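(* Let $\tau$ be in the upper half-plane and $\xi\in\mathbb{C}\setminus\bigl((-\infty,-1]\cup[1,\infty)\bigr)$ with $\xi/\tau\notin(-\infty,0]$. Put $q=e^{2\pi i\tau}$, $x=e^{2\pi i\xi}$, $q^*=e^{-2\pi i/\tau}$, $x^*=e^{2\pi i\xi/\tau}$. Then $$(x;q)_\infty=q^{-1/24}\,\sqrt{1-x}\;(x^*q^*;q^* )_\infty\,\exp\Bigl(\frac{\mathrm{Li}_2(x)}{\log q}+G(\tau,\xi)+P(\tau,\xi)\Bigr),$$ where $$G(\tau,\xi)=-\log\Gamma\Bigl(\frac\xi\tau+1\Bigr)+\Bigl(\frac\xi\tau+\frac12\Bigr)\log\frac\xi\tau-\frac\xi\tau+\log\sqrt{2\pi}.$$
   Context: $(x;q)_\infty=\prod_{n\ge0}(1-xq^n)$ for $|q|<1$. Here $\log q=2\pi i\tau$, $q^{-1/24}=e^{-\pi i\tau/12}$, $\sqrt{1-x}$ is the principal branch $e^{\frac12\log(1-x)}$, $\log$ is the principal branch, $\Gamma$ is Euler's Gamma function, and $\mathrm{Li}_2$ is the dilogarithm $\mathrm{Li}_2(x)=-\int_0^x\log(1-t)\frac{dt}{t}=\sum_{n\ge1}x^n/n^2$ (analytically continued). $P=P_-$ is defined as follows: for $d\in(-\pi,0)$ let $$P^d(\tau,\xi)=\int_0^{\infty e^{id}}\frac{\sin\bigl(\frac{\xi}{\tau}t\bigr)}{e^{it/\tau}-1}\Bigl(\cot\frac t2-\frac2t\Bigr)\frac{dt}{t},$$ integrated along the half-line from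 $0$ of argument $d$; it is analytic on $\Omega^d=\bigcup_{\sigma\in(0,\pi)}\{\tau:\arg\tau=d+\sigma\}\times\{\xi:|\Im(\xi e^{-i\sigma})|<\sin\sigma\}$, and $P_-$ is the analytic function on $\{\arg\tau\in(-\pi,\pi)\}\times\bigl(\mathbb{C}\setminus((-\infty,-1]\cup[1,\infty))\bigr)$ agreeing with $P^d$ on $\Omega^d$ for each $d\in(-\pi,0)$.
   Formalization: √(1−x) and Li₂(x) are continued analytically in ξ from Im ξ>0 (principal branches fail for some Im ξ<0), and P is taken on any open connected domain between the union of the Ω^d and the stated product, since P cannot be analytic on all of it (at ξ=1+τ the formula would force 0≠0). *)

theory Defs
  imports "HOL-Complex_Analysis.Complex_Analysis"
begin

definition qpoch_inf :: "complex \<Rightarrow> complex \<Rightarrow> complex" where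
  "qpoch_inf x q = (\<Prod>n. 1 - x * q ^ n)"

definition real_cuts :: "complex set" where
  "real_cuts = of_real ` ({..-1} \<union> {1..})"

definition xi_domain :: "complex \<Rightarrow> complex set" where
  "xi_domain \<tau> = {\<xi>. \<xi> \<notin> real_cuts \<and> \<xi> / \<tau> \<notin> \<real>\<^sub>\<le>\<^sub>0}"

definition analytic_continuation ::
  "(complex \<Rightarrow> complex) \<Rightarrow> complex set \<Rightarrow> complex set \<Rightarrow> complex \<Rightarrow> complex" where
  "analytic_continuation f U D = (SOME F. F holomorphic_on D \<and> (\<forall>z\<in>U. F z = f z))"

text \<open>
  The branches of \<open>log (1 - x)\<close> and \<open>Li\<^sub>2 x\<close> at \<open>x = exp (2 \<pi> i \<xi>)\<close> are the principal ones
  for \<open>\<bar>x\<bar> < 1\<close>, i.e. \<open>Im \<xi> > 0\<close>, continued analytically in \<open>\<xi>\<close> to \<open>xi_domain \<tau>\<close>. For \<open>Im \<tau> > 0\<close>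
  this set is simply connected, contains the upper half-plane and contains no integer, so \<open>x = 1\<close>
  does not occur and the continuations exist and are unique.
  The functions \<open>Ln (1 - x)\<close> and principal \<open>Li\<^sub>2 x\<close> themselves jump where \<open>x > 1\<close>, that is on the
  half-lines \<open>Re \<xi> \<in> \<int>\<close>, \<open>Im \<xi> \<le> 0\<close>, which meet \<open>xi_domain \<tau>\<close>; the other factors of the product
  formula are analytic there.
\<close>

definition log_one_minus_x :: "complex \<Rightarrow> complex \<Rightarrow> complex" where
  "log_one_minus_x \<tau> =
     analytic_continuation (\<lambda>\<xi>. Ln (1 - exp (2 * of_real pi * \<i> * \<xi>))) {\<xi>. Im \<xi> > 0} (xi_domain \<tau>)"

definition sqrt_one_minus_x :: "complex \<Rightarrow> complex \<Rightarrow> complex" where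
  "sqrt_one_minus_x \<tau> \<xi> = exp (log_one_minus_x \<tau> \<xi> / 2)"

definition Li2_series :: "complex \<Rightarrow> complex" where
  "Li2_series x = (\<Sum>n. x ^ Suc n / of_nat (Suc n) ^ 2)"

definition Li2_x :: "complex \<Rightarrow> complex \<Rightarrow> complex" where
  "Li2_x \<tau> =
     analytic_continuation (\<lambda>\<xi>. Li2_series (exp (2 * of_real pi * \<i> * \<xi>))) {\<xi>. Im \<xi> > 0} (xi_domain \<tau>)"

definition G_fun :: "complex \<Rightarrow> complex \<Rightarrow> complex" where
  "G_fun \<tau> \<xi> = - ln_Gamma (\<xi> / \<tau> + 1) + (\<xi> / \<tau> + 1 / 2) * Ln (\<xi> / \<tau>) - \<xi> / \<tau>
     + of_real (ln (sqrt (2 * pi)))"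

definition P_ray :: "real \<Rightarrow> complex \<Rightarrow> complex \<Rightarrow> complex" where
  "P_ray d \<tau> \<xi> = integral {0..} (\<lambda>r. let t = of_real r * cis d in
     sin (\<xi> / \<tau> * t) / (exp (\<i> * t / \<tau>) - 1) * (cot (t / 2) - 2 / t) / t * cis d)"

definition Omega_ray :: "real \<Rightarrow> (complex \<times> complex) set" where
  "Omega_ray d = (\<Union>\<sigma>\<in>{0<..<pi}.
     {\<tau>. \<tau> \<noteq> 0 \<and> Arg \<tau> = d + \<sigma>} \<times> {\<xi>. \<bar>Im (\<xi> * cis (- \<sigma>))\<bar> < sin \<sigma>})"

definition holomorphic2_on :: "(complex \<Rightarrow> complex \<Rightarrow> complex) \<Rightarrow> (complex \<times> complex) set \<Rightarrow> bool" where
  "holomorphic2_on f W \<longleftrightarrow>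
     (\<forall>p\<in>W. \<exists>a b. ((\<lambda>(z, w). f z w) has_derivative (\<lambda>(h, k). a * h + b * k)) (at p))"

text \<open>
  \<open>P\<close> is the function \<open>P\<^sub>-\<close>, considered on the domain \<open>W\<close>; the identity theorem makes it unique there.
  The smallest admissible \<open>W\<close> is the union of the sets \<open>Omega_ray d\<close>. \<open>W\<close> is a parameter because
  \<open>P\<^sub>-\<close> has logarithmic singularities at the points \<open>\<xi> = \<plusminus>(n + m \<tau>)\<close>, \<open>n, m \<ge> 1\<close>, so that it does not
  extend to all of \<open>(- \<real>\<^sub>\<le>\<^sub>0) \<times> (- real_cuts)\<close>.
\<close>

definition is_P_minus_on :: "(complex \<times> complex) set \<Rightarrow> (complex \<Rightarrow> complex \<Rightarrow> complex) \<Rightarrow> bool" where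
  "is_P_minus_on W P \<longleftrightarrow>
     open W \<and> connected W \<and>
     (\<Union>d\<in>{-pi<..<0}. Omega_ray d) \<subseteq> W \<and> W \<subseteq> (- \<real>\<^sub>\<le>\<^sub>0) \<times> (- real_cuts) \<and>
     holomorphic2_on P W \<and>
     (\<forall>d\<in>{-pi<..<0}. \<forall>(\<tau>, \<xi>)\<in>Omega_ray d. P \<tau> \<xi> = P_ray d \<tau> \<xi>)"

end

theory Submission
  imports Defs "HOL-Real_Asymp.Real_Asymp"
begin

text \<open>
  Write \<open>z = \<xi> / \<tau>\<close>. On the ray of argument \<open>- \<pi> / 2\<close> the function \<open>P\<close> is
  \<open>\<integral>\<^sub>0\<^sup>\<infinity> sinh (z r) / (exp (r / \<tau>) - 1) (coth (r / 2) - 2 / r) dr / r\<close>.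
  Increasing \<open>\<xi>\<close> by \<open>1\<close> cancels the first denominator and leaves two of Binet's integrals for \<open>log \<Gamma>\<close>;
  increasing \<open>\<xi>\<close> by \<open>\<tau>\<close> cancels the second one and leaves integrals for
  \<open>log \<Gamma>(1 + \<xi>) + log \<Gamma>(1 - \<xi>)\<close> and its primitive, which also describe \<open>log (1 - x)\<close> and \<open>Li\<^sub>2 x\<close>.
  So both sides of the product formula satisfy the same two difference equations. If \<open>Re (1 / \<tau>) = 1\<close>,
  the shift \<open>\<xi> \<mapsto> \<xi> + \<tau> - 1\<close> preserves the line \<open>Re z = 1 / 2\<close>, and along its iterates both sides
  tend to \<open>1\<close>: the Riemann-Lebesgue lemma gives \<open>P \<longlonglongrightarrow> \<pi> i \<tau> / 12\<close>. This proves the formula for these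
  \<open>\<tau>\<close> and \<open>\<xi>\<close>, and the rest is analytic continuation.
\<close>

section \<open>Integrals over the half-line\<close>

text \<open>With \<open>a = 1 / \<tau>\<close> the integral converges only for
  \<open>\<bar>Re z\<bar> < Re a\<close>, so neither of the two shifts,
  \<open>z \<mapsto> z + a\<close> and \<open>z \<mapsto> z + 1\<close>, can be iterated for ever.
  Their combination \<open>z \<mapsto> z - a + 1\<close> can if \<open>Re a = 1\<close>: it is
  vertical and its intermediate point stays in the strip. Far up, both infinite products tend to 1,
  so the limit also fixes the multiplicative constant. The value pi i tau / 12 comes from the
  singular part of the integrand at 0, where coth(r/2) - 2/r is close to r/6 and 1/(exp(ar) - 1) to
  1/(ar): a Dirichlet integral with factor 1/(6a). The condition \<open>Re a = 1\<close> describes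
  only an arc of \<open>\<tau>\<close>. A real \<open>\<xi>\<close> in (0,1), however, lies in the
  strip for every \<open>\<tau>\<close> in the right half-plane, so for such \<open>\<xi>\<close>
  the arc suffices for the identity theorem in \<open>\<tau>\<close>. The square root, the
  dilogarithm and G each have a cut along \<open>\<xi> / \<tau> \<le> 0\<close>. Their logarithms
  are collected in the entire function \<open>rGamma\<close>, so that the difference of the two
  sides is holomorphic across this cut. Continuation in two variables is done along lines, one
  complex variable at a time.\<close>

abbreviation half_line_integral :: "(real \<Rightarrow> complex) \<Rightarrow> complex" where
  "half_line_integral f \<equiv> (LINT r:{0<..}|lborel. f r)"

abbreviation half_line_integrable :: "(real \<Rightarrow> complex) \<Rightarrow> bool" where
  "half_line_integrable f \<equiv> set_integrable lborel {0<..} f"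

lemma set_integrable_exp_decay:
  fixes \<delta> :: real
  assumes "\<delta> > 0"
  shows "set_integrable lborel {0<..} (\<lambda>r. C * exp (- \<delta> * r))"
proof -
  have "(\<lambda>x. exp (-\<delta>*x) :: real) absolutely_integrable_on {0..}"
    by (intro nonnegative_absolutely_integrable_1 integrable_on_exp_minus_to_infinity) (use assms in auto)
  then have "set_integrable lebesgue {0<..} (\<lambda>x. exp (-\<delta>*x) :: real)"
    by (rule set_integrable_subset) auto
  then have "set_integrable lborel {0<..} (\<lambda>x. exp (-\<delta>*x) :: real)"
    unfolding set_integrable_def
    by (subst integrable_completion[symmetric]) (auto intro!: borel_measurable_continuous_on_indicator continuous_intros)
  then show ?thesis by (intro set_integrable_mult_right)
qed

lemma half_line_measurable:
  fixes f :: "real \<Rightarrow> complex"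
  assumes "continuous_on {0<..} f"
  shows "(\<lambda>r. indicator {0<..} r *\<^sub>R f r) \<in> borel_measurable lborel"
  using borel_measurable_continuous_on_indicator[OF _ assms] by simp

lemma half_line_integrableI:
  fixes f :: "real \<Rightarrow> complex"
  assumes "continuous_on {0<..} f" "\<delta> > 0" "\<And>r. r > 0 \<Longrightarrow> norm (f r) \<le> C * exp (- \<delta> * r)"
  shows "half_line_integrable f"
proof (rule set_integrable_bound[OF set_integrable_exp_decay[OF assms(2), of C]])
  show "set_borel_measurable lborel {0<..} f"
    using half_line_measurable[OF assms(1)] by (simp add: set_borel_measurable_def)
  show "AE x in lborel. x \<in> {0<..} \<longrightarrow> norm (f x) \<le> norm (C * exp (- \<delta> * x))"
    using assms(3) by (intro always_eventually) (force intro: order_trans[OF _ abs_ge_self])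
qed

lemma half_line_integral_dominated_convergence:
  fixes f :: "nat \<Rightarrow> real \<Rightarrow> complex"
  assumes "\<And>n. continuous_on {0<..} (f n)" "continuous_on {0<..} g" "\<delta> > 0"
    and "\<And>n r. r > 0 \<Longrightarrow> norm (f n r) \<le> C * exp (- \<delta> * r)"
    and "\<And>r. r > 0 \<Longrightarrow> (\<lambda>n. f n r) \<longlonglongrightarrow> g r"
  shows "(\<lambda>n. half_line_integral (f n)) \<longlonglongrightarrow> half_line_integral g"
  unfolding set_lebesgue_integral_def
proof (rule integral_dominated_convergence)
  show "integrable lborel (\<lambda>r. indicator {0<..} r *\<^sub>R (C * exp (- \<delta> * r)))"
    using set_integrable_exp_decay[OF assms(3), of C] unfolding set_integrable_def .
  show "AE x in lborel. (\<lambda>i. indicator {0<..} x *\<^sub>R f i x) \<longlonglongrightarrow> indicator {0<..} x *\<^sub>R g x"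
    using assms(5) by (intro always_eventually) (auto simp: indicator_def)
  show "AE x in lborel. norm (indicator {0<..} x *\<^sub>R f i x) \<le> indicator {0<..} x *\<^sub>R (C * exp (- \<delta> * x))" for i
    using assms(4) by (intro always_eventually) (auto simp: indicator_def)
qed (use half_line_measurable assms in auto)

text \<open>On a ball the mean value inequality bounds all difference quotients by the bound for
  \<open>f'\<close>, so dominated convergence along sequences applies.\<close>

lemma half_line_integral_has_field_derivative:
  fixes f f' :: "complex \<Rightarrow> real \<Rightarrow> complex"
  assumes "\<eta> > 0" "\<delta> > 0"
    and cont: "\<And>z. z \<in> ball z0 \<eta> \<Longrightarrow> continuous_on {0<..} (f z)"
    and cont': "continuous_on {0<..} (f' z0)"
    and int: "\<And>z. z \<in> ball z0 \<eta> \<Longrightarrow> half_line_integrable (f z)"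
    and der: "\<And>z r. z \<in> ball z0 \<eta> \<Longrightarrow> r > 0 \<Longrightarrow> ((\<lambda>z. f z r) has_field_derivative f' z r) (at z)"
    and bound: "\<And>z r. z \<in> ball z0 \<eta> \<Longrightarrow> r > 0 \<Longrightarrow> norm (f' z r) \<le> C * exp (- \<delta> * r)"
  shows "((\<lambda>z. half_line_integral (f z)) has_field_derivative half_line_integral (f' z0)) (at z0)"
  unfolding has_field_derivative_iff tendsto_at_iff_sequentially
proof (intro allI impI)
  fix X :: "nat \<Rightarrow> complex" assume X: "\<forall>i. X i \<in> UNIV - {z0}" "X \<longlonglongrightarrow> z0"
  then have "\<forall>\<^sub>F n in sequentially. X n \<in> ball z0 \<eta>"
    using \<open>\<eta> > 0\<close> by (intro topological_tendstoD[OF X(2)]) auto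
  then obtain N where N: "\<And>n. n \<ge> N \<Longrightarrow> X n \<in> ball z0 \<eta>"
    by (auto simp: eventually_sequentially)
  \<comment> \<open>The domination must hold for every index, so the terms outside the ball are
    dropped.\<close>
  define Y where "Y = (\<lambda>n. X (n + N))"
  have Y: "Y n \<in> ball z0 \<eta>" "Y n \<noteq> z0" for n using N X by (auto simp: Y_def)
  have Ylim: "Y \<longlonglongrightarrow> z0" using X(2) by (simp add: Y_def LIMSEQ_ignore_initial_segment)
  have z0: "z0 \<in> ball z0 \<eta>" using \<open>\<eta> > 0\<close> by simp
  have "(\<lambda>n. half_line_integral (\<lambda>r. (f (Y n) r - f z0 r) / (Y n - z0))) \<longlonglongrightarrow> half_line_integral (f' z0)"
  proof (rule half_line_integral_dominated_convergence[OF _ cont' \<open>\<delta> > 0\<close>])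
    show "continuous_on {0<..} (\<lambda>r. (f (Y n) r - f z0 r) / (Y n - z0))" for n
      using Y[of n] cont[OF Y(1)[of n]] cont[OF z0] by (intro continuous_intros) auto
    show "(\<lambda>n. (f (Y n) r - f z0 r) / (Y n - z0)) \<longlonglongrightarrow> f' z0 r" if "r > 0" for r
    proof -
      have "((\<lambda>y. (f y r - f z0 r) / (y - z0)) \<longlongrightarrow> f' z0 r) (at z0)"
        using der[OF z0 that] by (simp add: has_field_derivative_iff)
      then show ?thesis
        unfolding tendsto_at_iff_sequentially using Y(2) Ylim by (auto simp: comp_def)
    qed
    show "norm ((f (Y n) r - f z0 r) / (Y n - z0)) \<le> C * exp (- \<delta> * r)" if "r > 0" for n r
    proof -
      have "norm (f (Y n) r - f z0 r) \<le> (C * exp (- \<delta> * r)) * norm (Y n - z0)"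
        by (rule field_differentiable_bound[OF convex_ball _ _ Y(1) z0, where f' = "\<lambda>z. f' z r"])
           (use der bound that in \<open>auto intro: has_field_derivative_at_within\<close>)
      then show ?thesis using Y(2)[of n] by (simp add: norm_divide field_simps)
    qed
  qed
  also have "(\<lambda>n. half_line_integral (\<lambda>r. (f (Y n) r - f z0 r) / (Y n - z0))) =
      (\<lambda>n. (half_line_integral (f (Y n)) - half_line_integral (f z0)) / (Y n - z0))"
    using int[OF Y(1)] int[OF z0] by (intro ext) (simp add: set_integral_diff)
  finally have "(\<lambda>n. ((\<lambda>y. (half_line_integral (f y) - half_line_integral (f z0)) / (y - z0)) \<circ> X) (n + N)) \<longlonglongrightarrow> half_line_integral (f' z0)"
    by (simp add: Y_def comp_def)
  then show "((\<lambda>y. (half_line_integral (f y) - half_line_integral (f z0)) / (y - z0)) \<circ> X) \<longlonglongrightarrow> half_line_integral (f' z0)"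
    by (rule LIMSEQ_offset)
qed

lemma half_line_integral_exp:
  fixes c :: complex
  assumes "Re c > 0"
  shows "half_line_integrable (\<lambda>r. exp (- c * of_real r))" (is ?A)
    and "half_line_integral (\<lambda>r. exp (- c * of_real r)) = 1 / c" (is ?B)
proof -
  show int: ?A
    by (rule half_line_integrableI[of _ "Re c" 1]) (use assms in \<open>auto intro!: continuous_intros\<close>)
  have c: "c \<noteq> 0" using assms by auto
  have "(LBINT r=0..\<infinity>. exp (- c * of_real r)) = 0 - (- 1 / c)"
  proof (rule interval_integral_FTC_integrable[where F = "\<lambda>r. - exp (- c * of_real r) / c"])
    show "((\<lambda>r. - exp (- c * complex_of_real r) / c) has_vector_derivative exp (- c * complex_of_real x)) (at x)" for x
      by (rule has_vector_derivative_real_field) (use c in \<open>auto intro!: derivative_eq_intros\<close>)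
    show "isCont (\<lambda>r. exp (- c * complex_of_real r)) x" for x
      by (intro continuous_intros)
    have "((\<lambda>r. - exp (- c * complex_of_real r) / c) \<longlongrightarrow> - exp (- c * complex_of_real 0) / c) (at_right 0)"
      by (intro tendsto_intros) (use c in auto)
    then show "(((\<lambda>r. - exp (- c * complex_of_real r) / c) \<circ> real_of_ereal) \<longlongrightarrow> - 1 / c) (at_right 0)"
      by (simp add: ereal_tendsto_simps zero_ereal_def)
    have "((\<lambda>r. norm (- exp (- c * complex_of_real r) / c)) \<longlongrightarrow> 0) at_top"
    proof -
      have "((\<lambda>r::real. exp (- (Re c * r)) / cmod c) \<longlongrightarrow> 0 / cmod c) at_top"
        using assms by (intro tendsto_divide tendsto_const) (real_asymp, use c in auto)
      then show ?thesis by (simp add: norm_divide)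
    qed
    then have "((\<lambda>r. - exp (- c * complex_of_real r) / c) \<longlongrightarrow> 0) at_top"
      by (rule tendsto_norm_zero_cancel)
    then show "(((\<lambda>r. - exp (- c * complex_of_real r) / c) \<circ> real_of_ereal) \<longlongrightarrow> 0) (at_left \<infinity>)"
      by (simp add: ereal_tendsto_simps)
  qed (use int in \<open>auto simp: zero_ereal_def\<close>)
  then show ?B
    by (simp add: zero_ereal_def interval_integral_to_infinity_eq)
qed

text \<open>Pays for a factor \<open>r\<close> with half of the decay rate.\<close>

lemma le_exp_mult_half: "(r::real) \<le> 2 / \<delta> * exp (\<delta> / 2 * r)" if "\<delta> > 0"
proof -
  have "\<delta> / 2 * r \<le> exp (\<delta> / 2 * r)" using exp_ge_add_one_self[of "\<delta> / 2 * r"] by linarith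
  then show ?thesis using that by (simp add: field_simps)
qed

text \<open>The integral of \<open>exp (- c r)\<close> is differentiated in \<open>c\<close> in two
  ways, under the integral sign and as \<open>1 / c\<close>.\<close>

lemma half_line_integral_mult_exp:
  fixes c :: complex
  assumes "Re c > 0"
  shows "half_line_integrable (\<lambda>r. of_real r * exp (- c * of_real r))" (is ?A)
    and "half_line_integral (\<lambda>r. of_real r * exp (- c * of_real r)) = 1 / c ^ 2" (is ?B)
proof -
  define \<delta> where "\<delta> = Re c / 2"
  have \<delta>: "\<delta> > 0" using assms by (simp add: \<delta>_def)
  have bd: "norm (of_real r * exp (- z * of_real r)) \<le> 2 / \<delta> * exp (- (\<delta> / 2) * r)"
    if "z \<in> ball c \<delta>" "r > 0" for z r
  proof -
    have "\<bar>Re (c - z)\<bar> < \<delta>"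
      using that abs_Re_le_cmod[of "c - z"] by (simp add: dist_norm)
    then have "Re z \<ge> \<delta>" by (simp add: \<delta>_def abs_if split: if_splits)
    then have "exp (- Re z * r) \<le> exp (- \<delta> * r)" using that by simp
    then have "r * exp (- Re z * r) \<le> (2 / \<delta> * exp (\<delta> / 2 * r)) * exp (- \<delta> * r)"
      using that le_exp_mult_half[OF \<delta>, of r] \<delta> by (intro mult_mono) auto
    also have "\<dots> = 2 / \<delta> * exp (- (\<delta> / 2) * r)"
      by (simp add: exp_add[symmetric] field_simps)
    finally show ?thesis using that by (simp add: norm_mult)
  qed
  show int: ?A
    by (rule half_line_integrableI[of _ "\<delta> / 2" "2 / \<delta>"]) (use \<delta> bd[of c] in \<open>auto intro!: continuous_intros\<close>)
  have "((\<lambda>z. half_line_integral (\<lambda>r. exp (- z * of_real r))) has_field_derivative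
       half_line_integral (\<lambda>r. - (of_real r * exp (- c * of_real r)))) (at c)"
  proof (rule half_line_integral_has_field_derivative[of \<delta> "\<delta> / 2", where C = "2 / \<delta>"])
    show "half_line_integrable (\<lambda>r. exp (- z * of_real r))" if "z \<in> ball c \<delta>" for z
      using that abs_Re_le_cmod[of "c - z"] by (intro half_line_integral_exp) (auto simp: dist_norm \<delta>_def)
    show "((\<lambda>z. exp (- z * of_real r)) has_field_derivative - (of_real r * exp (- z * of_real r))) (at z)" for z r
      by (auto intro!: derivative_eq_intros)
  qed (use \<delta> bd in \<open>auto intro!: continuous_intros\<close>)
  moreover have "((\<lambda>z. half_line_integral (\<lambda>r. exp (- z * of_real r))) has_field_derivative - (1 / c ^ 2)) (at c)"
  proof (rule has_field_derivative_transform_within_open[where S = "{z. Re z > 0}" and f = "\<lambda>z. 1 / z"])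
    show "((\<lambda>z. 1 / z) has_field_derivative - (1 / c ^ 2)) (at c)"
      using assms by (auto intro!: derivative_eq_intros simp: power2_eq_square)
  qed (use assms half_line_integral_exp in \<open>auto simp: open_halfspace_Re_gt\<close>)
  ultimately have "half_line_integral (\<lambda>r. - (of_real r * exp (- c * of_real r))) = - (1 / c ^ 2)"
    by (rule DERIV_unique)
  then show ?B by (simp add: set_lebesgue_integral_def)
qed

text \<open>Limits at both ends leave a compact interval in between. For the kernels below the
  limits are computed from asymptotic expansions.\<close>

lemma bounded_on_half_line:
  fixes g :: "real \<Rightarrow> real"
  assumes "continuous_on {0<..} g" "(g \<longlongrightarrow> l) (at_right 0)" "(g \<longlongrightarrow> m) at_top"
  obtains C where "C > 0" "\<And>r. r > 0 \<Longrightarrow> \<bar>g r\<bar> \<le> C"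
proof -
  have "\<forall>\<^sub>F r in at_right 0. \<bar>g r - l\<bar> < 1" "\<forall>\<^sub>F r in at_top. \<bar>g r - m\<bar> < 1"
    using tendstoD[OF assms(2), of 1] tendstoD[OF assms(3), of 1] by (auto simp: dist_real_def)
  then obtain p q where p: "p > 0" "\<And>r. 0 < r \<Longrightarrow> r < p \<Longrightarrow> \<bar>g r - l\<bar> < 1"
    and q: "\<And>r. r \<ge> q \<Longrightarrow> \<bar>g r - m\<bar> < 1"
    unfolding eventually_at_right[OF zero_less_one] eventually_at_top_linorder
    using zero_less_one by (auto simp: eventually_at_right_field)
  have "compact (g ` {p..q})"
    using p(1) by (intro compact_continuous_image continuous_on_subset[OF assms(1)]) auto
  then have "\<exists>D. \<forall>r\<in>{p..q}. \<bar>g r\<bar> \<le> D"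
    using compact_imp_bounded[of "g ` {p..q}"] by (auto simp: bounded_iff)
  then obtain D where D: "\<And>r. r \<in> {p..q} \<Longrightarrow> \<bar>g r\<bar> \<le> D" by blast
  show thesis
  proof (rule that[of "\<bar>l\<bar> + \<bar>m\<bar> + \<bar>D\<bar> + 1"])
    fix r :: real assume "r > 0"
    then consider "r < p" | "r \<ge> q" | "r \<in> {p..q}" by fastforce
    then show "\<bar>g r\<bar> \<le> \<bar>l\<bar> + \<bar>m\<bar> + \<bar>D\<bar> + 1"
      using p(2)[of r] q[of r] D[of r] \<open>r > 0\<close> by cases fastforce+
  qed auto
qed

section \<open>Binet's formula\<close>

text \<open>Twice this function is coth(r/2) - 2/r, so the same kernel occurs in Binet's integral
  and in P.\<close>

definition binet_kernel :: "real \<Rightarrow> real" where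
  "binet_kernel r = 1 / 2 - 1 / r + 1 / (exp r - 1)"

lemma continuous_binet_kernel [continuous_intros]: "continuous_on {0<..} binet_kernel"
  unfolding binet_kernel_def by (auto intro!: continuous_intros)

lemma binet_kernel_bounded:
  obtains C where "C > 0" "\<And>r. r > 0 \<Longrightarrow> \<bar>binet_kernel r\<bar> \<le> C"
proof (rule bounded_on_half_line[OF continuous_binet_kernel])
  show "(binet_kernel \<longlongrightarrow> 0) (at_right 0)" unfolding binet_kernel_def by real_asymp
  show "(binet_kernel \<longlongrightarrow> 1/2) at_top" unfolding binet_kernel_def by real_asymp
qed (rule that)

lemma binet_kernel_linear_bound:
  obtains C where "C > 0" "\<And>r. r > 0 \<Longrightarrow> \<bar>binet_kernel r / r\<bar> \<le> C"
proof (rule bounded_on_half_line)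
  show "continuous_on {0<..} (\<lambda>r. binet_kernel r / r)"
    by (auto intro!: continuous_intros)
  show "((\<lambda>r. binet_kernel r / r) \<longlongrightarrow> 1/12) (at_right 0)" unfolding binet_kernel_def by real_asymp
  show "((\<lambda>r. binet_kernel r / r) \<longlongrightarrow> 0) at_top" unfolding binet_kernel_def by real_asymp
qed (rule that)

text \<open>The kernel starts with r/12. An error of order \<open>r\<close> is what later cancels
  the pole of 1/(exp(ar) - 1).\<close>

lemma binet_kernel_quadratic_bound:
  obtains C where "C > 0" "\<And>r. r > 0 \<Longrightarrow> \<bar>2 * binet_kernel r / r - 1 / 6\<bar> \<le> C * r"
proof (rule bounded_on_half_line)
  show "continuous_on {0<..} (\<lambda>r. (2 * binet_kernel r / r - 1 / 6) / r)"
    by (auto intro!: continuous_intros)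
  show "((\<lambda>r. (2 * binet_kernel r / r - 1 / 6) / r) \<longlongrightarrow> 0) (at_right 0)" unfolding binet_kernel_def by real_asymp
  show "((\<lambda>r. (2 * binet_kernel r / r - 1 / 6) / r) \<longlongrightarrow> 0) at_top" unfolding binet_kernel_def by real_asymp
next
  fix C :: real assume "C > 0" "\<And>r. r > 0 \<Longrightarrow> \<bar>(2 * binet_kernel r / r - 1 / 6) / r\<bar> \<le> C"
  then show thesis by (intro that[of C]) (auto simp: abs_divide pos_divide_le_eq)
qed

section \<open>The denominators exp(ar) - 1 and the trigamma integral\<close>

lemma one_add_mult_exp_neg_le:
  fixes r \<eta> :: real
  assumes "0 < \<eta>" "\<eta> \<le> 1" "r > 0"
  shows "(1 + r) * exp (- r) \<le> exp (- (1 - \<eta>) * r) / \<eta>"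
proof -
  have "\<eta> * (1 + r) \<le> 1 + \<eta> * r" using assms by (simp add: algebra_simps)
  also have "\<dots> \<le> exp (\<eta> * r)" by simp
  finally have "\<eta> * (1 + r) * exp (-r) \<le> exp (\<eta> * r) * exp (-r)"
    by (intro mult_right_mono) auto
  then show ?thesis using assms by (simp add: exp_add[symmetric] field_simps)
qed

text \<open>Clearing denominators leaves \<open>1 + r \<le> exp r\<close>.\<close>

lemma div_exp_minus_one_le:
  fixes r :: real
  assumes "r > 0"
  shows "r / (exp r - 1) \<le> (1 + r) * exp (- r)"
proof -
  have "exp r > 1" "1 + r \<le> exp r" using assms by auto
  then show ?thesis using assms by (simp add: field_simps exp_minus)
qed

lemma div_exp_minus_one_le':
  fixes r \<eta> :: real
  assumes "0 < \<eta>" "\<eta> \<le> 1" "r > 0"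
  shows "r / (exp r - 1) \<le> exp (- (1 - \<eta>) * r) / \<eta>"
  by (rule order_trans[OF div_exp_minus_one_le one_add_mult_exp_neg_le]) (use assms in auto)

text \<open>The normalisation \<open>Re a = 1\<close> makes \<open>exp r\<close> the modulus of
  \<open>exp (a r)\<close>, so complex denominators are controlled by the real one.\<close>

lemma norm_exp_minus_one_ge:
  fixes a :: complex
  assumes "Re a = 1"
  shows "norm (exp (a * of_real r) - 1) \<ge> exp r - 1"
  using norm_triangle_ineq2[of "exp (a * of_real r)" 1] assms by simp

text \<open>Expanding 1/(exp(ar) - 1) into a geometric series and integrating termwise gives the sum
  of 1/(ka + w)^2 over k \<ge> 1, a trigamma series up to the factor a^2.\<close>

lemma half_line_integral_trigamma:
  fixes a w :: complex
  assumes a: "Re a = 1" and w: "Re w > -1"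
  defines "f \<equiv> \<lambda>r. of_real r * exp (- w * of_real r) / (exp (a * of_real r) - 1)"
  shows "half_line_integrable f" "half_line_integral f = Polygamma 1 (1 + w / a) / a ^ 2"
proof -
  \<comment> \<open>Chosen so that the rate \<open>1 - \<eta> + Re w\<close> left after the bound
    for \<open>r / (exp r - 1)\<close> is still at least \<open>\<eta>\<close>.\<close>
  define \<eta> where "\<eta> = min 1 ((1 + Re w) / 2)"
  have \<eta>: "0 < \<eta>" "\<eta> \<le> 1" "\<eta> \<le> (1 + Re w) / 2" using w by (auto simp: \<eta>_def min_def)
  have a0: "a \<noteq> 0" using a by auto
  have e0: "exp (a * of_real r) - 1 \<noteq> 0" if "r > 0" for r
  proof
    assume "exp (a * of_real r) - 1 = 0"
    then have "norm (exp (a * of_real r) - 1) = 0" by (simp only: norm_zero)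
    then have "exp r \<le> 1" using norm_exp_minus_one_ge[OF a, of r] by linarith
    then show False using that by simp
  qed
  have cont: "continuous_on {0<..} f"
    unfolding f_def using e0 by (auto intro!: continuous_intros)
  have B: "r * exp (- Re w * r) / (exp r - 1) \<le> 1 / \<eta> * exp (- \<eta> * r)" if "r > 0" for r
  proof -
    have "r * exp (- Re w * r) / (exp r - 1) = r / (exp r - 1) * exp (- Re w * r)" by simp
    also have "\<dots> \<le> exp (- (1 - \<eta>) * r) / \<eta> * exp (- Re w * r)"
      using div_exp_minus_one_le'[OF \<eta>(1,2) that] by (intro mult_right_mono) auto
    also have "\<dots> = 1 / \<eta> * exp (- (1 - \<eta> + Re w) * r)" by (simp add: exp_add[symmetric] algebra_simps)
    also have "\<dots> \<le> 1 / \<eta> * exp (- \<eta> * r)"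
      using \<eta> that by (intro mult_left_mono iffD2[OF exp_le_cancel_iff] mult_right_mono) auto
    finally show ?thesis .
  qed
  have "norm (f r) \<le> 1 / \<eta> * exp (- \<eta> * r)" if "r > 0" for r
  proof -
    have "norm (f r) \<le> r * exp (- Re w * r) / (exp r - 1)"
    proof -
      have "exp r - 1 > 0" using that by simp
      moreover have "norm (f r) = r * exp (- Re w * r) / norm (exp (a * of_real r) - 1)"
        using that by (simp add: f_def norm_mult norm_divide)
      ultimately show ?thesis
        using norm_exp_minus_one_ge[OF a, of r] that
        by (simp only:) (intro divide_left_mono mult_pos_pos mult_nonneg_nonneg, auto)
    qed
    also note B[OF that]
    finally show ?thesis .
  qed
  then show "half_line_integrable f"
    using half_line_integrableI[OF cont \<eta>(1)] by blast
  \<comment> \<open>\<open>Suc k\<close>, because the geometric series starts with exp(-ar).\<close>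
  define g where "g = (\<lambda>k r. of_real r * exp (- (of_nat (Suc k) * a + w) * of_real r))"
  have re: "Re (of_nat (Suc k) * a + w) > 0" for k using a w by (simp add: algebra_simps)
  have gk: "half_line_integrable (g k)" "half_line_integral (g k) = 1 / (of_nat (Suc k) * a + w) ^ 2" for k
    unfolding g_def using half_line_integral_mult_exp[OF re[of k]] by auto
  have geq: "g k r = of_real r * exp (- w * of_real r) * exp (- (a * of_real r)) ^ Suc k" for k r
    by (simp only: exp_of_nat_mult[symmetric] g_def mult.assoc mult_exp_exp) (simp add: algebra_simps)
  \<comment> \<open>Stated for an arbitrary field, since it sums the complex series and its real
    majorant. At \<open>E = 1\<close> both sides are 0 by division by zero.\<close>
  have inv: "inverse E * (1 / (1 - inverse E)) = 1 / (E - 1)" if "E \<noteq> 0" for E :: "'b :: field"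
    using that by (cases "E = 1") (simp_all add: field_simps)
  have "(\<lambda>n. half_line_integral (\<lambda>r. \<Sum>k<n. g k r)) \<longlonglongrightarrow> half_line_integral f"
  proof (rule half_line_integral_dominated_convergence[OF _ cont \<eta>(1)])
    show "continuous_on {0<..} (\<lambda>r. \<Sum>k<n. g k r)" for n
      unfolding g_def by (intro continuous_intros)
    fix r :: real assume r: "r > 0"
    have lt: "norm (exp (- (a * of_real r))) < 1" using r a by simp
    have "(\<lambda>k. exp (- (a * of_real r)) ^ k) sums (1 / (1 - exp (- (a * of_real r))))"
      using geometric_sums[OF lt] .
    then have "(\<lambda>k. of_real r * exp (- w * of_real r) * exp (- (a * of_real r)) * exp (- (a * of_real r)) ^ k) sums
       (of_real r * exp (- w * of_real r) * exp (- (a * of_real r)) * (1 / (1 - exp (- (a * of_real r)))))"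
      by (rule sums_mult)
    also have "(\<lambda>k. of_real r * exp (- w * of_real r) * exp (- (a * of_real r)) * exp (- (a * of_real r)) ^ k) = (\<lambda>k. g k r)"
      by (simp add: geq mult_ac)
    also have "of_real r * exp (- w * of_real r) * exp (- (a * of_real r)) * (1 / (1 - exp (- (a * of_real r)))) = f r"
      unfolding f_def exp_minus[of "a * _"] mult.assoc inv[OF exp_not_eq_zero] by simp
    finally show "(\<lambda>n. \<Sum>k<n. g k r) \<longlonglongrightarrow> f r" by (simp add: sums_def)
    show "norm (\<Sum>k<n. g k r) \<le> 1 / \<eta> * exp (- \<eta> * r)" for n
    proof -
      have "norm (\<Sum>k<n. g k r) \<le> (\<Sum>k<n. norm (g k r))" by (rule norm_sum)
      also have "\<dots> = (\<Sum>k<n. r * exp (- Re w * r) * exp (-r) * exp (-r) ^ k)"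
        using r a by (intro sum.cong) (auto simp: geq norm_mult norm_power)
      also have "\<dots> \<le> (\<Sum>k. r * exp (- Re w * r) * exp (-r) * exp (-r) ^ k)"
        using r by (intro sum_le_suminf summable_mult summable_geometric) auto
      also have "\<dots> = r * exp (- Re w * r) * exp (-r) * (1 / (1 - exp (-r)))"
        using r by (subst suminf_mult) (auto intro!: summable_geometric simp: suminf_geometric)
      also have "\<dots> = r * exp (- Re w * r) / (exp r - 1)"
        unfolding exp_minus[of r] mult.assoc inv[OF exp_not_eq_zero] by simp
      also note B[OF r]
      finally show ?thesis .
    qed
  qed
  also have "(\<lambda>n. half_line_integral (\<lambda>r. \<Sum>k<n. g k r)) = (\<lambda>n. \<Sum>k<n. 1 / (of_nat (Suc k) * a + w) ^ 2)"
  proof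
    fix n show "half_line_integral (\<lambda>r. \<Sum>k<n. g k r) = (\<Sum>k<n. 1 / (of_nat (Suc k) * a + w) ^ 2)"
      using gk unfolding set_lebesgue_integral_def set_integrable_def scaleR_sum_right
      by (subst Bochner_Integration.integral_sum) auto
  qed
  finally have s1: "(\<lambda>k. 1 / (of_nat (Suc k) * a + w) ^ 2) sums half_line_integral f"
    by (simp add: sums_def)
  have eq: "1 / (of_nat (Suc k) * a + w) ^ 2 = inverse ((1 + w / a + of_nat k) ^ 2) / a ^ 2" for k
  proof -
    have "of_nat (Suc k) * a + w = a * (1 + w / a + of_nat k)" using a0 by (simp add: field_simps)
    then show ?thesis by (simp only: power_mult_distrib) (simp add: field_simps)
  qed
  have "half_line_integral f * a ^ 2 = (\<Sum>k. inverse ((1 + w / a + of_nat k) ^ 2))"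
    using sums_mult2[OF s1, of "a ^ 2"] a0 unfolding eq by (simp add: sums_iff)
  also have "\<dots> = Polygamma 1 (1 + w / a)"
    by (simp add: Polygamma_def numeral_2_eq_2)
  finally show "half_line_integral f = Polygamma 1 (1 + w / a) / a ^ 2"
    using a0 by (simp add: field_simps)
qed

section \<open>Binet's integral and the Stirling remainder\<close>

lemma laplace_has_field_derivative:
  fixes g :: "real \<Rightarrow> real" and z :: complex
  assumes "continuous_on {0<..} g" "\<And>r. r > 0 \<Longrightarrow> \<bar>g r\<bar> \<le> C" "C > 0" "Re z > 0"
  shows "half_line_integrable (\<lambda>r. of_real (g r) * exp (- z * of_real r))"
    and "((\<lambda>z. half_line_integral (\<lambda>r. of_real (g r) * exp (- z * of_real r))) has_field_derivative
          - half_line_integral (\<lambda>r. of_real (r * g r) * exp (- z * of_real r))) (at z)"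
proof -
  define \<delta> where "\<delta> = Re z / 2"
  have \<delta>: "\<delta> > 0" using assms by (simp add: \<delta>_def)
  have int: "half_line_integrable (\<lambda>r. of_real (g r) * exp (- z * of_real r))" if "Re z > 0" for z
    by (rule half_line_integrableI[of _ "Re z" C])
       (use assms(1-3) that in \<open>auto intro!: continuous_intros mult_mono simp: norm_mult\<close>)
  show "half_line_integrable (\<lambda>r. of_real (g r) * exp (- z * of_real r))" using int assms(4) .
  have ballD: "Re w \<ge> \<delta>" if "w \<in> ball z \<delta>" for w
    using that abs_Re_le_cmod[of "z - w"] by (simp add: dist_norm \<delta>_def abs_if split: if_splits)
  have "((\<lambda>z. half_line_integral (\<lambda>r. of_real (g r) * exp (- z * of_real r))) has_field_derivative
          half_line_integral (\<lambda>r. - (of_real (r * g r) * exp (- z * of_real r)))) (at z)"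
  proof (rule half_line_integral_has_field_derivative[of \<delta> "\<delta> / 2", where C = "C * (2 / \<delta>)"])
    fix w assume w: "w \<in> ball z \<delta>"
    show "half_line_integrable (\<lambda>r. of_real (g r) * exp (- w * of_real r))"
      using ballD[OF w] \<delta> by (intro int) auto
    fix r :: real assume r: "r > 0"
    show "((\<lambda>z. of_real (g r) * exp (- z * of_real r)) has_field_derivative - (of_real (r * g r) * exp (- w * of_real r))) (at w)"
      by (auto intro!: derivative_eq_intros)
    have "norm (- (of_real (r * g r) * exp (- w * of_real r))) = \<bar>g r\<bar> * (r * exp (- Re w * r))"
      using r by (simp add: norm_mult)
    also have "\<dots> \<le> C * ((2 / \<delta> * exp (\<delta> / 2 * r)) * exp (- \<delta> * r))"
      using r ballD[OF w] assms(2)[OF r] le_exp_mult_half[OF \<delta>, of r] assms(3) \<delta> by (intro mult_mono) auto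
    also have "\<dots> = C * (2 / \<delta>) * exp (- (\<delta> / 2) * r)"
      by (simp add: exp_add[symmetric] field_simps)
    finally show "norm (- (of_real (r * g r) * exp (- w * of_real r))) \<le> C * (2 / \<delta>) * exp (- (\<delta> / 2) * r)" .
  qed (use \<delta> assms(1) in \<open>auto intro!: continuous_intros\<close>)
  then show "((\<lambda>z. half_line_integral (\<lambda>r. of_real (g r) * exp (- z * of_real r))) has_field_derivative
          - half_line_integral (\<lambda>r. of_real (r * g r) * exp (- z * of_real r))) (at z)"
    by (simp add: set_lebesgue_integral_def)
qed

definition binet_integral :: "complex \<Rightarrow> complex" where
  "binet_integral z = half_line_integral (\<lambda>r. of_real (binet_kernel r / r) * exp (- z * of_real r))"

text \<open>The error term of Stirling's formula. By \<open>exp_G_fun\<close> it is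
  \<open>- G_fun\<close> at \<open>z = \<xi> / \<tau>\<close> up to multiples of 2 pi i.\<close>

definition stirling_remainder :: "complex \<Rightarrow> complex" where
  "stirling_remainder z = ln_Gamma z - (z - 1 / 2) * Ln z + z - of_real (ln (2 * pi) / 2)"

lemma binet_integral_integrable:
  "Re z > 0 \<Longrightarrow> half_line_integrable (\<lambda>r. of_real (binet_kernel r / r) * exp (- z * of_real r))"
proof -
  assume z: "Re z > 0"
  obtain C where "C > 0" "\<And>r. r > 0 \<Longrightarrow> \<bar>binet_kernel r / r\<bar> \<le> C"
    using binet_kernel_linear_bound by blast
  then show ?thesis
    using z by (intro laplace_has_field_derivative(1)[where C = C]) (auto intro!: continuous_intros)
qed

text \<open>This is the second derivative of Binet's integral; the kernel times \<open>r\<close>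
  splits into three Laplace transforms already known.\<close>

lemma half_line_integral_mult_binet_kernel:
  assumes "Re z > 0"
  shows "half_line_integral (\<lambda>r. of_real (r * binet_kernel r) * exp (- z * of_real r)) =
           1 / (2 * z ^ 2) - 1 / z + Polygamma 1 (1 + z)"
proof -
  have "half_line_integral (\<lambda>r. of_real (r * binet_kernel r) * exp (- z * of_real r)) =
     half_line_integral (\<lambda>r. 1 / 2 * (of_real r * exp (- z * of_real r)) - exp (- z * of_real r) +
        of_real r * exp (- z * of_real r) / (exp (1 * of_real r) - 1))"
    by (rule set_lebesgue_integral_cong)
       (auto simp: binet_kernel_def algebra_simps divide_simps exp_of_real of_real_exp[symmetric] simp del: of_real_exp)
  also have "\<dots> = 1 / 2 * (1 / z ^ 2) - 1 / z + Polygamma 1 (1 + z / 1) / 1 ^ 2"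
    using half_line_integral_mult_exp[OF assms] half_line_integral_exp[OF assms]
      half_line_integral_trigamma[of 1 z] assms
    by (subst set_integral_add; (subst set_integral_diff)?) (auto intro!: set_integrable_mult_right)
  finally show ?thesis by simp
qed

lemma binet_integral_tendsto_0:
  assumes "filterlim X at_top sequentially"
  shows "(\<lambda>n. binet_integral (of_real (X n))) \<longlonglongrightarrow> 0"
proof -
  from assms have "\<forall>\<^sub>F n in sequentially. X n \<ge> 1" by (simp add: filterlim_at_top)
  then obtain N where N: "\<And>n. n \<ge> N \<Longrightarrow> X n \<ge> 1" by (auto simp: eventually_sequentially)
  obtain C where C: "C > 0" "\<And>r. r > 0 \<Longrightarrow> \<bar>binet_kernel r / r\<bar> \<le> C"
    using binet_kernel_linear_bound by blast
  have "(\<lambda>n. half_line_integral (\<lambda>r. of_real (binet_kernel r / r) * exp (- of_real (X (n + N)) * of_real r)))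
      \<longlonglongrightarrow> half_line_integral (\<lambda>_. 0)"
  proof (rule half_line_integral_dominated_convergence[where \<delta> = 1 and C = C])
    show "norm (of_real (binet_kernel r / r) * exp (- complex_of_real (X (n + N)) * of_real r)) \<le> C * exp (- 1 * r)"
      if "r > 0" for n r
    proof -
      have "norm (of_real (binet_kernel r / r) * exp (- complex_of_real (X (n + N)) * of_real r)) =
          \<bar>binet_kernel r / r\<bar> * exp (- X (n + N) * r)" by (simp add: norm_mult norm_divide)
      also have "\<dots> \<le> C * exp (- 1 * r)"
        using C that N[of "n + N"] by (intro mult_mono) auto
      finally show ?thesis .
    qed
    show "(\<lambda>n. of_real (binet_kernel r / r) * exp (- complex_of_real (X (n + N)) * of_real r)) \<longlonglongrightarrow> 0"
      if "r > 0" for r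
    proof -
      have "((\<lambda>x. exp (- x * r)) \<longlongrightarrow> 0) at_top" using that by real_asymp
      then have "(\<lambda>n. exp (- X n * r)) \<longlonglongrightarrow> 0"
        using filterlim_compose assms by blast
      then have "(\<lambda>n. exp (- X (n + N) * r)) \<longlonglongrightarrow> 0"
        by (rule LIMSEQ_ignore_initial_segment)
      then have "(\<lambda>n. exp (- complex_of_real (X (n + N)) * of_real r)) \<longlonglongrightarrow> 0"
        by (intro tendsto_norm_zero_cancel[of "\<lambda>n. exp (- complex_of_real (X (n + N)) * of_real r)"]) simp
      then show ?thesis using tendsto_mult_right_zero by blast
    qed
  qed (auto intro!: continuous_intros)
  then have "(\<lambda>n. binet_integral (of_real (X (n + N)))) \<longlonglongrightarrow> 0"
    by (simp add: binet_integral_def set_lebesgue_integral_def)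
  then show ?thesis by (rule LIMSEQ_offset)
qed

lemma stirling_remainder_of_real:
  "x > 0 \<Longrightarrow> stirling_remainder (of_real x) =
     of_real (ln_Gamma x - (x - 1 / 2) * ln x + x - ln (2 * pi) / 2)"
  by (simp add: stirling_remainder_def ln_Gamma_complex_of_real Ln_of_real)

text \<open>Both sides have the same second derivative, so they differ by an affine function
  \<open>\<alpha> z + \<beta>\<close>. The two constants are found from functional equations of
  Gamma along the positive reals, which leave only limits of elementary functions and presuppose no
  Stirling asymptotics.\<close>

theorem binet_formula:
  assumes "Re z > 0"
  shows "binet_integral z = stirling_remainder z"
proof -
  define D1 where "D1 = (\<lambda>z. - half_line_integral (\<lambda>r. of_real (r * (binet_kernel r / r)) * exp (- z * of_real r)))"
  have D1': "D1 = (\<lambda>z. - half_line_integral (\<lambda>r. of_real (binet_kernel r) * exp (- z * of_real r)))"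
    unfolding D1_def by (intro ext arg_cong[of _ _ uminus] set_lebesgue_integral_cong) auto
  have d1: "(binet_integral has_field_derivative D1 z) (at z)" if "Re z > 0" for z
    unfolding binet_integral_def D1_def
    by (rule binet_kernel_linear_bound, rule laplace_has_field_derivative(2))
       (use that in \<open>auto intro!: continuous_intros\<close>)
  have d2: "(D1 has_field_derivative 1 / (2 * z ^ 2) - 1 / z + Polygamma 1 (1 + z)) (at z)" if "Re z > 0" for z
  proof -
    have "((\<lambda>z. half_line_integral (\<lambda>r. of_real (binet_kernel r) * exp (- z * of_real r))) has_field_derivative
       - half_line_integral (\<lambda>r. of_real (r * binet_kernel r) * exp (- z * of_real r))) (at z)"
      by (rule binet_kernel_bounded, rule laplace_has_field_derivative(2))
         (use that in \<open>auto intro!: continuous_intros\<close>)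
    from DERIV_minus[OF this] show ?thesis
      by (simp only: D1' half_line_integral_mult_binet_kernel[OF that] minus_minus)
  qed
  define E1 where "E1 = (\<lambda>z::complex. Digamma z - Ln z + 1 / (2 * z))"
  have nonpos: "z \<notin> \<real>\<^sub>\<le>\<^sub>0" "z \<noteq> 0" if "Re z > 0" for z
    using that by (auto simp: complex_nonpos_Reals_iff)
  have e1: "(stirling_remainder has_field_derivative E1 z) (at z)" if "Re z > 0" for z
    unfolding stirling_remainder_def E1_def using nonpos[OF that]
    by (auto intro!: derivative_eq_intros simp: field_simps)
  have e2: "(E1 has_field_derivative 1 / (2 * z ^ 2) - 1 / z + Polygamma 1 (1 + z)) (at z)" if "Re z > 0" for z
  proof -
    have zi: "z \<notin> \<int>\<^sub>\<le>\<^sub>0" using nonpos[OF that] nonpos_Ints_subset_nonpos_Reals by blast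
    have P: "Polygamma 1 (1 + z) = Polygamma 1 z - 1 / z ^ 2"
      using Polygamma_plus1[of z 1] nonpos[OF that] by (simp add: add_ac power2_eq_square)
    have "1 / (2 * z ^ 2) = (1 / z ^ 2) / 2" by simp
    then have eq: "1 / (2 * z ^ 2) - 1 / z + Polygamma 1 (1 + z) = Polygamma 1 z - 1 / z - 1 / (2 * z ^ 2)"
      unfolding P by (simp only:) (simp add: algebra_simps)
    show ?thesis
      unfolding E1_def eq
    proof -
      have "((\<lambda>z. Digamma z - Ln z + 1 / 2 * inverse z) has_field_derivative
          Polygamma (Suc 0) z - inverse z + 1 / 2 * - (inverse z ^ Suc (Suc 0))) (at z)"
        using nonpos[OF that] zi
        by (intro DERIV_add DERIV_diff DERIV_cmult DERIV_inverse has_field_derivative_Ln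
              has_field_derivative_Polygamma)
      then show "((\<lambda>z. Digamma z - Ln z + 1 / (2 * z)) has_field_derivative Polygamma 1 z - 1 / z - 1 / (2 * z ^ 2)) (at z)"
        by (simp add: power2_eq_square inverse_eq_divide)
    qed
  qed
  let ?S = "{z::complex. Re z > 0}"
  have conv: "convex ?S" by (rule convex_halfspace_Re_gt)
  have "(\<lambda>z. D1 z - E1 z) constant_on ?S"
    by (rule has_field_derivative_0_imp_constant_on)
       (use d2 e2 in \<open>auto intro!: derivative_eq_intros convex_connected conv open_halfspace_Re_gt\<close>)
  then obtain \<alpha> where \<alpha>: "\<And>z. Re z > 0 \<Longrightarrow> D1 z - E1 z = \<alpha>" by (auto simp: constant_on_def)
  have "(\<lambda>z. binet_integral z - stirling_remainder z - \<alpha> * z) constant_on ?S"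
    by (rule has_field_derivative_0_imp_constant_on)
       (use d1 e1 \<alpha> in \<open>auto intro!: derivative_eq_intros convex_connected conv open_halfspace_Re_gt\<close>)
  then obtain \<beta> where "\<And>z. Re z > 0 \<Longrightarrow> binet_integral z - stirling_remainder z - \<alpha> * z = \<beta>"
    by (auto simp: constant_on_def)
  then have AB: "binet_integral z - stirling_remainder z = \<alpha> * z + \<beta>" if "Re z > 0" for z
    using that by (metis add.commute diff_add_cancel)
  have ni: "x \<notin> \<int>\<^sub>\<le>\<^sub>0" "complex_of_real x \<notin> \<int>\<^sub>\<le>\<^sub>0" if "x > 0" for x :: real
    subgoal using that by (auto elim!: nonpos_Ints_cases)
    subgoal using that nonpos(1)[of "of_real x"] nonpos_Ints_subset_nonpos_Reals[where 'a = complex] by auto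
    done
  define s where "s = (\<lambda>x::real. ln_Gamma x - (x - 1 / 2) * ln x + x - ln (2 * pi) / 2)"
  have s: "stirling_remainder (of_real x) = of_real (s x)" if "x > 0" for x
    using stirling_remainder_of_real[OF that] by (simp add: s_def)
  \<comment> \<open>The first difference of the affine function is \<open>\<alpha>\<close>; by
    Gamma(x + 1) = x Gamma(x) that of the Stirling remainder is elementary and tends to 0.\<close>
  have "(\<lambda>n. binet_integral (of_real (real n + 2)) - binet_integral (of_real (real n + 1))
            - of_real (s (real n + 2) - s (real n + 1))) \<longlonglongrightarrow> 0 - 0 - of_real 0"
  proof (intro tendsto_diff binet_integral_tendsto_0 tendsto_of_real)
    show "filterlim (\<lambda>n. real n + 2) at_top sequentially" by real_asymp
    show "filterlim (\<lambda>n. real n + 1) at_top sequentially" by real_asymp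
    have "s (x + 1) - s x = 1 - (x + 1/2) * (ln (x + 1) - ln x)" if "x > 0" for x
    proof -
      have "ln_Gamma (x + 1) = ln_Gamma x + ln x"
        using Gamma_plus1[of x] that ni[OF that]
        by (simp add: ln_Gamma_real_pos ln_mult Gamma_eq_zero_iff add.commute)
      then show ?thesis by (simp add: s_def algebra_simps)
    qed
    from this[of "real n + 1" for n]
    have eq: "(\<lambda>n. s (real n + 2) - s (real n + 1)) = (\<lambda>n. 1 - (real n + 3/2) * (ln (real n + 2) - ln (real n + 1)))"
      by (auto simp: add_ac)
    show "(\<lambda>n. s (real n + 2) - s (real n + 1)) \<longlonglongrightarrow> 0"
      unfolding eq by real_asymp
  qed
  also have "(\<lambda>n. binet_integral (of_real (real n + 2)) - binet_integral (of_real (real n + 1))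
            - of_real (s (real n + 2) - s (real n + 1))) = (\<lambda>n. \<alpha>)"
  proof
    fix n
    show "binet_integral (of_real (real n + 2)) - binet_integral (of_real (real n + 1))
            - of_real (s (real n + 2) - s (real n + 1)) = \<alpha>"
      using AB[of "of_real (real n + 2)"] AB[of "of_real (real n + 1)"] s[of "real n + 2"] s[of "real n + 1"]
      by (simp add: algebra_simps)
  qed
  finally have "\<alpha> = 0" by (simp add: LIMSEQ_const_iff)
  \<comment> \<open>Values at x, x + 1/2 and, with a minus sign, 2x: a constant
    \<open>\<beta>\<close> contributes \<open>\<beta>\<close> again, while Legendre's duplication
    formula makes the combination of Stirling remainders elementary.\<close>
  have "(\<lambda>n. binet_integral (of_real (real n + 1)) + binet_integral (of_real (real n + 3/2)) - binet_integral (of_real (2 * real n + 2))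
            - of_real (s (real n + 1) + s (real n + 3/2) - s (2 * real n + 2))) \<longlonglongrightarrow> 0 + 0 - 0 - of_real 0"
  proof (intro tendsto_diff tendsto_add binet_integral_tendsto_0 tendsto_of_real)
    show "filterlim (\<lambda>n. real n + 3/2) at_top sequentially" by real_asymp
    show "filterlim (\<lambda>n. real n + 1) at_top sequentially" by real_asymp
    show "filterlim (\<lambda>n. 2 * real n + 2) at_top sequentially" by real_asymp
    have "s x + s (x + 1/2) - s (2 * x) = 1/2 - x * (ln (x + 1/2) - ln x)" if "x > 0" for x
    proof -
      have "of_real (Gamma x * Gamma (x + 1/2)) = complex_of_real (exp ((1 - 2 * x) * ln 2) * sqrt pi * Gamma (2 * x))"
        using Gamma_legendre_duplication[of "of_real x"] ni[OF that] ni[of "x + 1/2"] that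
        by (simp add: Gamma_complex_of_real[symmetric] exp_of_real[symmetric])
      then have "Gamma x * Gamma (x + 1/2) = exp ((1 - 2 * x) * ln 2) * sqrt pi * Gamma (2 * x)"
        by (simp only: of_real_eq_iff)
      then have "ln (Gamma x * Gamma (x + 1/2)) = ln (exp ((1 - 2 * x) * ln 2) * sqrt pi * Gamma (2 * x))"
        by simp
      then have "ln_Gamma x + ln_Gamma (x + 1/2) = (1 - 2 * x) * ln 2 + ln pi / 2 + ln_Gamma (2 * x)"
        using that ni(1)[OF that] ni(1)[of "x + 1/2"] ni(1)[of "2 * x"]
        by (simp add: ln_Gamma_real_pos ln_mult ln_sqrt Gamma_eq_zero_iff)
      then show ?thesis using that by (simp add: s_def ln_mult algebra_simps) (simp add: field_simps)
    qed
    from this[of "real n + 1" for n]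
    have eq: "(\<lambda>n. s (real n + 1) + s (real n + 3/2) - s (2 * real n + 2)) =
        (\<lambda>n. 1/2 - (real n + 1) * (ln (real n + 3/2) - ln (real n + 1)))"
      by (auto simp: algebra_simps)
    show "(\<lambda>n. s (real n + 1) + s (real n + 3/2) - s (2 * real n + 2)) \<longlonglongrightarrow> 0"
      unfolding eq by real_asymp
  qed
  also have "(\<lambda>n. binet_integral (of_real (real n + 1)) + binet_integral (of_real (real n + 3/2)) - binet_integral (of_real (2 * real n + 2))
            - of_real (s (real n + 1) + s (real n + 3/2) - s (2 * real n + 2))) = (\<lambda>n. \<beta>)"
  proof
    fix n
    show "binet_integral (of_real (real n + 1)) + binet_integral (of_real (real n + 3/2)) - binet_integral (of_real (2 * real n + 2))
            - of_real (s (real n + 1) + s (real n + 3/2) - s (2 * real n + 2)) = \<beta>"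
      using AB[of "of_real (real n + 1)"] AB[of "of_real (real n + 3/2)"] AB[of "of_real (2 * real n + 2)"]
        s[of "real n + 1"] s[of "real n + 3/2"] s[of "2 * real n + 2"] \<open>\<alpha> = 0\<close>
      by (simp add: algebra_simps)
  qed
  finally have "\<beta> = 0" by (simp add: LIMSEQ_const_iff)
  with AB[OF assms] \<open>\<alpha> = 0\<close> show ?thesis by simp
qed

section \<open>Logarithm and dilogarithm on the cut plane\<close>

lemma mem_real_cuts_iff: "\<xi> \<in> real_cuts \<longleftrightarrow> Im \<xi> = 0 \<and> \<bar>Re \<xi>\<bar> \<ge> 1"
  by (auto simp: real_cuts_def complex_eq_iff image_iff abs_if)

lemma open_Compl_real_cuts: "open (- real_cuts)"
proof -
  have "real_cuts = {z. Im z = 0} \<inter> {z. \<bar>Re z\<bar> \<ge> 1}" by (auto simp: mem_real_cuts_iff)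
  moreover have "closed \<dots>"
    by (intro closed_Int closed_Collect_eq closed_Collect_le continuous_intros)
  ultimately show ?thesis by auto
qed

text \<open>Scaling towards 0 keeps non-real points non-real until 0 is reached and shrinks real
  ones. Star-shapedness gives primitives here and connecting paths in the final
  continuation.\<close>

lemma Compl_real_cuts_segment: "\<xi> \<notin> real_cuts \<Longrightarrow> closed_segment 0 \<xi> \<subseteq> - real_cuts"
proof (clarsimp simp: closed_segment_def mem_real_cuts_iff)
  fix u :: real
  assume *: "Im \<xi> = 0 \<longrightarrow> \<not> 1 \<le> \<bar>Re \<xi>\<bar>" "0 \<le> u" "u \<le> 1" "u = 0 \<or> Im \<xi> = 0" "1 \<le> \<bar>u * Re \<xi>\<bar>"
  then have "u \<noteq> 0" by auto
  then have "\<bar>Re \<xi>\<bar> < 1" using * by auto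
  moreover have "\<bar>u * Re \<xi>\<bar> \<le> 1 * \<bar>Re \<xi>\<bar>" using * by (simp add: abs_mult mult_left_le_one_le)
  ultimately show False using * by linarith
qed

section \<open>The logarithm of 1 - x\<close>

text \<open>Half of log(pi xi / sin(pi xi)) by the reflection formula, in the branch that vanishes
  at 0; \<open>ln_Gamma\<close> provides this branch on the whole cut plane.\<close>

definition lg_sym :: "complex \<Rightarrow> complex" where
  "lg_sym \<xi> = (ln_Gamma (1 + \<xi>) + ln_Gamma (1 - \<xi>)) / 2"

lemma one_pm_notin_nonpos_Reals:
  assumes "\<xi> \<notin> real_cuts"
  shows "1 + \<xi> \<notin> \<real>\<^sub>\<le>\<^sub>0" "1 - \<xi> \<notin> \<real>\<^sub>\<le>\<^sub>0"
  using assms by (auto simp: mem_real_cuts_iff complex_nonpos_Reals_iff)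

lemma lg_sym_holomorphic: "lg_sym holomorphic_on - real_cuts"
proof -
  have 1: "(\<lambda>\<xi>. ln_Gamma (1 + \<xi>)) holomorphic_on - real_cuts"
    by (rule holomorphic_on_compose[of "\<lambda>\<xi>. 1 + \<xi>" _ ln_Gamma, unfolded o_def])
       (use one_pm_notin_nonpos_Reals in \<open>auto intro!: holomorphic_intros\<close>)
  have 2: "(\<lambda>\<xi>. ln_Gamma (1 - \<xi>)) holomorphic_on - real_cuts"
    by (rule holomorphic_on_compose[of "\<lambda>\<xi>. 1 - \<xi>" _ ln_Gamma, unfolded o_def])
       (use one_pm_notin_nonpos_Reals in \<open>auto intro!: holomorphic_intros\<close>)
  show ?thesis unfolding lg_sym_def by (intro holomorphic_intros 1 2) auto
qed

lemma lg_sym_0 [simp]: "lg_sym 0 = 0"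
  using ln_Gamma_complex_conv_fact[of 1] by (simp add: lg_sym_def)

text \<open>The two conditions determine the function on the cut plane, which is star-shaped about
  0. It will carry the part of the dilogarithm that is free of logarithms of
  \<open>\<xi>\<close>.\<close>

definition lg_sym_primitive :: "complex \<Rightarrow> complex" where
  "lg_sym_primitive = (SOME M. (\<forall>\<xi>\<in>- real_cuts. (M has_field_derivative lg_sym \<xi>) (at \<xi>)) \<and> M 0 = 0)"

lemma lg_sym_primitive:
  shows lg_sym_primitive_deriv: "\<xi> \<notin> real_cuts \<Longrightarrow> (lg_sym_primitive has_field_derivative lg_sym \<xi>) (at \<xi>)"
    and lg_sym_primitive_0 [simp]: "lg_sym_primitive 0 = 0"
proof -
  have "starlike (- real_cuts)"
    unfolding starlike_def using Compl_real_cuts_segment by (intro bexI[of _ 0]) (auto simp: mem_real_cuts_iff)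
  then obtain g where g: "\<forall>\<xi>\<in>- real_cuts. (g has_field_derivative lg_sym \<xi>) (at \<xi>)"
    using holomorphic_starlike_primitive[of "- real_cuts" lg_sym "{}"] lg_sym_holomorphic open_Compl_real_cuts
    by (auto simp: holomorphic_on_imp_continuous_on holomorphic_on_imp_differentiable_at)
  then have "(\<forall>\<xi>\<in>- real_cuts. ((\<lambda>\<xi>. g \<xi> - g 0) has_field_derivative lg_sym \<xi>) (at \<xi>)) \<and> g 0 - g 0 = 0"
    by (auto intro!: derivative_eq_intros)
  then have "(\<forall>\<xi>\<in>- real_cuts. (lg_sym_primitive has_field_derivative lg_sym \<xi>) (at \<xi>)) \<and> lg_sym_primitive 0 = 0"
    unfolding lg_sym_primitive_def
    by (rule someI[of "\<lambda>M. (\<forall>\<xi>\<in>- real_cuts. (M has_field_derivative lg_sym \<xi>) (at \<xi>)) \<and> M 0 = 0" "\<lambda>\<xi>. g \<xi> - g 0"])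
  then show "\<xi> \<notin> real_cuts \<Longrightarrow> (lg_sym_primitive has_field_derivative lg_sym \<xi>) (at \<xi>)" "lg_sym_primitive 0 = 0"
    by auto
qed

lemma lg_sym_primitive_holomorphic: "lg_sym_primitive holomorphic_on - real_cuts"
  using lg_sym_primitive_deriv open_Compl_real_cuts
  by (auto simp: holomorphic_on_open)

text \<open>Euler's reflection formula. The sine is kept on the left so that
  \<open>\<xi> = 0\<close> is covered.\<close>

lemma exp_2_lg_sym:
  assumes "\<xi> \<notin> real_cuts"
  shows "exp (2 * lg_sym \<xi>) * sin (of_real pi * \<xi>) = of_real pi * \<xi>"
proof -
  have n: "1 + \<xi> \<notin> \<int>\<^sub>\<le>\<^sub>0" "1 - \<xi> \<notin> \<int>\<^sub>\<le>\<^sub>0"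
    using one_pm_notin_nonpos_Reals[OF assms] nonpos_Ints_subset_nonpos_Reals by blast+
  have "exp (2 * lg_sym \<xi>) = Gamma (1 + \<xi>) * Gamma (1 - \<xi>)"
  proof -
    have "2 * lg_sym \<xi> = ln_Gamma (1 + \<xi>) + ln_Gamma (1 - \<xi>)" by (simp add: lg_sym_def)
    then show ?thesis using n by (simp add: exp_add Gamma_complex_altdef)
  qed
  moreover have "Gamma (1 + \<xi>) * Gamma (1 - \<xi>) * sin (of_real pi * \<xi>) = of_real pi * \<xi>"
  proof (cases "\<xi> = 0")
    case False
    have "\<xi> \<notin> \<int>\<^sub>\<le>\<^sub>0"
    proof
      assume "\<xi> \<in> \<int>\<^sub>\<le>\<^sub>0"
      then obtain m :: int where m: "m \<le> 0" "\<xi> = of_int m" by (auto elim!: nonpos_Ints_cases)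
      then have "m \<le> -1" using False by auto
      then show False using assms m by (auto simp: mem_real_cuts_iff)
    qed
    then have "Gamma (1 + \<xi>) = \<xi> * Gamma \<xi>" using Gamma_plus1[of \<xi>] by (simp add: add.commute)
    \<comment> \<open>A zero of the sine makes \<open>\<xi>\<close> an integer; 0 is excluded in
      this case and all other integers lie on the cuts.\<close>
    moreover have "sin (of_real pi * \<xi>) \<noteq> 0"
    proof
      assume "sin (of_real pi * \<xi>) = 0"
      then obtain m :: int where "of_real pi * \<xi> = of_real (of_int m * pi)" by (auto simp: sin_eq_0)
      then have "\<xi> = of_int m" by (simp add: field_simps)
      then have "\<bar>m\<bar> \<ge> 1" using False by auto
      then show False using assms \<open>\<xi> = of_int m\<close> by (auto simp: mem_real_cuts_iff)
    qed
    ultimately show ?thesis using Gamma_reflection_complex[of \<xi>] by (simp add: field_simps)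
  qed simp
  ultimately show ?thesis by simp
qed

lemma minus_2i_exp_sin:
  "- 2 * \<i> * exp (of_real pi * \<i> * \<xi>) * sin (of_real pi * \<xi>) = 1 - exp (2 * of_real pi * \<i> * \<xi>)"
proof -
  have *: "sin (of_real pi * \<xi>) = (exp (of_real pi * \<i> * \<xi>) - inverse (exp (of_real pi * \<i> * \<xi>))) / (2 * \<i>)"
    by (simp add: sin_exp_eq exp_minus[symmetric] mult_ac)
  have "exp (2 * of_real pi * \<i> * \<xi>) = exp (of_real pi * \<i> * \<xi>) * exp (of_real pi * \<i> * \<xi>)"
    using exp_double[of "of_real pi * \<i> * \<xi>"] by (simp add: power2_eq_square mult.assoc)
  then show ?thesis unfolding * by (simp add: field_simps)
qed

text \<open>The logarithm of 1 - x = -2i exp(pi i xi) sin(pi xi), with the sine written through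
  \<open>lg_sym\<close>. Its only cut inside the cut plane comes from \<open>Ln \<xi>\<close>, which
  makes the later continuation explicit.\<close>

definition log_uhp :: "complex \<Rightarrow> complex" where
  "log_uhp \<xi> = of_real pi * \<i> * \<xi> + of_real (ln (2 * pi)) - of_real pi * \<i> / 2 + Ln \<xi> - 2 * lg_sym \<xi>"

lemma exp_half_pi_i: "exp (of_real pi * \<i> / 2) = \<i>"
  using cis_conv_exp[of "pi / 2"] by (simp add: mult.commute)

lemma uhp_not_cut: "Im \<xi> > 0 \<Longrightarrow> \<xi> \<notin> real_cuts" "Im \<xi> > 0 \<Longrightarrow> \<xi> \<notin> \<real>\<^sub>\<le>\<^sub>0" "Im \<xi> > 0 \<Longrightarrow> \<xi> \<noteq> 0"
  by (auto simp: mem_real_cuts_iff complex_nonpos_Reals_iff)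

text \<open>The factor \<open>\<xi>\<close> stays outside the exponential, so the identity involves
  no branch and holds on the whole cut plane.\<close>

lemma exp_log_uhp_gen:
  assumes "\<xi> \<notin> real_cuts"
  shows "exp (of_real pi * \<i> * \<xi> + of_real (ln (2 * pi)) - of_real pi * \<i> / 2 - 2 * lg_sym \<xi>) * \<xi>
     = 1 - exp (2 * of_real pi * \<i> * \<xi>)"
proof -
  have "exp (of_real pi * \<i> * \<xi> + of_real (ln (2 * pi)) - of_real pi * \<i> / 2 - 2 * lg_sym \<xi>) =
     exp (of_real pi * \<i> * \<xi>) * (2 * of_real pi) * (- \<i>) / exp (2 * lg_sym \<xi>)"
  proof -
    have "exp (of_real (ln (2 * pi))) = complex_of_real (2 * pi)" by (simp only: exp_of_real) simp
    then show ?thesis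
      unfolding exp_add exp_diff exp_half_pi_i by simp
  qed
  then have "exp (of_real pi * \<i> * \<xi> + of_real (ln (2 * pi)) - of_real pi * \<i> / 2 - 2 * lg_sym \<xi>) * \<xi> =
     - 2 * \<i> * exp (of_real pi * \<i> * \<xi>) * (of_real pi * \<xi>) / exp (2 * lg_sym \<xi>)"
    by simp
  also have "\<dots> = - 2 * \<i> * exp (of_real pi * \<i> * \<xi>) * (exp (2 * lg_sym \<xi>) * sin (of_real pi * \<xi>)) / exp (2 * lg_sym \<xi>)"
    by (simp only: exp_2_lg_sym[OF assms])
  also have "\<dots> = - 2 * \<i> * exp (of_real pi * \<i> * \<xi>) * sin (of_real pi * \<xi>)" by simp
  finally show ?thesis using minus_2i_exp_sin by simp
qed

lemma norm_exp_2_pi_i: "norm (exp (2 * of_real pi * \<i> * \<xi>)) = exp (- 2 * pi * Im \<xi>)"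
  by simp

text \<open>Both sides have the same exponential, hence differ by a constant in 2 pi i Z. The
  constant is identified by approaching 0 along the imaginary axis.\<close>

lemma Ln_one_minus_eq_log_uhp:
  assumes "Im \<xi> > 0"
  shows "Ln (1 - exp (2 * of_real pi * \<i> * \<xi>)) = log_uhp \<xi>"
proof -
  define d where "d = (\<lambda>\<xi>. Ln (1 - exp (2 * of_real pi * \<i> * \<xi>)) - log_uhp \<xi>)"
  let ?U = "{\<xi>. Im \<xi> > 0}"
  have x: "1 - exp (2 * of_real pi * \<i> * \<xi>) \<notin> \<real>\<^sub>\<le>\<^sub>0" if "Im \<xi> > 0" for \<xi>
  proof -
    have "norm (exp (2 * of_real pi * \<i> * \<xi>)) < 1" unfolding norm_exp_2_pi_i using that by simp
    then have "Re (exp (2 * of_real pi * \<i> * \<xi>)) < 1" using complex_Re_le_cmod order_le_less_trans by blast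
    then show ?thesis by (auto simp: complex_nonpos_Reals_iff)
  qed
  have lgU: "lg_sym holomorphic_on ?U"
    using lg_sym_holomorphic by (rule holomorphic_on_subset) (auto simp: uhp_not_cut)
  have hol: "d holomorphic_on ?U"
    unfolding d_def log_uhp_def
    by (intro holomorphic_intros lgU) (use x uhp_not_cut in auto)
  have exp1: "exp (d \<xi>) = 1" if "Im \<xi> > 0" for \<xi>
  proof -
    have "1 - exp (2 * of_real pi * \<i> * \<xi>) \<noteq> 0" using x[OF that] by auto
    moreover have "exp (log_uhp \<xi>) = 1 - exp (2 * of_real pi * \<i> * \<xi>)"
    proof -
      have "log_uhp \<xi> = (of_real pi * \<i> * \<xi> + of_real (ln (2 * pi)) - of_real pi * \<i> / 2 - 2 * lg_sym \<xi>) + Ln \<xi>"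
        by (simp add: log_uhp_def)
      then show ?thesis
        using exp_log_uhp_gen[of \<xi>] uhp_not_cut[OF that] by (simp only: exp_add exp_Ln not_False_eq_True)
    qed
    ultimately show ?thesis by (simp add: d_def exp_diff)
  qed
  have "d constant_on ?U"
  proof (rule has_field_derivative_0_imp_constant_on)
    fix z assume z: "z \<in> ?U"
    have dz: "(d has_field_derivative deriv d z) (at z)"
      using hol z by (intro holomorphic_derivI[of _ ?U]) (auto simp: open_halfspace_Im_gt)
    have "((\<lambda>z. exp (d z)) has_field_derivative exp (d z) * deriv d z) (at z)"
      using dz by (auto intro!: derivative_eq_intros)
    moreover have "((\<lambda>z. exp (d z)) has_field_derivative 0) (at z)"
      by (rule has_field_derivative_transform_within_open[of "\<lambda>_. 1" _ _ ?U])
         (use z exp1 in \<open>auto simp: open_halfspace_Im_gt\<close>)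
    ultimately have "exp (d z) * deriv d z = 0" by (rule DERIV_unique)
    then show "(d has_field_derivative 0) (at z)" using dz by simp
  qed (auto intro: convex_connected convex_halfspace_Im_gt simp: open_halfspace_Im_gt)
  then obtain c where c: "\<And>\<xi>. Im \<xi> > 0 \<Longrightarrow> d \<xi> = c" by (auto simp: constant_on_def)
  have "exp c = 1" using exp1[of \<i>] c[of \<i>] by simp
  then have "norm (exp c) = 1" by simp
  then have "Re c = 0" by simp
  \<comment> \<open>For \<open>\<xi> = \<i> \<epsilon>\<close> the number 1 - x is positive, and the
    argument pi/2 of \<open>\<xi>\<close> cancels against the term - pi i / 2, so only
    \<open>lg_sym\<close> contributes to the imaginary part.\<close>
  have "((\<lambda>\<epsilon>. Im (2 * lg_sym (of_real \<epsilon> * \<i>))) \<longlongrightarrow> Im (2 * lg_sym (of_real 0 * \<i>))) (at_right (0::real))"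
  proof (intro tendsto_intros)
    have "isCont lg_sym (of_real 0 * \<i>)"
      using holomorphic_on_imp_continuous_on[OF lg_sym_holomorphic] open_Compl_real_cuts
      by (auto simp: continuous_on_eq_continuous_at mem_real_cuts_iff)
    then show "((\<lambda>\<epsilon>. lg_sym (of_real \<epsilon> * \<i>)) \<longlongrightarrow> lg_sym (of_real 0 * \<i>)) (at_right 0)"
      by (rule isCont_tendsto_compose) (intro tendsto_intros)
  qed
  moreover have "\<forall>\<^sub>F \<epsilon> in at_right 0. Im (2 * lg_sym (of_real \<epsilon> * \<i>)) = Im c"
    using eventually_at_right_less[of "0::real"]
  proof eventually_elim
    case (elim \<epsilon>)
    have "Ln (1 - exp (2 * of_real pi * \<i> * (of_real \<epsilon> * \<i>))) = Ln (of_real (1 - exp (- 2 * pi * \<epsilon>)))"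
      by (simp add: exp_of_real[symmetric] mult_ac)
    also have "\<dots> = of_real (ln (1 - exp (- 2 * pi * \<epsilon>)))" using elim by (intro Ln_of_real) simp
    finally have "Im (Ln (1 - exp (2 * of_real pi * \<i> * (of_real \<epsilon> * \<i>)))) = 0" by simp
    moreover have "Im (Ln (of_real \<epsilon> * \<i>)) = pi / 2"
      using elim by (simp add: Ln_times_of_real)
    moreover have "c = Ln (1 - exp (2 * of_real pi * \<i> * (of_real \<epsilon> * \<i>))) - log_uhp (of_real \<epsilon> * \<i>)"
      using c[of "of_real \<epsilon> * \<i>"] elim by (simp add: d_def)
    ultimately show ?case by (simp add: log_uhp_def)
  qed
  ultimately have "((\<lambda>_. Im c) \<longlongrightarrow> Im (2 * lg_sym (of_real 0 * \<i>))) (at_right (0::real))"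
    using tendsto_cong by fast
  then have "Im c = Im (2 * lg_sym (of_real 0 * \<i>))"
    by (rule tendsto_unique[OF trivial_limit_at_right_real tendsto_const])
  then have "Im c = 0" by simp
  with \<open>Re c = 0\<close> have "c = 0" by (simp add: complex_eq_iff)
  then show ?thesis using c[OF assms] by (simp add: d_def)
qed

section \<open>The dilogarithm\<close>

text \<open>Multiplying the derivative by \<open>x\<close> keeps \<open>x = 0\<close> in the
  statement. That case yields the continuity at 0 needed for the limit of the formula.\<close>

lemma Li2_series_has_field_derivative:
  assumes "norm x < 1"
  shows "\<exists>D. (Li2_series has_field_derivative D) (at x) \<and> D * x = - Ln (1 - x)"
proof -
  \<comment> \<open>\<open>c 0\<close> is \<open>1 / 0 = 0\<close>, so the series may start at 0
    instead of 1.\<close>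
  define c where "c = (\<lambda>n. 1 / of_nat n ^ 2 :: complex)"
  have sm: "summable (\<lambda>n. c n * z ^ n)" if "norm z < 1" for z
  proof (rule summable_comparison_test')
    show "summable (\<lambda>n. norm z ^ n)" using that by (intro summable_geometric) simp
    show "norm (c n * z ^ n) \<le> norm z ^ n" if "n \<ge> 0" for n
    proof (cases "n = 0")
      case False
      then have "1 / real n ^ 2 \<le> 1" by simp
      then show ?thesis unfolding c_def
        by (simp add: norm_mult norm_divide norm_power mult_left_le_one_le divide_le_eq)
           (simp add: False mult_le_cancel_left1)
    qed (simp add: c_def)
  qed
  have eq: "Li2_series z = (\<Sum>n. c n * z ^ n)" if "norm z < 1" for z
    using suminf_split_head[OF sm[OF that]] by (simp add: Li2_series_def c_def)
  have d: "((\<lambda>z. \<Sum>n. c n * z ^ n) has_field_derivative (\<Sum>n. diffs c n * x ^ n)) (at x)"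
    by (rule termdiffs_strong'[of 1]) (use sm assms in auto)
  have "(Li2_series has_field_derivative (\<Sum>n. diffs c n * x ^ n)) (at x)"
    by (rule has_field_derivative_transform_within_open[OF d, of "ball 0 1"]) (use eq assms in auto)
  moreover have "(\<Sum>n. diffs c n * x ^ n) * x = - Ln (1 - x)"
  proof -
    have "(\<lambda>n. - ((x) ^ n) / of_nat n) sums Ln (1 - x)"
      using Ln_series'[of "- x"] assms by simp
    then have "(\<lambda>n. - (x ^ Suc n) / of_nat (Suc n)) sums Ln (1 - x)"
      by (subst sums_Suc_iff) simp
    then have "(\<lambda>n. x ^ Suc n / of_nat (Suc n)) sums (- Ln (1 - x))"
      using sums_minus by fastforce
    also have "(\<lambda>n. x ^ Suc n / of_nat (Suc n)) = (\<lambda>n. (diffs c n * x ^ n) * x)"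
    proof
      fix n
      have "of_nat (Suc n) \<noteq> (0::complex)" by (rule of_nat_neq_0)
      then show "x ^ Suc n / of_nat (Suc n) = diffs c n * x ^ n * x"
        by (simp add: diffs_def c_def power2_eq_square del: of_nat_Suc)
    qed
    finally have s: "(\<lambda>n. (diffs c n * x ^ n) * x) sums (- Ln (1 - x))" .
    show ?thesis
    proof (cases "x = 0")
      case False
      then show ?thesis using sums_mult2[OF s, of "inverse x"]
        by (simp add: sums_iff field_simps)
    qed simp
  qed
  ultimately show ?thesis by blast
qed

text \<open>A primitive of \<open>log_uhp\<close> without its term \<open>Ln \<xi>\<close>; that
  term contributes \<open>\<xi> * Ln \<xi> - \<xi>\<close>.\<close>

definition Li2_uhp_aux :: "complex \<Rightarrow> complex" where
  "Li2_uhp_aux \<xi> = of_real pi * \<i> * \<xi> ^ 2 / 2 + (of_real (ln (2 * pi)) - of_real pi * \<i> / 2) * \<xi> - 2 * lg_sym_primitive \<xi>"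

text \<open>The constant of integration, read off at the point \<open>\<xi> = \<i>\<close>; hence
  the double \<open>\<i>\<close> in the exponent.\<close>

definition Li2_const :: complex where
  "Li2_const = Li2_series (exp (2 * of_real pi * \<i> * \<i>)) +
     2 * of_real pi * \<i> * (Li2_uhp_aux \<i> + \<i> * Ln \<i> - \<i>)"

text \<open>The chain rule gives the derivative \<open>- 2 pi \<i> log_uhp \<xi>\<close>, because x
  Li2'(x) = - log(1 - x).\<close>

lemma Li2_series_uhp:
  assumes "Im \<xi> > 0"
  shows "Li2_series (exp (2 * of_real pi * \<i> * \<xi>)) =
     Li2_const - 2 * of_real pi * \<i> * (Li2_uhp_aux \<xi> + \<xi> * Ln \<xi> - \<xi>)"
proof -
  define d where "d = (\<lambda>\<xi>. Li2_series (exp (2 * of_real pi * \<i> * \<xi>)) +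
     2 * of_real pi * \<i> * (Li2_uhp_aux \<xi> + \<xi> * Ln \<xi> - \<xi>))"
  have "d constant_on {\<xi>. Im \<xi> > 0}"
  proof (rule has_field_derivative_0_imp_constant_on)
    fix z assume z: "z \<in> {\<xi>. Im \<xi> > 0}"
    define x where "x = exp (2 * of_real pi * \<i> * z)"
    have "norm x < 1" unfolding x_def norm_exp_2_pi_i using z by simp
    then obtain D where D: "(Li2_series has_field_derivative D) (at x)" "D * x = - Ln (1 - x)"
      using Li2_series_has_field_derivative by blast
    have 1: "((\<lambda>\<xi>. Li2_series (exp (2 * of_real pi * \<i> * \<xi>))) has_field_derivative D * (2 * of_real pi * \<i> * x)) (at z)"
      unfolding x_def
      by (rule DERIV_chain2[where f = Li2_series and g = "\<lambda>\<xi>. exp (2 * of_real pi * \<i> * \<xi>)"])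
         (use D(1) in \<open>auto intro!: derivative_eq_intros simp: x_def\<close>)
    have 2: "((\<lambda>\<xi>. Li2_uhp_aux \<xi> + \<xi> * Ln \<xi> - \<xi>) has_field_derivative log_uhp z) (at z)"
      unfolding Li2_uhp_aux_def log_uhp_def
      using z uhp_not_cut[of z]
      by (auto intro!: derivative_eq_intros lg_sym_primitive_deriv)
    have "(d has_field_derivative D * (2 * of_real pi * \<i> * x) + 2 * of_real pi * \<i> * log_uhp z) (at z)"
      unfolding d_def by (intro DERIV_add 1 DERIV_cmult 2)
    also have "D * (2 * of_real pi * \<i> * x) = - (2 * of_real pi * \<i> * log_uhp z)"
    proof -
      have "D * x = - log_uhp z"
        using D(2) Ln_one_minus_eq_log_uhp[of z] z by (simp add: x_def)
      then have "2 * of_real pi * \<i> * (D * x) = 2 * of_real pi * \<i> * (- log_uhp z)" by simp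
      then show ?thesis by (simp add: mult_ac)
    qed
    finally show "(d has_field_derivative 0) (at z)" by simp
  qed (auto intro: convex_connected convex_halfspace_Im_gt simp: open_halfspace_Im_gt)
  then have "d \<xi> = d \<i>" using assms by (auto simp: constant_on_def)
  then show ?thesis by (simp add: d_def Li2_const_def algebra_simps)
qed

section \<open>The domain of \<open>\<xi>\<close> and the continued branches\<close>

lemma open_xi_domain: "\<tau> \<noteq> 0 \<Longrightarrow> open (xi_domain \<tau>)"
proof -
  assume "\<tau> \<noteq> 0"
  then have "open ((\<lambda>\<xi>. \<xi> / \<tau>) -` (- \<real>\<^sub>\<le>\<^sub>0))"
    by (intro open_vimage continuous_intros) auto
  moreover have "xi_domain \<tau> = (- real_cuts) \<inter> ((\<lambda>\<xi>. \<xi> / \<tau>) -` (- \<real>\<^sub>\<le>\<^sub>0))"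
    by (auto simp: xi_domain_def)
  ultimately show ?thesis using open_Compl_real_cuts by (metis open_Int)
qed

text \<open>The removed half-line consists of nonpositive multiples of \<open>\<tau>\<close>, and
  these have nonpositive imaginary part.\<close>

lemma uhp_subset_xi_domain:
  assumes "Im \<tau> > 0"
  shows "{\<xi>. Im \<xi> > 0} \<subseteq> xi_domain \<tau>"
proof
  fix \<xi> assume \<xi>: "\<xi> \<in> {\<xi>. Im \<xi> > 0}"
  have "\<xi> / \<tau> \<notin> \<real>\<^sub>\<le>\<^sub>0"
  proof
    assume "\<xi> / \<tau> \<in> \<real>\<^sub>\<le>\<^sub>0"
    then obtain r where r: "r \<le> 0" "\<xi> / \<tau> = of_real r" by (auto elim!: nonpos_Reals_cases)
    then have "\<xi> = of_real r * \<tau>" using uhp_not_cut(3)[OF assms] by (simp add: divide_eq_eq)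
    then have "Im \<xi> = r * Im \<tau>" by simp
    then show False using \<xi> r assms by (simp add: zero_less_mult_iff)
  qed
  then show "\<xi> \<in> xi_domain \<tau>" using \<xi> uhp_not_cut by (auto simp: xi_domain_def)
qed

text \<open>
  \<open>xi_domain \<tau>\<close> is the union of the upper half-plane and of two half-planes bounded by the line
  through \<open>0\<close> and \<open>\<tau>\<close>, minus the real cuts; the latter two are star-shaped with respect to \<open>1 / 2\<close>
  and \<open>- 1 / 2\<close>.
\<close>

lemma star_sector:
  assumes \<tau>: "Im \<tau> > 0" and s: "s \<in> {1 / 2, - 1 / 2 :: real}"
    and \<xi>: "\<xi> \<notin> real_cuts" "s * Im (\<xi> / \<tau>) < 0"
  shows "closed_segment (of_real s) \<xi> \<subseteq> xi_domain \<tau>"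
proof
  fix w assume "w \<in> closed_segment (of_real s) \<xi>"
  then obtain u where u: "0 \<le> u" "u \<le> 1" "w = of_real (1 - u) * of_real s + of_real u * \<xi>"
    by (auto simp: closed_segment_def scaleR_conv_of_real)
  have Im_inv: "Im (1 / \<tau>) < 0" using \<tau> by (simp add: Im_divide field_simps sum_power2_gt_zero_iff)
  have w': "w / \<tau> = of_real ((1 - u) * s) * (1 / \<tau>) + of_real u * (\<xi> / \<tau>)"
    using u by (simp add: add_divide_distrib)
  \<comment> \<open>Multiplying by \<open>s\<close> treats both half-planes at once: the result is a
    convex combination of two negative numbers.\<close>
  have "s * Im (w / \<tau>) = (1 - u) * (s * s * Im (1 / \<tau>)) + u * (s * Im (\<xi> / \<tau>))"
  proof -
    define A B where "A = 1 / \<tau>" and "B = \<xi> / \<tau>"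
    show ?thesis unfolding w' A_def[symmetric] B_def[symmetric] by (simp add: algebra_simps)
  qed
  moreover have "s * s * Im (1 / \<tau>) < 0" using Im_inv s by (intro mult_pos_neg) auto
  ultimately have "s * Im (w / \<tau>) < 0"
    using \<xi>(2) u convex_bound_lt[of "s * s * Im (1 / \<tau>)" 0 "s * Im (\<xi> / \<tau>)" "1 - u" u] by simp
  then have "Im (w / \<tau>) \<noteq> 0" by auto
  then have 1: "w / \<tau> \<notin> \<real>\<^sub>\<le>\<^sub>0" by (auto simp: complex_nonpos_Reals_iff)
  have "w \<notin> real_cuts"
  proof
    assume "w \<in> real_cuts"
    then have w: "Im w = 0" "\<bar>Re w\<bar> \<ge> 1" by (auto simp: mem_real_cuts_iff)
    have "u \<noteq> 0" using w s u by auto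
    then have "Im \<xi> = 0" using w u by simp
    then have "\<bar>Re \<xi>\<bar> < 1" using \<xi> by (auto simp: mem_real_cuts_iff)
    have "\<bar>Re w\<bar> \<le> (1 - u) * \<bar>s\<bar> + u * \<bar>Re \<xi>\<bar>"
      using u abs_triangle_ineq[of "(1 - u) * s" "u * Re \<xi>"] by (simp add: abs_mult)
    also have "\<dots> < (1 - u) * 1 + u * 1"
      using \<open>\<bar>Re \<xi>\<bar> < 1\<close> u \<open>u \<noteq> 0\<close> s by (intro add_le_less_mono mult_left_mono mult_strict_left_mono) auto
    finally show False using w by simp
  qed
  then show "w \<in> xi_domain \<tau>" using 1 by (simp add: xi_domain_def)
qed

text \<open>Each of the two stars is a union of segments through its centre and meets the upper
  half-plane.\<close>

lemma connected_xi_domain: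
  assumes \<tau>: "Im \<tau> > 0"
  shows "connected (xi_domain \<tau>)"
proof -
  define U where "U = {\<xi>. Im \<xi> > 0}"
  have U: "connected U" unfolding U_def by (intro convex_connected convex_halfspace_Im_gt)
  have half: "s \<in> {1 / 2, - 1 / 2 :: real} \<Longrightarrow> \<exists>v\<in>U. v \<notin> real_cuts \<and> s * Im (v / \<tau>) < 0" for s
  proof -
    assume s: "s \<in> {1 / 2, - 1 / 2 :: real}"
    have Im_inv: "Im (1 / \<tau>) < 0" using \<tau> by (simp add: Im_divide field_simps sum_power2_gt_zero_iff)
    \<comment> \<open>Adding \<open>\<tau>\<close> raises the centre into the upper half-plane
      without changing the imaginary part of the quotient by \<open>\<tau>\<close>.\<close>
    define v where "v = of_real s + of_real (1 :: real) * \<tau>"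
    have "\<tau> \<noteq> 0" using \<tau> by auto
    then have v': "v / \<tau> = of_real s * (1 / \<tau>) + 1" by (simp add: v_def add_divide_distrib)
    define A where "A = 1 / \<tau>"
    have "s * Im (v / \<tau>) = s * s * Im (1 / \<tau>)" unfolding v' A_def[symmetric] by simp
    also have "\<dots> < 0" using Im_inv s by (intro mult_pos_neg) auto
    finally show ?thesis using \<tau> uhp_not_cut(1)[of v] by (intro bexI[of _ v]) (auto simp: v_def U_def)
  qed
  define T where "T = (\<lambda>s::real. \<Union>\<xi>\<in>{\<xi>. \<xi> \<notin> real_cuts \<and> s * Im (\<xi> / \<tau>) < 0}. closed_segment (of_real s) \<xi>)"
  have T: "connected (T s)" "T s \<subseteq> xi_domain \<tau>" "T s \<inter> U \<noteq> {}" if s: "s \<in> {1 / 2, - 1 / 2}" for s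
  proof -
    show "connected (T s)" unfolding T_def
      by (rule connected_Union) (auto intro!: exI[of _ "of_real s"])
    show "T s \<subseteq> xi_domain \<tau>" unfolding T_def using star_sector[OF \<tau> s] by blast
    obtain v where "v \<in> U" "v \<notin> real_cuts" "s * Im (v / \<tau>) < 0" using half[OF s] by blast
    then have "v \<in> T s \<inter> U" unfolding T_def by auto
    then show "T s \<inter> U \<noteq> {}" by blast
  qed
  have "connected (U \<union> T (1/2))" using T[of "1/2"] U by (intro connected_Un) auto
  then have "connected ((U \<union> T (1/2)) \<union> T (- 1/2))" by (rule connected_Un) (use T[of "- 1/2"] in auto)
  moreover have "xi_domain \<tau> = (U \<union> T (1/2)) \<union> T (- 1/2)"
  proof
    show "(U \<union> T (1/2)) \<union> T (- 1/2) \<subseteq> xi_domain \<tau>"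
      using T(2)[of "1/2"] T(2)[of "- 1/2"] uhp_subset_xi_domain[OF \<tau>] by (auto simp: U_def)
    show "xi_domain \<tau> \<subseteq> (U \<union> T (1/2)) \<union> T (- 1/2)"
    proof
      fix \<xi> assume \<xi>: "\<xi> \<in> xi_domain \<tau>"
      then have c: "\<xi> \<notin> real_cuts" "\<xi> / \<tau> \<notin> \<real>\<^sub>\<le>\<^sub>0" by (auto simp: xi_domain_def)
      consider "Im (\<xi> / \<tau>) < 0" | "Im (\<xi> / \<tau>) > 0" | "Im (\<xi> / \<tau>) = 0" by linarith
      then show "\<xi> \<in> (U \<union> T (1/2)) \<union> T (- 1/2)"
      proof cases
        case 1
        then have "\<xi> \<in> T (1/2)" unfolding T_def using c by (intro UN_I[of \<xi>]) auto
        then show ?thesis by blast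
      next
        case 2
        then have "\<xi> \<in> T (- 1/2)" unfolding T_def using c by (intro UN_I[of \<xi>]) auto
        then show ?thesis by blast
      next
        case 3
        \<comment> \<open>On the dividing line only the positive multiples of \<open>\<tau>\<close>
          remain, and they lie in the upper half-plane.\<close>
        then have "Re (\<xi> / \<tau>) > 0" using c by (auto simp: complex_nonpos_Reals_iff)
        moreover define c where "c = Re (\<xi> / \<tau>)"
        have "\<xi> / \<tau> = of_real c" using 3 by (simp add: complex_eq_iff c_def)
        then have "\<xi> = of_real c * \<tau>" using uhp_not_cut(3)[OF \<tau>] nonzero_divide_eq_eq by blast
        then have "Im \<xi> = c * Im \<tau>" by simp
        ultimately show ?thesis using \<tau> by (auto simp: U_def c_def)
      qed
    qed
  qed
  ultimately show ?thesis by simp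
qed

text \<open>An explicit continuation shows that the choice is made from a nonempty set; the identity
  theorem makes the choice unique on \<open>D\<close>.\<close>

lemma analytic_continuation_eq:
  assumes "F holomorphic_on D" "\<And>z. z \<in> U \<Longrightarrow> F z = f z" "open D" "connected D" "open U" "U \<noteq> {}" "U \<subseteq> D" "z \<in> D"
  shows "analytic_continuation f U D z = F z"
proof -
  let ?F = "analytic_continuation f U D"
  have "F holomorphic_on D \<and> (\<forall>z\<in>U. F z = f z)" using assms by blast
  then have F: "?F holomorphic_on D \<and> (\<forall>z\<in>U. ?F z = f z)"
    unfolding analytic_continuation_def
    by (rule someI[of "\<lambda>F. F holomorphic_on D \<and> (\<forall>z\<in>U. F z = f z)" F])
  then show ?thesis
    using assms by (intro analytic_continuation_open[OF \<open>open U\<close> \<open>open D\<close> \<open>U \<noteq> {}\<close> \<open>connected D\<close> \<open>U \<subseteq> D\<close>, of ?F F z]) auto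
qed

text \<open>Both arguments lie in (0, pi), so their difference is principal. The left-hand side is
  the form to be continued, because its cut in \<open>\<xi>\<close> is the half-line removed from
  \<open>xi_domain \<tau>\<close>.\<close>

lemma Ln_add_Ln_divide:
  assumes "Im \<tau> > 0" "Im \<xi> > 0"
  shows "Ln \<tau> + Ln (\<xi> / \<tau>) = Ln \<xi>"
proof -
  have "Ln (\<xi> / \<tau>) = Ln \<xi> - Ln \<tau>"
  proof (rule Ln_unique)
    show "exp (Ln \<xi> - Ln \<tau>) = \<xi> / \<tau>" using uhp_not_cut(3)[OF assms(1)] uhp_not_cut(3)[OF assms(2)] by (simp add: exp_diff)
    show "- pi < Im (Ln \<xi> - Ln \<tau>)" "Im (Ln \<xi> - Ln \<tau>) \<le> pi"
      using Im_Ln_pos_lt_imp[OF assms(1)] Im_Ln_pos_lt_imp[OF assms(2)] by auto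
  qed
  then show ?thesis by simp
qed

lemma log_one_minus_x_eq:
  assumes \<tau>: "Im \<tau> > 0" and \<xi>: "\<xi> \<in> xi_domain \<tau>"
  shows "log_one_minus_x \<tau> \<xi> =
    of_real pi * \<i> * \<xi> + of_real (ln (2 * pi)) - of_real pi * \<i> / 2 + (Ln \<tau> + Ln (\<xi> / \<tau>)) - 2 * lg_sym \<xi>"
proof -
  have lg: "lg_sym holomorphic_on xi_domain \<tau>"
    by (rule holomorphic_on_subset[OF lg_sym_holomorphic]) (auto simp: xi_domain_def)
  have t: "\<tau> \<noteq> 0" using \<tau> by auto
  show ?thesis
    unfolding log_one_minus_x_def
  proof (rule analytic_continuation_eq[OF _ _ open_xi_domain[OF t] connected_xi_domain[OF \<tau>] _ _ uhp_subset_xi_domain[OF \<tau>] \<xi>,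
      where F = "\<lambda>\<xi>. of_real pi * \<i> * \<xi> + of_real (ln (2 * pi)) - of_real pi * \<i> / 2 + (Ln \<tau> + Ln (\<xi> / \<tau>)) - 2 * lg_sym \<xi>"])
    show "(\<lambda>\<xi>. of_real pi * \<i> * \<xi> + of_real (ln (2 * pi)) - of_real pi * \<i> / 2 + (Ln \<tau> + Ln (\<xi> / \<tau>)) - 2 * lg_sym \<xi>) holomorphic_on xi_domain \<tau>"
      using t by (intro holomorphic_intros lg) (auto simp: xi_domain_def)
    show "of_real pi * \<i> * z + of_real (ln (2 * pi)) - of_real pi * \<i> / 2 + (Ln \<tau> + Ln (z / \<tau>)) - 2 * lg_sym z =
        Ln (1 - exp (2 * of_real pi * \<i> * z))" if "z \<in> {\<xi>. Im \<xi> > 0}" for z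
      using that Ln_add_Ln_divide[OF \<tau>, of z] Ln_one_minus_eq_log_uhp[of z] by (simp add: log_uhp_def)
    show "{\<xi>. Im \<xi> > 0} \<noteq> {}" by (auto intro!: exI[of _ \<i>])
  qed (auto simp: open_halfspace_Im_gt)
qed

lemma Li2_x_eq:
  assumes \<tau>: "Im \<tau> > 0" and \<xi>: "\<xi> \<in> xi_domain \<tau>"
  shows "Li2_x \<tau> \<xi> = Li2_const - 2 * of_real pi * \<i> * (Li2_uhp_aux \<xi> + \<xi> * (Ln \<tau> + Ln (\<xi> / \<tau>)) - \<xi>)"
proof -
  have lg: "lg_sym_primitive holomorphic_on xi_domain \<tau>"
    by (rule holomorphic_on_subset[OF lg_sym_primitive_holomorphic]) (auto simp: xi_domain_def)
  have t: "\<tau> \<noteq> 0" using \<tau> by auto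
  show ?thesis
    unfolding Li2_x_def
  proof (rule analytic_continuation_eq[OF _ _ open_xi_domain[OF t] connected_xi_domain[OF \<tau>] _ _ uhp_subset_xi_domain[OF \<tau>] \<xi>,
      where F = "\<lambda>\<xi>. Li2_const - 2 * of_real pi * \<i> * (Li2_uhp_aux \<xi> + \<xi> * (Ln \<tau> + Ln (\<xi> / \<tau>)) - \<xi>)"])
    show "(\<lambda>\<xi>. Li2_const - 2 * of_real pi * \<i> * (Li2_uhp_aux \<xi> + \<xi> * (Ln \<tau> + Ln (\<xi> / \<tau>)) - \<xi>)) holomorphic_on xi_domain \<tau>"
      unfolding Li2_uhp_aux_def
      using t by (intro holomorphic_intros lg) (auto simp: xi_domain_def)
    show "Li2_const - 2 * of_real pi * \<i> * (Li2_uhp_aux z + z * (Ln \<tau> + Ln (z / \<tau>)) - z) =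
        Li2_series (exp (2 * of_real pi * \<i> * z))" if "z \<in> {\<xi>. Im \<xi> > 0}" for z
      using that Ln_add_Ln_divide[OF \<tau>, of z] Li2_series_uhp[of z] by simp
    show "{\<xi>. Im \<xi> > 0} \<noteq> {}" by (auto intro!: exI[of _ \<i>])
  qed (auto simp: open_halfspace_Im_gt)
qed

section \<open>The prefactor without its branch cut\<close>

text \<open>What remains of log(1 - x)/2 + Li2(x)/log q + G after all terms with
  \<open>Ln (\<xi> / \<tau>)\<close> and \<open>ln_Gamma (\<xi> / \<tau> + 1)\<close> have been
  removed. In \<open>\<xi>\<close> it is holomorphic on the whole cut plane.\<close>

definition H_fun :: "complex \<Rightarrow> complex \<Rightarrow> complex" where
  "H_fun \<tau> \<xi> = (of_real pi * \<i> * \<xi> + of_real (ln (2 * pi)) - of_real pi * \<i> / 2 + Ln \<tau>) / 2 - lg_sym \<xi>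
     + Li2_const / (2 * of_real pi * \<i> * \<tau>) - (Li2_uhp_aux \<xi> + \<xi> * Ln \<tau>) / \<tau> + of_real (ln (2 * pi) / 2)"

text \<open>The logarithms of \<open>\<xi> / \<tau>\<close> in the three factors add up to a single one, so the branch cut disappears.\<close>

lemma exp_prefactor_gen:
  assumes z: "z \<notin> \<real>\<^sub>\<le>\<^sub>0" and t: "\<tau> \<noteq> 0" "z = \<xi> / \<tau>"
    and L: "L = of_real pi * \<i> * \<xi> + of_real (ln (2 * pi)) - of_real pi * \<i> / 2 + (Ln \<tau> + Ln (\<xi> / \<tau>)) - 2 * lg_sym \<xi>"
    and Li: "Li = Li2_const - 2 * of_real pi * \<i> * (Li2_uhp_aux \<xi> + \<xi> * (Ln \<tau> + Ln (\<xi> / \<tau>)) - \<xi>)"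
  shows "exp (L / 2) * exp (Li / (2 * of_real pi * \<i> * \<tau>) + G_fun \<tau> \<xi> + p) = rGamma z * exp (H_fun \<tau> \<xi> + p)"
proof -
  have z1: "z + 1 \<notin> \<int>\<^sub>\<le>\<^sub>0"
  proof
    assume "z + 1 \<in> \<int>\<^sub>\<le>\<^sub>0"
    then have "z + 1 \<in> \<real>\<^sub>\<le>\<^sub>0" using nonpos_Ints_subset_nonpos_Reals by blast
    then show False using z by (auto simp: complex_nonpos_Reals_iff)
  qed
  have z0: "z \<noteq> 0" using z by auto
  \<comment> \<open>The coefficients 1/2, -z and z + 1/2 of \<open>Ln z\<close> add up to 1, and
    this one logarithm is the factor in 1/Gamma(z) = z/Gamma(z + 1).\<close>
  have "rGamma z = exp (Ln z - ln_Gamma (z + 1))"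
  proof -
    have "rGamma z = z * rGamma (z + 1)" by (rule rGamma_plus1[symmetric])
    also have "\<dots> = exp (Ln z) * exp (- ln_Gamma (z + 1))"
      using z0 z1 by (simp add: rGamma_complex_altdef)
    finally show ?thesis by (simp add: exp_add[symmetric])
  qed
  moreover have "L / 2 + (Li / (2 * of_real pi * \<i> * \<tau>) + G_fun \<tau> \<xi> + p) = (Ln z - ln_Gamma (z + 1)) + (H_fun \<tau> \<xi> + p)"
  proof -
    have ls: "ln (sqrt (2 * pi)) = ln (2 * pi) / 2" by (simp add: ln_sqrt)
    have "Li / (2 * of_real pi * \<i> * \<tau>) = Li2_const / (2 * of_real pi * \<i> * \<tau>) - (Li2_uhp_aux \<xi> + \<xi> * (Ln \<tau> + Ln z) - \<xi>) / \<tau>"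
    proof -
      have "(C - 2 * of_real pi * \<i> * X) / (2 * of_real pi * \<i> * \<tau>) = C / (2 * of_real pi * \<i> * \<tau>) - X / \<tau>" for C X
        by (simp add: diff_divide_distrib)
      then show ?thesis unfolding Li t(2)[symmetric] .
    qed
    also have "(Li2_uhp_aux \<xi> + \<xi> * (Ln \<tau> + Ln z) - \<xi>) / \<tau> = (Li2_uhp_aux \<xi> + \<xi> * Ln \<tau>) / \<tau> + z * Ln z - z"
      using t by (simp add: field_simps)
    finally show ?thesis
      unfolding L G_fun_def H_fun_def t(2)[symmetric] ls by (simp add: algebra_simps add_divide_distrib diff_divide_distrib)
  qed
  ultimately show ?thesis by (simp only: mult_exp_exp)
qed

lemma exp_prefactor:
  assumes "Im \<tau> > 0" "\<xi> \<notin> real_cuts" "\<xi> / \<tau> \<notin> \<real>\<^sub>\<le>\<^sub>0"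
  shows "sqrt_one_minus_x \<tau> \<xi> * exp (Li2_x \<tau> \<xi> / (2 * of_real pi * \<i> * \<tau>) + G_fun \<tau> \<xi> + p) =
     rGamma (\<xi> / \<tau>) * exp (H_fun \<tau> \<xi> + p)"
proof -
  have "\<xi> \<in> xi_domain \<tau>" using assms by (simp add: xi_domain_def)
  then show ?thesis
    unfolding sqrt_one_minus_x_def using assms
    by (intro exp_prefactor_gen log_one_minus_x_eq Li2_x_eq) auto
qed

text \<open>In the upper half-plane the first factor and the dilogarithm are principal functions of
  x, which shows how the prefactor behaves when \<open>\<xi>\<close> increases by 1.\<close>

lemma exp_prefactor_uhp:
  assumes "Im \<tau> > 0" "Im \<xi> > 0"
  shows "exp (Ln (1 - exp (2 * of_real pi * \<i> * \<xi>)) / 2) *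
      exp (Li2_series (exp (2 * of_real pi * \<i> * \<xi>)) / (2 * of_real pi * \<i> * \<tau>) + G_fun \<tau> \<xi> + p) =
     rGamma (\<xi> / \<tau>) * exp (H_fun \<tau> \<xi> + p)"
proof (rule exp_prefactor_gen)
  show "\<xi> / \<tau> \<notin> \<real>\<^sub>\<le>\<^sub>0" using uhp_subset_xi_domain[OF assms(1)] assms(2) by (auto simp: xi_domain_def)
qed (use assms Ln_one_minus_eq_log_uhp[of \<xi>] Li2_series_uhp[of \<xi>] Ln_add_Ln_divide[OF assms] in \<open>auto simp: log_uhp_def\<close>)

section \<open>Difference equations of the integral\<close>

lemma norm_le_deriv_bound_segment:
  fixes f :: "complex \<Rightarrow> complex"
  assumes "\<And>v. (f has_field_derivative f' v) (at v)" "f 0 = 0"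
    and "\<And>v. v \<in> closed_segment 0 w \<Longrightarrow> norm (f' v) \<le> B"
  shows "norm (f w) \<le> B * norm w"
proof -
  have "norm (f w - f 0) \<le> B * norm (w - 0)"
    by (rule field_differentiable_bound[of "closed_segment 0 w" f f'])
       (use assms in \<open>auto intro: has_field_derivative_at_within\<close>)
  then show ?thesis using assms(2) by simp
qed

lemma closed_segment_0_bounds:
  fixes w :: complex
  assumes "v \<in> closed_segment 0 w"
  shows "norm v \<le> norm w" "\<bar>Re v\<bar> \<le> \<bar>Re w\<bar>"
  using assms by (auto simp: closed_segment_def abs_mult mult_left_le_one_le)

lemma norm_cosh_le: "norm (cosh (w :: complex)) \<le> exp \<bar>Re w\<bar>"
proof -
  have "norm (cosh w) = norm (exp w + exp (- w)) / 2"
    by (simp add: cosh_def scaleR_conv_of_real norm_mult)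
  also have "\<dots> \<le> (exp (Re w) + exp (- Re w)) / 2"
    using norm_triangle_ineq[of "exp w" "exp (- w)"] by simp
  also have "\<dots> \<le> (exp \<bar>Re w\<bar> + exp \<bar>Re w\<bar>) / 2" by (intro divide_right_mono add_mono) auto
  finally show ?thesis by simp
qed

text \<open>This and the next two estimates each integrate the preceding one along the segment from
  0, on which neither the norm nor the modulus of the real part exceeds its value at
  \<open>w\<close>.\<close>

lemma norm_sinh_le: "norm (sinh (w :: complex)) \<le> norm w * exp \<bar>Re w\<bar>"
proof -
  have "norm (sinh w) \<le> exp \<bar>Re w\<bar> * norm w"
  proof (rule norm_le_deriv_bound_segment[where f' = cosh])
    fix v assume v: "v \<in> closed_segment 0 w"
    have "norm (cosh v) \<le> exp \<bar>Re v\<bar>" by (rule norm_cosh_le)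
    also have "\<dots> \<le> exp \<bar>Re w\<bar>" using closed_segment_0_bounds[OF v] by simp
    finally show "norm (cosh v) \<le> exp \<bar>Re w\<bar>" .
  qed (auto intro!: derivative_eq_intros)
  then show ?thesis by (simp add: mult.commute)
qed

lemma norm_cosh_minus_one_le: "norm (cosh (w :: complex) - 1) \<le> norm w ^ 2 * exp \<bar>Re w\<bar>"
proof -
  have "norm (cosh w - 1) \<le> (norm w * exp \<bar>Re w\<bar>) * norm w"
  proof (rule norm_le_deriv_bound_segment[where f' = sinh])
    fix v assume v: "v \<in> closed_segment 0 w"
    have "norm (sinh v) \<le> norm v * exp \<bar>Re v\<bar>" by (rule norm_sinh_le)
    also have "\<dots> \<le> norm w * exp \<bar>Re w\<bar>" using closed_segment_0_bounds[OF v] by (intro mult_mono) auto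
    finally show "norm (sinh v) \<le> norm w * exp \<bar>Re w\<bar>" .
  qed (auto intro!: derivative_eq_intros)
  then show ?thesis by (simp add: mult_ac power2_eq_square)
qed

lemma norm_sinh_minus_self_le: "norm (sinh (w :: complex) - w) \<le> norm w ^ 3 * exp \<bar>Re w\<bar>"
proof -
  have "norm (sinh w - w) \<le> (norm w ^ 2 * exp \<bar>Re w\<bar>) * norm w"
  proof (rule norm_le_deriv_bound_segment[where f' = "\<lambda>v. cosh v - 1"])
    fix v assume v: "v \<in> closed_segment 0 w"
    have "norm (cosh v - 1) \<le> norm v ^ 2 * exp \<bar>Re v\<bar>" by (rule norm_cosh_minus_one_le)
    also have "\<dots> \<le> norm w ^ 2 * exp \<bar>Re w\<bar>" using closed_segment_0_bounds[OF v] by (intro mult_mono power_mono) auto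
    finally show "norm (cosh v - 1) \<le> norm w ^ 2 * exp \<bar>Re w\<bar>" .
  qed (auto intro!: derivative_eq_intros)
  then show ?thesis by (simp add: mult_ac power3_eq_cube power2_eq_square)
qed

section \<open>Integrals with the kernel 1/(r (exp(ar) - 1))\<close>

definition bose_kernel :: "complex \<Rightarrow> real \<Rightarrow> complex" where
  "bose_kernel a r = 1 / (of_real r * (exp (a * of_real r) - 1))"

lemma exp_mult_minus_one_nonzero:
  fixes a :: complex
  assumes "Re a = 1" "r > 0"
  shows "exp (a * of_real r) - 1 \<noteq> 0"
proof
  assume "exp (a * of_real r) - 1 = 0"
  then have "norm (exp (a * of_real r) - 1) = 0" by (simp only: norm_zero)
  then have "exp r \<le> 1" using norm_exp_minus_one_ge[OF assms(1), of r] by linarith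
  then show False using assms(2) by simp
qed

lemma continuous_bose_kernel: "Re a = 1 \<Longrightarrow> continuous_on {0<..} (bose_kernel a)"
  unfolding bose_kernel_def using exp_mult_minus_one_nonzero by (auto intro!: continuous_intros)

text \<open>A numerator of order \<open>r ^ 2\<close> cancels the double pole at 0. Of the gap
  \<open>1 - \<rho>\<close> in the exponent one half pays for the factor
  \<open>r / (exp r - 1)\<close> and the other half remains as decay.\<close>

lemma norm_bose_kernel_le:
  assumes "Re a = 1" "\<bar>Re z\<bar> \<le> \<rho>" "\<rho> < 1" "r > 0" "c \<ge> 0"
    and N: "norm N \<le> c * r ^ 2 * exp (\<bar>Re z\<bar> * r)"
  shows "norm (N * bose_kernel a r) \<le> c / ((1 - \<rho>) / 2) * exp (- ((1 - \<rho>) / 2) * r)"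
proof -
  define \<eta> where "\<eta> = (1 - \<rho>) / 2"
  have \<eta>: "0 < \<eta>" "\<eta> \<le> 1" using assms by (auto simp: \<eta>_def)
  have pos: "exp r - 1 > 0" using assms by simp
  have "norm (bose_kernel a r) = 1 / (r * norm (exp (a * of_real r) - 1))"
    using assms by (simp add: bose_kernel_def norm_divide norm_mult)
  also have "\<dots> \<le> 1 / (r * (exp r - 1))"
    using norm_exp_minus_one_ge[OF assms(1), of r] pos assms(4)
    by (intro divide_left_mono mult_left_mono mult_pos_pos) auto
  finally have K: "norm (bose_kernel a r) \<le> 1 / (r * (exp r - 1))" .
  have N': "norm N \<le> c * r ^ 2 * exp (\<rho> * r)"
    by (rule order_trans[OF N]) (use assms in \<open>auto intro!: mult_left_mono\<close>)
  have "norm (N * bose_kernel a r) \<le> (c * r ^ 2 * exp (\<rho> * r)) * (1 / (r * (exp r - 1)))"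
    unfolding norm_mult using K N' assms by (intro mult_mono) auto
  also have "\<dots> = c * exp (\<rho> * r) * (r / (exp r - 1))"
    using assms(4) by (simp add: power2_eq_square)
  also have "\<dots> \<le> c * exp (\<rho> * r) * (exp (- (1 - \<eta>) * r) / \<eta>)"
    using div_exp_minus_one_le'[OF \<eta> assms(4)] assms(5) by (intro mult_left_mono) auto
  also have "\<dots> = c / \<eta> * (exp (\<rho> * r) * exp (- (1 - \<eta>) * r))" by simp
  also have "exp (\<rho> * r) * exp (- (1 - \<eta>) * r) = exp (- \<eta> * r)"
    unfolding mult_exp_exp by (simp add: \<eta>_def field_simps)
  finally show ?thesis by (simp add: \<eta>_def)
qed

lemma abs_Re_mult_of_real: "r > 0 \<Longrightarrow> \<bar>Re (z * of_real r)\<bar> = \<bar>Re z\<bar> * r"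
  by (simp add: abs_mult)

text \<open>\<open>bose1\<close>, \<open>bose2\<close>, \<open>bose3\<close> are successive
  primitives of \<open>bose0\<close> in \<open>z\<close> that vanish at \<open>z = 0\<close>;
  subtracting 1 and \<open>z\<close> keeps all numerators of order \<open>r ^ 2\<close>.\<close>

definition bose0 :: "complex \<Rightarrow> complex \<Rightarrow> real \<Rightarrow> complex" where
  "bose0 a z r = of_real r ^ 2 * cosh (z * of_real r) * bose_kernel a r"
definition bose1 :: "complex \<Rightarrow> complex \<Rightarrow> real \<Rightarrow> complex" where
  "bose1 a z r = of_real r * sinh (z * of_real r) * bose_kernel a r"
definition bose2 :: "complex \<Rightarrow> complex \<Rightarrow> real \<Rightarrow> complex" where
  "bose2 a z r = (cosh (z * of_real r) - 1) * bose_kernel a r"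
definition bose3 :: "complex \<Rightarrow> complex \<Rightarrow> real \<Rightarrow> complex" where
  "bose3 a z r = (sinh (z * of_real r) / of_real r - z) * bose_kernel a r"

lemma continuous_bose:
  assumes "Re a = 1"
  shows "continuous_on {0<..} (bose0 a z)" "continuous_on {0<..} (bose1 a z)"
    "continuous_on {0<..} (bose2 a z)" "continuous_on {0<..} (bose3 a z)"
proof -
  have [continuous_intros]: "continuous_on {0<..} (\<lambda>r. bose_kernel a r)"
    using continuous_bose_kernel[OF assms] by simp
  show "continuous_on {0<..} (bose0 a z)" "continuous_on {0<..} (bose1 a z)"
    "continuous_on {0<..} (bose2 a z)" "continuous_on {0<..} (bose3 a z)"
    unfolding bose0_def bose1_def bose2_def bose3_def
    by (auto intro!: continuous_intros)
qed

lemma norm_bose_le: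
  assumes a: "Re a = 1" and z: "\<bar>Re z\<bar> \<le> \<rho>" "\<rho> < 1" "norm z \<le> m" "1 \<le> m" and r: "r > 0"
  defines "C \<equiv> m ^ 3 / ((1 - \<rho>) / 2)" and "\<delta> \<equiv> (1 - \<rho>) / 2"
  shows "norm (bose0 a z r) \<le> C * exp (- \<delta> * r)" "norm (bose1 a z r) \<le> C * exp (- \<delta> * r)"
    "norm (bose2 a z r) \<le> C * exp (- \<delta> * r)" "norm (bose3 a z r) \<le> C * exp (- \<delta> * r)"
proof -
  define e where "e = exp (\<bar>Re z\<bar> * r)"
  have e: "e > 0" by (simp add: e_def)
  have e': "exp \<bar>Re (z * of_real r)\<bar> = e" using abs_Re_mult_of_real[OF r, of z] by (simp add: e_def)
  have nz: "norm (z * of_real r) = norm z * r" using r by (simp add: norm_mult)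
  \<comment> \<open>The four numerators carry the powers 0 to 3 of the norm of \<open>z\<close>;
    since \<open>m \<ge> 1\<close>, the cube serves them all.\<close>
  have m3: "1 \<le> m ^ 3" "norm z \<le> m ^ 3" "norm z ^ 2 \<le> m ^ 3" "norm z ^ 3 \<le> m ^ 3"
  proof -
    show "1 \<le> m ^ 3" using z by simp
    have m: "m ^ 1 \<le> m ^ 3" "m ^ 2 \<le> m ^ 3" using z by (intro power_increasing; simp)+
    show "norm z \<le> m ^ 3" using m(1) z(3) by simp
    show "norm z ^ 2 \<le> m ^ 3" using m(2) power_mono[OF z(3) norm_ge_zero, of 2] by linarith
    show "norm z ^ 3 \<le> m ^ 3" using power_mono[OF z(3) norm_ge_zero, of 3] .
  qed
  have "m ^ 3 \<ge> 0" using m3(1) by linarith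
  note R = norm_bose_kernel_le[OF a z(1,2) r \<open>m ^ 3 \<ge> 0\<close>, folded e_def, folded C_def \<delta>_def]
  have le: "k * (r ^ 2 * e) \<le> m ^ 3 * r ^ 2 * e" if "k \<le> m ^ 3" for k
    using mult_right_mono[OF that, of "r ^ 2 * e"] e by (simp add: mult_ac)
  have "norm (of_real r ^ 2 * cosh (z * of_real r)) \<le> 1 * (r ^ 2 * e)"
    using norm_cosh_le[of "z * of_real r"] r unfolding e' by (simp add: norm_mult norm_power)
  from R[OF order_trans[OF this le]] show "norm (bose0 a z r) \<le> C * exp (- \<delta> * r)"
    using m3 unfolding bose0_def by blast
  have "norm (of_real r * sinh (z * of_real r)) \<le> r * (norm z * r * e)"
    using norm_sinh_le[of "z * of_real r"] r unfolding e' nz by (simp add: norm_mult)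
  then have "norm (of_real r * sinh (z * of_real r)) \<le> norm z * (r ^ 2 * e)" by (simp add: power2_eq_square mult_ac)
  from R[OF order_trans[OF this le]] show "norm (bose1 a z r) \<le> C * exp (- \<delta> * r)"
    using m3 unfolding bose1_def by blast
  have "norm (cosh (z * of_real r) - 1) \<le> norm z ^ 2 * (r ^ 2 * e)"
    using norm_cosh_minus_one_le[of "z * of_real r"] unfolding e' nz by (simp add: power_mult_distrib mult_ac)
  from R[OF order_trans[OF this le]] show "norm (bose2 a z r) \<le> C * exp (- \<delta> * r)"
    using m3 unfolding bose2_def by blast
  have "sinh (z * of_real r) / of_real r - z = (sinh (z * of_real r) - z * of_real r) / of_real r"
    using r by (simp add: field_simps)
  then have "norm (sinh (z * of_real r) / of_real r - z) = norm (sinh (z * of_real r) - z * of_real r) / r"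
    using r by (simp add: norm_divide)
  also have "\<dots> \<le> ((norm z * r) ^ 3 * e) / r"
    using norm_sinh_minus_self_le[of "z * of_real r"] r unfolding e' nz by (intro divide_right_mono) auto
  also have "\<dots> = norm z ^ 3 * (r ^ 2 * e)"
    using r by (simp add: power_mult_distrib power3_eq_cube power2_eq_square)
  finally have "norm (sinh (z * of_real r) / of_real r - z) \<le> norm z ^ 3 * (r ^ 2 * e)" .
  from R[OF order_trans[OF this le]] show "norm (bose3 a z r) \<le> C * exp (- \<delta> * r)"
    using m3 unfolding bose3_def by blast
qed

lemma bose_integrable:
  assumes a: "Re a = 1" and z: "\<bar>Re z\<bar> < 1"
  shows "half_line_integrable (bose0 a z)" "half_line_integrable (bose1 a z)"
    "half_line_integrable (bose2 a z)" "half_line_integrable (bose3 a z)"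
proof -
  have d: "(1 - \<bar>Re z\<bar>) / 2 > 0" using z by simp
  note B = norm_bose_le[OF a order_refl z, of "norm z + 1"]
  show "half_line_integrable (bose0 a z)" "half_line_integrable (bose1 a z)"
    "half_line_integrable (bose2 a z)" "half_line_integrable (bose3 a z)"
    by (rule half_line_integrableI[OF _ d], rule continuous_bose[OF a], rule B, auto)+
qed

lemma bose_has_field_derivative:
  assumes a: "Re a = 1" and z: "\<bar>Re z\<bar> < 1"
  shows "((\<lambda>z. half_line_integral (bose1 a z)) has_field_derivative half_line_integral (bose0 a z)) (at z)"
    "((\<lambda>z. half_line_integral (bose2 a z)) has_field_derivative half_line_integral (bose1 a z)) (at z)"
    "((\<lambda>z. half_line_integral (bose3 a z)) has_field_derivative half_line_integral (bose2 a z)) (at z)"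
proof -
  \<comment> \<open>A ball of half the distance to the edge of the strip, so that one
    \<open>\<rho> < 1\<close> serves all its points.\<close>
  define \<eta> where "\<eta> = (1 - \<bar>Re z\<bar>) / 2"
  define \<rho> where "\<rho> = (1 + \<bar>Re z\<bar>) / 2"
  have \<eta>: "\<eta> > 0" "\<rho> < 1" using z by (auto simp: \<eta>_def \<rho>_def)
  have w: "\<bar>Re w\<bar> \<le> \<rho>" "norm w \<le> norm z + 1" "\<bar>Re w\<bar> < 1" if "w \<in> ball z \<eta>" for w
  proof -
    have "norm (z - w) < \<eta>" using that by (simp add: dist_norm)
    then have "\<bar>Re z - Re w\<bar> < \<eta>" using abs_Re_le_cmod[of "z - w"] by simp
    then show "\<bar>Re w\<bar> \<le> \<rho>" by (simp add: \<eta>_def \<rho>_def field_simps abs_if split: if_splits)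
    then show "\<bar>Re w\<bar> < 1" using \<eta> by linarith
    have "\<eta> \<le> 1" by (simp add: \<eta>_def)
    then show "norm w \<le> norm z + 1" using \<open>norm (z - w) < \<eta>\<close> norm_triangle_ineq3[of z w] by linarith
  qed
  have d: "(1 - \<rho>) / 2 > 0" using \<eta> by simp
  note B = norm_bose_le[OF a w(1) \<eta>(2) w(2)]
  show "((\<lambda>z. half_line_integral (bose1 a z)) has_field_derivative half_line_integral (bose0 a z)) (at z)"
  proof (rule half_line_integral_has_field_derivative[OF \<eta>(1) d, where C = "(norm z + 1) ^ 3 / ((1 - \<rho>) / 2)"])
    show "((\<lambda>z. bose1 a z r) has_field_derivative bose0 a w r) (at w)" for w r
      unfolding bose1_def bose0_def by (auto intro!: derivative_eq_intros simp: power2_eq_square)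
  qed (use bose_integrable[OF a] w continuous_bose[OF a] B in auto)
  show "((\<lambda>z. half_line_integral (bose2 a z)) has_field_derivative half_line_integral (bose1 a z)) (at z)"
  proof (rule half_line_integral_has_field_derivative[OF \<eta>(1) d, where C = "(norm z + 1) ^ 3 / ((1 - \<rho>) / 2)"])
    show "((\<lambda>z. bose2 a z r) has_field_derivative bose1 a w r) (at w)" for w r
      unfolding bose1_def bose2_def by (auto intro!: derivative_eq_intros)
  qed (use bose_integrable[OF a] w continuous_bose[OF a] B in auto)
  show "((\<lambda>z. half_line_integral (bose3 a z)) has_field_derivative half_line_integral (bose2 a z)) (at z)"
  proof (rule half_line_integral_has_field_derivative[OF \<eta>(1) d, where C = "(norm z + 1) ^ 3 / ((1 - \<rho>) / 2)"])
    show "((\<lambda>z. bose3 a z r) has_field_derivative bose2 a w r) (at w)" if "r > 0" for w r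
      unfolding bose3_def bose2_def using that by (auto intro!: derivative_eq_intros)
  qed (use bose_integrable[OF a] w continuous_bose[OF a] B in auto)
qed

text \<open>The cosine is the mean of two exponentials, and both \<open>z\<close> and
  \<open>- z\<close> are admissible in the trigamma integral.\<close>

lemma half_line_integral_bose0:
  assumes a: "Re a = 1" and z: "\<bar>Re z\<bar> < 1"
  shows "half_line_integral (bose0 a z) = (Polygamma 1 (1 + z / a) + Polygamma 1 (1 - z / a)) / (2 * a ^ 2)"
proof -
  define f where "f = (\<lambda>w r. complex_of_real r * exp (- w * of_real r) / (exp (a * of_real r) - 1))"
  have f: "half_line_integrable (f z)" "half_line_integrable (f (- z))"
    "half_line_integral (f z) = Polygamma 1 (1 + z / a) / a ^ 2"
    "half_line_integral (f (- z)) = Polygamma 1 (1 - z / a) / a ^ 2"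
    unfolding f_def using half_line_integral_trigamma[OF a, of z] half_line_integral_trigamma[OF a, of "- z"] z
    by (auto simp: abs_if split: if_splits)
  have "half_line_integral (bose0 a z) = half_line_integral (\<lambda>r. (f z r + f (- z) r) / 2)"
  proof (rule set_lebesgue_integral_cong)
    show "\<forall>r. r \<in> {0<..} \<longrightarrow> bose0 a z r = (f z r + f (- z) r) / 2"
    proof (intro allI impI)
      fix r :: real assume "r \<in> {0<..}"
      then have r: "r > 0" by simp
      have c: "cosh (z * of_real r) = (exp (- z * of_real r) + exp (z * of_real r)) / 2"
        by (simp add: cosh_def scaleR_conv_of_real add.commute)
      have eq: "of_real r ^ 2 * ((p + q) / 2) * (1 / (of_real r * d)) = (of_real r * p / d + of_real r * q / d) / 2" for p q d :: complex
        using r by (simp add: power2_eq_square add_divide_distrib ring_distribs mult.commute)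
      show "bose0 a z r = (f z r + f (- z) r) / 2"
        unfolding bose0_def bose_kernel_def f_def c eq minus_minus ..
    qed
  qed auto
  also have "\<dots> = (half_line_integral (f z) + half_line_integral (f (- z))) / 2"
    using f(1,2) by (simp add: set_integral_add)
  finally show ?thesis unfolding f(3,4) by (simp add: add_divide_distrib mult.commute)
qed

text \<open>A real quotient \<open>c = z / a\<close> equals \<open>Re z\<close>, because
  \<open>Re a = 1\<close>.\<close>

lemma strip_div_notin_real_cuts:
  assumes "Re a = 1" "\<bar>Re z\<bar> < 1"
  shows "z / a \<notin> real_cuts"
proof
  assume "z / a \<in> real_cuts"
  then have *: "Im (z / a) = 0" "\<bar>Re (z / a)\<bar> \<ge> 1" by (auto simp: mem_real_cuts_iff)
  define c where "c = Re (z / a)"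
  have "z / a = of_real c" using * by (simp add: complex_eq_iff c_def)
  moreover have "a \<noteq> 0" using assms by auto
  ultimately have "z = of_real c * a" using nonzero_divide_eq_eq by blast
  then have "Re z = c" using assms by simp
  then show False using * assms by (simp add: c_def)
qed

lemma eq_on_strip:
  assumes f: "\<And>z. \<bar>Re z\<bar> < 1 \<Longrightarrow> (f has_field_derivative D z) (at z)"
    and g: "\<And>z. \<bar>Re z\<bar> < 1 \<Longrightarrow> (g has_field_derivative D z) (at z)"
    and "f 0 = g 0" and z: "\<bar>Re z\<bar> < 1"
  shows "f z = g (z :: complex)"
proof -
  let ?S = "{z::complex. -1 < Re z} \<inter> {z. Re z < 1}"
  have "(\<lambda>z. f z - g z) constant_on ?S"
  proof (rule has_field_derivative_0_imp_constant_on)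
    show "((\<lambda>z. f z - g z) has_field_derivative 0) (at z)" if "z \<in> ?S" for z
    proof -
      have "\<bar>Re z\<bar> < 1" using that by auto
      then show ?thesis using DERIV_diff[OF f[of z] g[of z]] by simp
    qed
    show "connected ?S" by (intro convex_connected convex_Int convex_halfspace_Re_gt convex_halfspace_Re_lt)
    show "open ?S" by (intro open_Int open_halfspace_Re_gt open_halfspace_Re_lt)
  qed
  moreover have "z \<in> ?S" "0 \<in> ?S" using z by auto
  ultimately have "f z - g z = f 0 - g 0" unfolding constant_on_def by metis
  then show ?thesis using assms(3) by simp
qed

text \<open>The trigamma formula for \<open>bose0\<close> is integrated three times from
  \<open>z = 0\<close>, passing through digamma, \<open>lg_sym\<close> and its primitive.\<close>

lemma half_line_integral_bose:
  assumes a: "Re a = 1" and z: "\<bar>Re z\<bar> < 1"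
  shows "half_line_integral (bose2 a z) = lg_sym (z / a)"
    and "half_line_integral (bose3 a z) = a * lg_sym_primitive (z / a)"
proof -
  have a0: "a \<noteq> 0" using a by auto
  have notcut: "z / a \<notin> real_cuts" "1 + z / a \<notin> \<real>\<^sub>\<le>\<^sub>0" "1 - z / a \<notin> \<real>\<^sub>\<le>\<^sub>0"
    "1 + z / a \<notin> \<int>\<^sub>\<le>\<^sub>0" "1 - z / a \<notin> \<int>\<^sub>\<le>\<^sub>0" if "\<bar>Re z\<bar> < 1" for z
  proof -
    show 1: "z / a \<notin> real_cuts" using strip_div_notin_real_cuts[OF a that] .
    show "1 + z / a \<notin> \<real>\<^sub>\<le>\<^sub>0" "1 - z / a \<notin> \<real>\<^sub>\<le>\<^sub>0" using one_pm_notin_nonpos_Reals[OF 1] by auto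
    then show "1 + z / a \<notin> \<int>\<^sub>\<le>\<^sub>0" "1 - z / a \<notin> \<int>\<^sub>\<le>\<^sub>0" using nonpos_Ints_subset_nonpos_Reals by blast+
  qed
  have z0: "half_line_integral (bose1 a 0) = 0" "half_line_integral (bose2 a 0) = 0" "half_line_integral (bose3 a 0) = 0"
    by (simp_all add: bose1_def bose2_def bose3_def set_lebesgue_integral_def)
  define g1 where "g1 = (\<lambda>z. (Digamma (1 + z / a) - Digamma (1 - z / a)) / (2 * a))"
  have g1: "(g1 has_field_derivative half_line_integral (bose0 a z)) (at z)" if "\<bar>Re z\<bar> < 1" for z
    unfolding g1_def half_line_integral_bose0[OF a that] using notcut[OF that] a0
    by (auto intro!: derivative_eq_intros simp: power2_eq_square add_divide_distrib)
  have e1: "half_line_integral (bose1 a z) = g1 z" if "\<bar>Re z\<bar> < 1" for z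
    by (rule eq_on_strip[OF bose_has_field_derivative(1)[OF a] g1 _ that]) (auto simp: z0 g1_def)
  have d2: "((\<lambda>z. lg_sym (z / a)) has_field_derivative half_line_integral (bose1 a z)) (at z)" if "\<bar>Re z\<bar> < 1" for z
    unfolding e1[OF that] lg_sym_def g1_def using notcut[OF that] a0
    by (auto intro!: derivative_eq_intros simp: diff_divide_distrib)
  have e2: "half_line_integral (bose2 a z) = lg_sym (z / a)" if "\<bar>Re z\<bar> < 1" for z
    by (rule eq_on_strip[OF bose_has_field_derivative(2)[OF a] d2 _ that]) (auto simp: z0)
  show "half_line_integral (bose2 a z) = lg_sym (z / a)" using e2[OF z] .
  have d3: "((\<lambda>z. a * lg_sym_primitive (z / a)) has_field_derivative half_line_integral (bose2 a z)) (at z)" if "\<bar>Re z\<bar> < 1" for z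
  proof -
    have "((\<lambda>z. lg_sym_primitive (z / a)) has_field_derivative lg_sym (z / a) * (1 / a)) (at z)"
      by (rule DERIV_chain2[where f = lg_sym_primitive and g = "\<lambda>z. z / a"])
         (use lg_sym_primitive_deriv[OF notcut(1)[OF that]] a0 in \<open>auto intro!: derivative_eq_intros\<close>)
    from DERIV_cmult[OF this, of a] show ?thesis unfolding e2[OF that] using a0 by simp
  qed
  show "half_line_integral (bose3 a z) = a * lg_sym_primitive (z / a)"
    by (rule eq_on_strip[OF bose_has_field_derivative(3)[OF a] d3 _ z]) (auto simp: z0)
qed

section \<open>The integral P and its two shifts\<close>

text \<open>P on the ray of argument - pi/2 in the coordinates \<open>a = 1 / \<tau>\<close> and
  \<open>z = \<xi> / \<tau>\<close>, as shown by \<open>P_ray_eq_P_int\<close>.\<close>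

definition P_int :: "complex \<Rightarrow> complex \<Rightarrow> complex" where
  "P_int a z = half_line_integral (\<lambda>r. sinh (z * of_real r) * of_real (2 * binet_kernel r) * bose_kernel a r)"

lemma P_int_continuous:
  assumes "Re a = 1"
  shows "continuous_on {0<..} (\<lambda>r. sinh (z * of_real r) * of_real (2 * binet_kernel r) * bose_kernel a r)"
proof -
  have [continuous_intros]: "continuous_on {0<..} (\<lambda>r. bose_kernel a r)"
    using continuous_bose_kernel[OF assms] by simp
  show ?thesis by (auto intro!: continuous_intros)
qed

lemma P_int_integrable:
  assumes a: "Re a = 1" and z: "\<bar>Re z\<bar> < 1"
  shows "half_line_integrable (\<lambda>r. sinh (z * of_real r) * of_real (2 * binet_kernel r) * bose_kernel a r)"
proof -
  obtain C where C: "C > 0" "\<And>r. r > 0 \<Longrightarrow> \<bar>binet_kernel r / r\<bar> \<le> C"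
    using binet_kernel_linear_bound by blast
  have d: "(1 - \<bar>Re z\<bar>) / 2 > 0" using z by simp
  show ?thesis
  proof (rule half_line_integrableI[OF P_int_continuous[OF a] d])
    fix r :: real assume r: "r > 0"
    have "\<bar>2 * binet_kernel r\<bar> \<le> 2 * C * r" using C(2)[OF r] r by (simp add: field_simps abs_mult)
    then have "norm (sinh (z * of_real r) * of_real (2 * binet_kernel r)) \<le> (norm (z * of_real r) * exp \<bar>Re (z * of_real r)\<bar>) * (2 * C * r)"
      unfolding norm_mult norm_of_real using C(1) r norm_sinh_le[of "z * of_real r"] by (intro mult_mono) (auto simp: norm_mult)
    also have "\<dots> = (2 * C * norm z) * r ^ 2 * exp (\<bar>Re z\<bar> * r)"
      unfolding abs_Re_mult_of_real[OF r] using r by (simp add: norm_mult power2_eq_square mult_ac)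
    finally show "norm (sinh (z * of_real r) * of_real (2 * binet_kernel r) * bose_kernel a r) \<le>
        (2 * C * norm z) / ((1 - \<bar>Re z\<bar>) / 2) * exp (- ((1 - \<bar>Re z\<bar>) / 2) * r)"
      using C(1) z r by (intro norm_bose_kernel_le[OF a]) auto
  qed
qed

text \<open>The difference of the two hyperbolic sines contains sinh(r/2), which cancels the
  denominator of coth(r/2); the term - 2/r of the kernel is carried along.\<close>

lemma sinh_shift_binet_kernel:
  fixes A :: complex
  assumes "r > 0"
  shows "(sinh (A + of_real r) - sinh A) * of_real (2 * binet_kernel r) =
     cosh (A + of_real r) + cosh A - 2 / of_real r * (sinh (A + of_real r) - sinh A)"
proof -
  define E where "E = exp (complex_of_real r)"
  define F where "F = exp A"
  have F: "F \<noteq> 0" "E \<noteq> 0" by (auto simp: F_def E_def)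
  have E: "E - 1 \<noteq> 0" "complex_of_real r \<noteq> 0"
  proof -
    have "exp r \<noteq> 1" using assms by simp
    then have "complex_of_real (exp r) \<noteq> 1" by (metis of_real_eq_1_iff)
    then show "E - 1 \<noteq> 0" unfolding E_def exp_of_real by simp
  qed (use assms in auto)
  have k: "complex_of_real (2 * binet_kernel r) = (E + 1) / (E - 1) - 2 / of_real r"
  proof -
    have "complex_of_real (2 * binet_kernel r) = 1 - 2 / of_real r + 2 / (E - 1)"
      by (simp add: binet_kernel_def E_def exp_of_real)
    also have "\<dots> = (E + 1) / (E - 1) - 2 / of_real r" using E by (simp add: field_simps)
    finally show ?thesis .
  qed
  have e: "exp (- (A + of_real r)) = inverse F * inverse E" "exp (A + of_real r) = F * E"
    "exp (- A) = inverse F" "exp A = F"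
    by (simp_all only: minus_add_distrib exp_add exp_minus F_def E_def)
  have sc: "sinh A = (F - inverse F) / 2" "cosh A = (F + inverse F) / 2"
    "sinh (A + of_real r) = (F * E - inverse F * inverse E) / 2"
    "cosh (A + of_real r) = (F * E + inverse F * inverse E) / 2"
    unfolding sinh_def cosh_def e by (simp_all add: scaleR_conv_of_real)
  have main: "(sinh (A + of_real r) - sinh A) * ((E + 1) / (E - 1)) = cosh (A + of_real r) + cosh A"
    unfolding sc using E F by (simp add: divide_simps) (simp add: algebra_simps)
  have "S * (X - Y) = S * X - Y * S" for S X Y :: complex by (simp add: algebra_simps)
  then show ?thesis unfolding k by (simp only: main)
qed

text \<open>The shift of \<open>\<xi>\<close> by \<open>\<tau>\<close>. The numerator that remains
  is a combination of those of \<open>bose2\<close> and \<open>bose3\<close>.\<close>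

lemma P_int_shift_1:
  assumes a: "Re a = 1" and z: "\<bar>Re z\<bar> < 1" "\<bar>Re (z + 1)\<bar> < 1"
  shows "P_int a (z + 1) - P_int a z = lg_sym ((z + 1) / a) + lg_sym (z / a)
     - 2 * a * (lg_sym_primitive ((z + 1) / a) - lg_sym_primitive (z / a))"
proof -
  note i = P_int_integrable[OF a z(1)] P_int_integrable[OF a z(2)]
  have "P_int a (z + 1) - P_int a z = half_line_integral (\<lambda>r. sinh ((z + 1) * of_real r) * of_real (2 * binet_kernel r) * bose_kernel a r
      - sinh (z * of_real r) * of_real (2 * binet_kernel r) * bose_kernel a r)"
    unfolding P_int_def by (rule set_integral_diff(2)[symmetric, OF i(2,1)])
  also have "\<dots> = half_line_integral (\<lambda>r. (bose2 a (z + 1) r + bose2 a z r) - 2 * (bose3 a (z + 1) r - bose3 a z r))"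
  proof (rule set_lebesgue_integral_cong)
    show "\<forall>r. r \<in> {0<..} \<longrightarrow> sinh ((z + 1) * of_real r) * of_real (2 * binet_kernel r) * bose_kernel a r
      - sinh (z * of_real r) * of_real (2 * binet_kernel r) * bose_kernel a r =
      (bose2 a (z + 1) r + bose2 a z r) - 2 * (bose3 a (z + 1) r - bose3 a z r)"
    proof (intro allI impI)
      fix r :: real assume "r \<in> {0<..}"
      then have r: "r > 0" by simp
      define k where "k = bose_kernel a r"
      define B where "B = complex_of_real (2 * binet_kernel r)"
      have eq: "(z + 1) * of_real r = z * of_real r + of_real r" by (simp add: algebra_simps)
      define s1 s0 c1 c0 where "s1 = sinh (z * of_real r + of_real r)" and "s0 = sinh (z * of_real r)"
        and "c1 = cosh (z * of_real r + of_real r)" and "c0 = cosh (z * of_real r)"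
      have "(s1 - s0) * B = c1 + c0 - 2 / of_real r * (s1 - s0)"
        using sinh_shift_binet_kernel[OF r, of "z * of_real r"] by (simp add: s1_def s0_def c1_def c0_def B_def)
      then have "s1 * B * k - s0 * B * k = (c1 + c0 - 2 / of_real r * (s1 - s0)) * k"
        by (metis left_diff_distrib)
      \<comment> \<open>The subtracted terms balance: 1 + 1 for the cosines against 2 ((z + 1) - z)
        for the sines.\<close>
      also have "\<dots> = ((c1 - 1) * k + (c0 - 1) * k) - 2 * ((s1 / of_real r - (z + 1)) * k - (s0 / of_real r - z) * k)"
        by (simp add: algebra_simps diff_divide_distrib)
      finally show "sinh ((z + 1) * of_real r) * of_real (2 * binet_kernel r) * bose_kernel a r
      - sinh (z * of_real r) * of_real (2 * binet_kernel r) * bose_kernel a r =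
      (bose2 a (z + 1) r + bose2 a z r) - 2 * (bose3 a (z + 1) r - bose3 a z r)"
        unfolding bose2_def bose3_def eq k_def[symmetric] B_def[symmetric] s1_def[symmetric] s0_def[symmetric]
          c1_def[symmetric] c0_def[symmetric] .
    qed
  qed auto
  also have "\<dots> = (half_line_integral (bose2 a (z + 1)) + half_line_integral (bose2 a z)) -
      2 * (half_line_integral (bose3 a (z + 1)) - half_line_integral (bose3 a z))"
    using bose_integrable(3,4)[OF a z(1)] bose_integrable(3,4)[OF a z(2)]
    by (subst set_integral_diff) (auto simp: set_integral_add set_integral_diff)
  finally show ?thesis
    unfolding half_line_integral_bose[OF a z(1)] half_line_integral_bose[OF a z(2)] by (simp add: algebra_simps)
qed

text \<open>The shift of \<open>\<xi>\<close> by 1. For \<open>z\<close> in the left half of the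
  strip both \<open>- z\<close> and \<open>z + a\<close> have positive real part, so both Binet
  integrals converge.\<close>

lemma P_int_shift_a:
  assumes a: "Re a = 1" and z: "-1 < Re z" "Re z < 0"
  shows "P_int a (z + a) - P_int a z = binet_integral (- z) + binet_integral (z + a)"
proof -
  have i: "half_line_integrable (\<lambda>r. sinh (z * of_real r) * of_real (2 * binet_kernel r) * bose_kernel a r)"
    "half_line_integrable (\<lambda>r. sinh ((z + a) * of_real r) * of_real (2 * binet_kernel r) * bose_kernel a r)"
    using z a by (intro P_int_integrable[OF a]; simp)+
  have j: "half_line_integrable (\<lambda>r. of_real (binet_kernel r / r) * exp (- (- z) * of_real r))"
    "half_line_integrable (\<lambda>r. of_real (binet_kernel r / r) * exp (- (z + a) * of_real r))"
    using z a by (intro binet_integral_integrable; simp)+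
  have "P_int a (z + a) - P_int a z = half_line_integral (\<lambda>r. sinh ((z + a) * of_real r) * of_real (2 * binet_kernel r) * bose_kernel a r
      - sinh (z * of_real r) * of_real (2 * binet_kernel r) * bose_kernel a r)"
    unfolding P_int_def by (rule set_integral_diff(2)[symmetric, OF i(2,1)])
  also have "\<dots> = half_line_integral (\<lambda>r. of_real (binet_kernel r / r) * exp (- (- z) * of_real r) +
       of_real (binet_kernel r / r) * exp (- (z + a) * of_real r))"
  proof (rule set_lebesgue_integral_cong)
    show "\<forall>r. r \<in> {0<..} \<longrightarrow> sinh ((z + a) * of_real r) * of_real (2 * binet_kernel r) * bose_kernel a r
      - sinh (z * of_real r) * of_real (2 * binet_kernel r) * bose_kernel a r =
      of_real (binet_kernel r / r) * exp (- (- z) * of_real r) +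
       of_real (binet_kernel r / r) * exp (- (z + a) * of_real r)"
    proof (intro allI impI)
      fix r :: real assume "r \<in> {0<..}"
      then have r: "r > 0" by simp
      define E F where "E = exp (a * of_real r)" and "F = exp (z * of_real r)"
      have E: "E - 1 \<noteq> 0" "E \<noteq> 0" "F \<noteq> 0"
        using exp_mult_minus_one_nonzero[OF a r] by (auto simp: E_def F_def)
      have sc: "sinh (z * of_real r) = (F - inverse F) / 2"
        "sinh ((z + a) * of_real r) = (F * E - inverse F * inverse E) / 2"
        "exp (- (- z) * of_real r) = F" "exp (- (z + a) * of_real r) = inverse F * inverse E"
        by (simp_all add: sinh_def scaleR_conv_of_real F_def E_def exp_add[symmetric] exp_minus[symmetric] algebra_simps)
      \<comment> \<open>The factor \<open>E - 1\<close> cancels the denominator of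
        \<open>bose_kernel\<close>.\<close>
      have D: "((F * E - inverse F * inverse E) / 2 - (F - inverse F) / 2) = (E - 1) / 2 * (F + inverse F * inverse E)"
        using E by (simp add: field_simps)
      have "(sinh ((z + a) * of_real r) - sinh (z * of_real r)) * (2 * B) * (1 / (of_real r * (E - 1))) =
          B / of_real r * (F + inverse F * inverse E)" for B
        unfolding sc D using E r by simp
      from this[of "of_real (binet_kernel r)"]
      show "sinh ((z + a) * of_real r) * of_real (2 * binet_kernel r) * bose_kernel a r
        - sinh (z * of_real r) * of_real (2 * binet_kernel r) * bose_kernel a r =
        of_real (binet_kernel r / r) * exp (- (- z) * of_real r) +
         of_real (binet_kernel r / r) * exp (- (z + a) * of_real r)"
        unfolding sc(3,4) bose_kernel_def E_def[symmetric] by (simp only: ring_distribs of_real_mult of_real_divide of_real_numeral)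
    qed
  qed auto
  also have "\<dots> = binet_integral (- z) + binet_integral (z + a)"
    unfolding binet_integral_def by (rule set_integral_add(2)[OF j])
  finally show ?thesis .
qed

section \<open>Asymptotics of the integral\<close>

text \<open>Averaging with the copy shifted by half a period replaces \<open>h\<close> by its
  difference to a small translate, which tends to 0 almost everywhere.\<close>

lemma riemann_lebesgue_half_line:
  fixes h :: "real \<Rightarrow> complex" and X :: "nat \<Rightarrow> real" and s :: real
  assumes cont: "continuous_on {0<..} h" and \<delta>: "\<delta> > 0"
    and bound: "\<And>r. r > 0 \<Longrightarrow> norm (h r) \<le> C * exp (- \<delta> * r)"
    and X: "filterlim X at_top sequentially" and s: "s \<in> {1, -1}"
  shows "(\<lambda>n. half_line_integral (\<lambda>r. h r * exp (\<i> * of_real (s * X n * r)))) \<longlonglongrightarrow> 0"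
proof -
  define F where "F = (\<lambda>r. indicator {0<..} r *\<^sub>R h r)"
  define G where "G = (\<lambda>r::real. indicator {0<..} r *\<^sub>R (C * exp (- \<delta> * r)))"
  have Fm [measurable]: "F \<in> borel_measurable borel"
    unfolding F_def using half_line_measurable[OF cont] by simp
  have "0 \<le> C * exp (- \<delta> * 1)" using order_trans[OF norm_ge_zero bound[of 1]] by simp
  then have C: "C \<ge> 0" by (simp add: zero_le_mult_iff)
  have G: "integrable lborel G"
    using set_integrable_exp_decay[OF \<delta>, of C] unfolding G_def set_integrable_def .
  have G1: "integrable lborel (\<lambda>r. G (1 + r))"
    using lborel_integrable_real_affine[OF G, of 1 1] by simp
  have FG: "norm (F r) \<le> G r" for r using bound[of r] by (auto simp: F_def G_def indicator_def)
  \<comment> \<open>One majorant for all shifts up to 1: extending the support to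
    \<open>r > - 1\<close> costs at most the factor \<open>exp \<delta>\<close>.\<close>
  have FG1: "norm (F (c + r)) \<le> exp \<delta> * G (1 + r)" if "0 < c" "c \<le> 1" for c r
  proof (cases "c + r > 0")
    case True
    have "norm (F (c + r)) \<le> G (c + r)" by (rule FG)
    also have "\<dots> = C * exp (- \<delta> * (c + r))" using True by (simp add: G_def)
    also have "\<dots> \<le> C * exp (\<delta> - \<delta> * (1 + r))"
      using C \<delta> that by (intro mult_left_mono) (auto simp: algebra_simps)
    also have "exp (\<delta> - \<delta> * (1 + r)) = exp \<delta> * exp (- \<delta> * (1 + r))" by (simp only: mult_exp_exp) simp
    also have "C * (exp \<delta> * exp (- \<delta> * (1 + r))) = exp \<delta> * G (1 + r)" using True that by (simp add: G_def)
    finally show ?thesis .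
  next
    case False
    have "G (1 + r) \<ge> 0" using C by (auto simp: G_def indicator_def)
    then show ?thesis using False by (simp add: F_def)
  qed
  have intF: "integrable lborel F"
    by (rule Bochner_Integration.integrable_bound[OF G]) (use FG in \<open>auto intro!: always_eventually order_trans[OF _ abs_ge_self]\<close>)
  \<comment> \<open>Shifting by \<open>pi / y\<close> changes the sign of the oscillating factor.\<close>
  define J where "J = (\<lambda>y. \<integral>r. F r * exp (\<i> * of_real (s * y * r)) \<partial>lborel)"
  have J: "2 * J y = (\<integral>r. (F r - F (pi / y + r)) * exp (\<i> * of_real (s * y * r)) \<partial>lborel)" if y: "y > 0" for y
  proof -
    have int1: "integrable lborel (\<lambda>r. F r * exp (\<i> * of_real (s * y * r)))"
      by (rule Bochner_Integration.integrable_bound[OF intF]) (auto simp: norm_mult)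
    have int2: "integrable lborel (\<lambda>r. F (pi / y + r) * exp (\<i> * of_real (s * y * r)))"
      by (rule Bochner_Integration.integrable_bound[OF lborel_integrable_real_affine[OF intF, of 1 "pi / y"]])
         (auto simp: norm_mult)
    have "J y = (\<integral>r. F (pi / y + r) * exp (\<i> * of_real (s * y * (pi / y + r))) \<partial>lborel)"
      unfolding J_def
      using lborel_integral_real_affine[of 1 "\<lambda>r. F r * exp (\<i> * of_real (s * y * r))" "pi / y"] by simp
    also have "(\<lambda>r. F (pi / y + r) * exp (\<i> * of_real (s * y * (pi / y + r)))) =
        (\<lambda>r. - (F (pi / y + r) * exp (\<i> * of_real (s * y * r))))"
    proof
      fix r
      have "s * y * (pi / y + r) = s * pi + s * y * r" using y by (simp add: algebra_simps)
      then have "exp (\<i> * of_real (s * y * (pi / y + r))) = exp (\<i> * of_real (s * pi)) * exp (\<i> * of_real (s * y * r))"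
        by (simp add: ring_distribs exp_add)
      moreover have "exp (\<i> * of_real (s * pi)) = - 1"
        using s by (auto simp: exp_minus mult.commute[of \<i>])
      ultimately show "F (pi / y + r) * exp (\<i> * of_real (s * y * (pi / y + r))) = - (F (pi / y + r) * exp (\<i> * of_real (s * y * r)))"
        by simp
    qed
    also have "(\<integral>r. - (F (pi / y + r) * exp (\<i> * of_real (s * y * r))) \<partial>lborel) = - (\<integral>r. F (pi / y + r) * exp (\<i> * of_real (s * y * r)) \<partial>lborel)"
      by simp
    finally have "2 * J y = (\<integral>r. F r * exp (\<i> * of_real (s * y * r)) \<partial>lborel) - (\<integral>r. F (pi / y + r) * exp (\<i> * of_real (s * y * r)) \<partial>lborel)"
      unfolding J_def by simp
    also have "\<dots> = (\<integral>r. F r * exp (\<i> * of_real (s * y * r)) - F (pi / y + r) * exp (\<i> * of_real (s * y * r)) \<partial>lborel)"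
      by (rule Bochner_Integration.integral_diff[symmetric, OF int1 int2])
    finally show ?thesis by (simp add: left_diff_distrib)
  qed
  have "\<forall>\<^sub>F n in sequentially. X n \<ge> pi" using X by (simp add: filterlim_at_top)
  then obtain N where N: "\<And>n. n \<ge> N \<Longrightarrow> X n \<ge> pi" by (auto simp: eventually_sequentially)
  \<comment> \<open>From \<open>N\<close> on the half period \<open>pi / Y n\<close> is at most 1,
    as the common majorant requires.\<close>
  define Y where "Y = (\<lambda>n. X (n + N))"
  have Y: "Y n \<ge> pi" for n using N by (simp add: Y_def)
  have Ylim: "filterlim Y at_top sequentially"
    unfolding Y_def using X by (rule filterlim_compose) (rule filterlim_add_const_nat_at_top)
  have c0: "(\<lambda>n. pi / Y n) \<longlonglongrightarrow> 0"
    by (rule real_tendsto_divide_at_top[OF tendsto_const Ylim])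
  have c: "0 < pi / Y n" "pi / Y n \<le> 1" for n
  proof -
    have "Y n > 0" using Y[of n] pi_gt_zero by linarith
    then show "0 < pi / Y n" "pi / Y n \<le> 1" using Y[of n] by (auto simp: divide_le_eq)
  qed
  have L: "(\<lambda>n. \<integral>r. (F r - F (pi / Y n + r)) * exp (\<i> * of_real (s * Y n * r)) \<partial>lborel) \<longlonglongrightarrow> (\<integral>r. 0 \<partial>(lborel :: real measure))"
  proof (rule integral_dominated_convergence)
    show "integrable lborel (\<lambda>r. G r + exp \<delta> * G (1 + r))"
      using G G1 by (intro Bochner_Integration.integrable_add integrable_mult_right)
    show "AE r in lborel. norm ((F r - F (pi / Y n + r)) * exp (\<i> * of_real (s * Y n * r))) \<le> G r + exp \<delta> * G (1 + r)" for n
    proof (rule always_eventually, rule allI)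
      fix r
      have "norm ((F r - F (pi / Y n + r)) * exp (\<i> * of_real (s * Y n * r))) = norm (F r - F (pi / Y n + r))"
        by (simp add: norm_mult)
      also have "\<dots> \<le> norm (F r) + norm (F (pi / Y n + r))" by (rule norm_triangle_ineq4)
      also have "\<dots> \<le> G r + exp \<delta> * G (1 + r)" using FG[of r] FG1[OF c, of n r] by (rule add_mono)
      finally show "norm ((F r - F (pi / Y n + r)) * exp (\<i> * of_real (s * Y n * r))) \<le> G r + exp \<delta> * G (1 + r)" .
    qed
    \<comment> \<open>\<open>F\<close> may jump at 0, so this one point is left out as a null
      set.\<close>
    have main: "(\<lambda>n. (F r - F (pi / Y n + r)) * exp (\<i> * of_real (s * Y n * r))) \<longlonglongrightarrow> 0" if "r \<noteq> 0" for r
    proof -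
      have F: "isCont F r"
      proof (cases "r > 0")
        case True
        have "isCont h r" using cont True by (simp add: continuous_on_eq_continuous_at)
        moreover have "\<forall>\<^sub>F x in nhds r. F x = h x"
          using eventually_nhds_in_open[of "{0<..}" r] True by (auto elim!: eventually_mono simp: F_def)
        ultimately show ?thesis using iffD2[OF isCont_cong] by blast
      next
        case False
        then have "r < 0" using that by simp
        then have "\<forall>\<^sub>F x in nhds r. F x = 0"
          using eventually_nhds_in_open[of "{..<0}" r] by (auto elim!: eventually_mono simp: F_def)
        then show ?thesis by (rule iffD2[OF isCont_cong]) simp
      qed
      have "(\<lambda>n. pi / Y n + r) \<longlonglongrightarrow> 0 + r" by (intro tendsto_add c0 tendsto_const)
      then have "(\<lambda>n. pi / Y n + r) \<longlonglongrightarrow> r" by simp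
      then have "(\<lambda>n. F (pi / Y n + r)) \<longlonglongrightarrow> F r"
        by (rule isCont_tendsto_compose[OF F])
      then have "(\<lambda>n. norm (F r - F (pi / Y n + r))) \<longlonglongrightarrow> norm (F r - F r)"
        by (intro tendsto_norm tendsto_diff tendsto_const)
      then have "(\<lambda>n. norm ((F r - F (pi / Y n + r)) * exp (\<i> * of_real (s * Y n * r)))) \<longlonglongrightarrow> 0"
        by (simp add: norm_mult)
      then show ?thesis by (rule tendsto_norm_zero_cancel)
    qed
    show "AE r in lborel. (\<lambda>n. (F r - F (pi / Y n + r)) * exp (\<i> * of_real (s * Y n * r))) \<longlonglongrightarrow> 0"
      by (rule eventually_mono[OF AE_lborel_singleton[of "0::real"]]) (rule main)
  qed measurable
  have "Y n > 0" for n using Y[of n] pi_gt_zero by linarith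
  then have "(\<lambda>n. 2 * J (Y n)) \<longlonglongrightarrow> 0" using L by (simp only: J Bochner_Integration.integral_zero)
  then have "(\<lambda>n. 1 / 2 * (2 * J (Y n))) \<longlonglongrightarrow> 1 / 2 * 0" by (intro tendsto_mult tendsto_const)
  then have "(\<lambda>n. J (X (n + N))) \<longlonglongrightarrow> 0" by (simp add: Y_def)
  then have "(\<lambda>n. J (X n)) \<longlonglongrightarrow> 0" by (rule LIMSEQ_offset)
  moreover have "half_line_integral (\<lambda>r. h r * exp (\<i> * of_real (s * X n * r))) = J (X n)" for n
    by (simp add: J_def F_def set_lebesgue_integral_def)
  ultimately show ?thesis by simp
qed

text \<open>A Frullani integral: its derivative in \<open>z\<close> is the elementary integral of
  cosh(zr) exp(-ar).\<close>

lemma half_line_integral_sinh_exp: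
  assumes a: "Re a = 1" and z: "\<bar>Re z\<bar> < 1"
  defines "f \<equiv> \<lambda>z r. sinh (z * of_real r) / of_real r * exp (- a * of_real r)"
  shows "half_line_integrable (f z)" "half_line_integral (f z) = (Ln (a + z) - Ln (a - z)) / 2"
proof -
  define g where "g = (\<lambda>z r. cosh (z * of_real r) * exp (- a * of_real r))"
  have cont: "continuous_on {0<..} (f z)" "continuous_on {0<..} (g z)" for z
    unfolding f_def g_def by (auto intro!: continuous_intros)
  have bd: "norm (g z r) \<le> exp (- (1 - \<rho>) * r)" "norm (f z r) \<le> norm z * exp (- (1 - \<rho>) * r)"
    if "\<bar>Re z\<bar> \<le> \<rho>" "r > 0" for z \<rho> r
  proof -
    have e: "exp \<bar>Re (z * of_real r)\<bar> * exp (- r) \<le> exp (- (1 - \<rho>) * r)"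
      unfolding abs_Re_mult_of_real[OF that(2)] mult_exp_exp using that by (auto simp: algebra_simps)
    have "norm (g z r) = norm (cosh (z * of_real r)) * exp (- r)" using a by (simp add: g_def norm_mult)
    also have "\<dots> \<le> exp \<bar>Re (z * of_real r)\<bar> * exp (- r)" by (intro mult_right_mono norm_cosh_le) auto
    finally show "norm (g z r) \<le> exp (- (1 - \<rho>) * r)" using e by linarith
    have "norm (f z r) = norm (sinh (z * of_real r)) / r * exp (- r)" using a that by (simp add: f_def norm_mult norm_divide)
    also have "\<dots> \<le> (norm (z * of_real r) * exp \<bar>Re (z * of_real r)\<bar>) / r * exp (- r)"
      using that by (intro mult_right_mono divide_right_mono norm_sinh_le) auto
    also have "\<dots> = norm z * (exp \<bar>Re (z * of_real r)\<bar> * exp (- r))" using that by (simp add: norm_mult)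
    also have "\<dots> \<le> norm z * exp (- (1 - \<rho>) * r)" by (intro mult_left_mono e) auto
    finally show "norm (f z r) \<le> norm z * exp (- (1 - \<rho>) * r)" .
  qed
  have int: "half_line_integrable (f z)" if "\<bar>Re z\<bar> < 1" for z
    using that by (intro half_line_integrableI[OF cont(1) _ bd(2)[OF order_refl]]) auto
  then show "half_line_integrable (f z)" using z .
  have intg: "half_line_integral (g z) = 1 / 2 * (1 / (a - z) + 1 / (a + z))" if "\<bar>Re z\<bar> < 1" for z
  proof -
    have *: "Re (a - z) > 0" "Re (a + z) > 0" using a that by auto
    have "g z = (\<lambda>r. 1 / 2 * (exp (- (a - z) * of_real r) + exp (- (a + z) * of_real r)))"
    proof
      fix r
      have "exp (- (a - z) * of_real r) = exp (z * of_real r) * exp (- a * of_real r)"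
        "exp (- (a + z) * of_real r) = exp (- (z * of_real r)) * exp (- a * of_real r)"
        unfolding mult_exp_exp by (simp_all add: algebra_simps)
      then show "g z r = 1 / 2 * (exp (- (a - z) * of_real r) + exp (- (a + z) * of_real r))"
        by (simp only: g_def cosh_def) (simp add: scaleR_conv_of_real ring_distribs)
    qed
    then show ?thesis
      using half_line_integral_exp[OF *(1)] half_line_integral_exp[OF *(2)] by (simp only: set_integral_mult_right set_integral_add(2))
  qed
  have d1: "((\<lambda>z. half_line_integral (f z)) has_field_derivative half_line_integral (g z)) (at z)" if z: "\<bar>Re z\<bar> < 1" for z
  proof -
    define \<eta> where "\<eta> = (1 - \<bar>Re z\<bar>) / 2"
    define \<rho> where "\<rho> = (1 + \<bar>Re z\<bar>) / 2"
    have \<eta>: "\<eta> > 0" "1 - \<rho> > 0" using z by (auto simp: \<eta>_def \<rho>_def)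
    have w: "\<bar>Re w\<bar> \<le> \<rho>" "\<bar>Re w\<bar> < 1" if "w \<in> ball z \<eta>" for w
    proof -
      have "norm (z - w) < \<eta>" using that by (simp add: dist_norm)
      then have "\<bar>Re z - Re w\<bar> < \<eta>" using abs_Re_le_cmod[of "z - w"] by simp
      then show "\<bar>Re w\<bar> \<le> \<rho>" by (simp add: \<eta>_def \<rho>_def field_simps abs_if split: if_splits)
      then show "\<bar>Re w\<bar> < 1" using \<eta> by linarith
    qed
    show ?thesis
    proof (rule half_line_integral_has_field_derivative[OF \<eta>(1,2), where C = 1])
      show "((\<lambda>z. f z r) has_field_derivative g w r) (at w)" if "r > 0" for w r
        unfolding f_def g_def using that by (auto intro!: derivative_eq_intros)
    qed (use cont int w bd in auto)
  qed
  show "half_line_integral (f z) = (Ln (a + z) - Ln (a - z)) / 2"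
  proof (rule eq_on_strip[OF d1 _ _ z])
    show "((\<lambda>z. (Ln (a + z) - Ln (a - z)) / 2) has_field_derivative half_line_integral (g z)) (at z)" if "\<bar>Re z\<bar> < 1" for z
    proof -
      have "Re (a - z) > 0" "Re (a + z) > 0" using a that by auto
      then have "a - z \<notin> \<real>\<^sub>\<le>\<^sub>0" "a + z \<notin> \<real>\<^sub>\<le>\<^sub>0" by (auto simp: complex_nonpos_Reals_iff)
      then show ?thesis unfolding intg[OF that]
        by (auto intro!: derivative_eq_intros simp: inverse_eq_divide add.commute)
    qed
    have "f 0 = (\<lambda>_. 0)" by (simp add: f_def fun_eq_iff)
    then show "half_line_integral (f 0) = (Ln (a + 0) - Ln (a - 0)) / 2"
      by (simp add: set_lebesgue_integral_def)
  qed
qed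

text \<open>Far up, \<open>a + z\<close> and \<open>a - z\<close> have arguments in (0, pi/2) and (-
  pi/2, 0). Subtracting pi i from the difference of the logarithms therefore gives the principal
  logarithm of - (a + z)/(a - z), a quotient that tends to 1.\<close>

lemma Ln_quotient_tendsto:
  fixes Y :: "nat \<Rightarrow> real"
  assumes a: "Re a = 1" and Y: "filterlim Y at_top sequentially"
  shows "(\<lambda>n. Ln (a + Complex (1/2) (Y n)) - Ln (a - Complex (1/2) (Y n))) \<longlonglongrightarrow> \<i> * of_real pi"
proof -
  define z where "z = (\<lambda>n. Complex (1/2) (Y n))"
  have "filterlim (\<lambda>n. - \<bar>Im a\<bar> + Y n) at_top sequentially"
    by (rule filterlim_tendsto_add_at_top[OF tendsto_const Y])
  then have Y': "filterlim (\<lambda>n. Y n - \<bar>Im a\<bar>) at_top sequentially" by simp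
  have "((\<lambda>n. - 2 * a / (a - z n)) \<longlonglongrightarrow> 0)"
  proof (rule tendsto_divide_0[OF tendsto_const])
    have "\<forall>n. Y n - \<bar>Im a\<bar> \<le> norm (a - z n)"
    proof
      fix n
      have "Y n - \<bar>Im a\<bar> \<le> \<bar>Im (a - z n)\<bar>" by (simp add: z_def)
      then show "Y n - \<bar>Im a\<bar> \<le> norm (a - z n)" using abs_Im_le_cmod[of "a - z n"] by linarith
    qed
    then have "filterlim (\<lambda>n. norm (a - z n)) at_top sequentially"
      by (intro filterlim_at_top_mono[OF Y'] always_eventually)
    then show "filterlim (\<lambda>n. a - z n) at_infinity sequentially"
      by (simp add: filterlim_norm_at_top_imp_at_infinity)
  qed
  then have "(\<lambda>n. 1 + - 2 * a / (a - z n)) \<longlonglongrightarrow> 1 + 0" by (intro tendsto_add tendsto_const)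
  then have "(\<lambda>n. Ln (1 + - 2 * a / (a - z n))) \<longlonglongrightarrow> Ln (1 + 0)" by (intro tendsto_Ln) auto
  then have "(\<lambda>n. Ln (1 + - 2 * a / (a - z n)) + \<i> * of_real pi) \<longlonglongrightarrow> 0 + \<i> * of_real pi"
    by (intro tendsto_add tendsto_const) simp
  moreover have "\<forall>\<^sub>F n in sequentially. Ln (1 + - 2 * a / (a - z n)) + \<i> * of_real pi = Ln (a + z n) - Ln (a - z n)"
  proof -
    have "\<forall>\<^sub>F n in sequentially. Y n - \<bar>Im a\<bar> > 0" using Y' unfolding filterlim_at_top_dense by blast
    then show ?thesis
    proof eventually_elim
      case (elim n)
      have r: "Re (a + z n) > 0" "Re (a - z n) > 0" using a by (auto simp: z_def)
      have i: "Im (a + z n) > 0" "Im (a - z n) < 0" using elim by (auto simp: z_def abs_if split: if_splits)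
      have nz: "a + z n \<noteq> 0" "a - z n \<noteq> 0" using r by (metis less_irrefl zero_complex.sel(1))+
      have ip: "0 < Im (Ln (a + z n))" "Im (Ln (a + z n)) < pi / 2" 
        using Im_Ln_pos_lt_imp[OF i(1)] Re_Ln_pos_lt_imp[OF r(1)] by auto
      have im: "Im (Ln (a - z n)) < 0" "- (pi / 2) < Im (Ln (a - z n))"
        using Re_Ln_pos_lt_imp[OF r(2)] Im_Ln_pos_le[OF nz(2)] i(2) mpi_less_Im_Ln[OF nz(2)] Im_Ln_le_pi[OF nz(2)]
        by auto
      have "Ln (1 + - 2 * a / (a - z n)) = Ln (a + z n) - Ln (a - z n) - \<i> * of_real pi"
      proof (rule Ln_unique)
        have "exp (Ln (a + z n) - Ln (a - z n) - \<i> * of_real pi) = - ((a + z n) / (a - z n))"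
          using nz by (simp add: exp_diff mult.commute[of \<i>])
        also have "\<dots> = 1 + - 2 * a / (a - z n)" using nz by (simp add: field_simps)
        finally show "exp (Ln (a + z n) - Ln (a - z n) - \<i> * of_real pi) = 1 + - 2 * a / (a - z n)" .
      qed (use ip im in auto)
      then show ?case by simp
    qed
  qed
  ultimately have "(\<lambda>n. Ln (a + z n) - Ln (a - z n)) \<longlonglongrightarrow> 0 + \<i> * of_real pi"
    by (rule Lim_transform_eventually)
  then show ?thesis by (simp add: z_def)
qed

text \<open>In the right half-plane \<open>exp (- v)\<close> has norm at most 1; two integrations
  from 0 give the second-order remainder.\<close>

lemma norm_exp_neg_remainder_le:
  fixes u :: complex
  assumes "Re u \<ge> 0"
  shows "norm (u - 1 + exp (- u)) \<le> norm u ^ 2"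
proof -
  have seg: "Re w \<ge> 0" "norm w \<le> norm v" if "w \<in> closed_segment 0 v" "Re v \<ge> 0" for v w :: complex
    using that closed_segment_0_bounds[of w v] by (auto simp: closed_segment_def)
  have 1: "norm (1 - exp (- v)) \<le> 1 * norm v" if "Re v \<ge> 0" for v :: complex
    by (rule norm_le_deriv_bound_segment[where f' = "\<lambda>v. exp (- v)"])
       (use seg(1)[OF _ that] in \<open>auto intro!: derivative_eq_intros\<close>)
  have "norm (u - 1 + exp (- u)) \<le> norm u * norm u"
  proof (rule norm_le_deriv_bound_segment[where f' = "\<lambda>v. 1 - exp (- v)"])
    fix v assume v: "v \<in> closed_segment 0 u"
    show "norm (1 - exp (- v)) \<le> norm u" using 1[OF seg(1)[OF v assms]] seg(2)[OF v assms] by simp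
  qed (auto intro!: derivative_eq_intros)
  then show ?thesis by (simp add: power2_eq_square)
qed

text \<open>The subtracted term is the singular part 1/(6ar) at 0, damped by exp(-ar) so that its
  integral against sinh(zr) converges in the strip and is the Frullani integral above.\<close>

lemma P_int_remainder_bound:
  assumes a: "Re a = 1"
  defines "h \<equiv> \<lambda>r. of_real (2 * binet_kernel r) * bose_kernel a r - exp (- a * of_real r) / (6 * a * of_real r)"
  obtains C where "\<And>r. r > 0 \<Longrightarrow> norm (h r) \<le> C * exp (- (3 / 4) * r)" "continuous_on {0<..} h"
proof -
  have a0: "a \<noteq> 0" using a by auto
  obtain C where C: "C > 0" "\<And>r. r > 0 \<Longrightarrow> \<bar>2 * binet_kernel r / r - 1 / 6\<bar> \<le> C * r"
    using binet_kernel_quadratic_bound by blast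
  have "norm (h r) \<le> (C + norm a / 6) * 4 * exp (- (3 / 4) * r)" if r: "r > 0" for r
  proof -
    define u where "u = a * of_real r"
    have u0: "u \<noteq> 0" using a0 r by (simp add: u_def)
    have eu: "exp u - 1 \<noteq> 0" unfolding u_def by (rule exp_mult_minus_one_nonzero[OF a r])
    have ge: "norm (exp u - 1) \<ge> exp r - 1" unfolding u_def by (rule norm_exp_minus_one_ge[OF a])
    have pos: "exp r - 1 > 0" using r by simp
    \<comment> \<open>The first summand is the error of the kernel against r/6, the second that of
      1/(exp u - 1) against exp(-u)/u.\<close>
    have heq: "h r = of_real (2 * binet_kernel r / r - 1 / 6) / (exp u - 1) + 1 / 6 * (1 / (exp u - 1) - exp (- u) / u)"
    proof -
      have "h r = of_real (2 * binet_kernel r / r) / (exp u - 1) - exp (- u) / (6 * u)"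
        unfolding h_def bose_kernel_def u_def using r by simp
      also have "\<dots> = of_real (2 * binet_kernel r / r - 1 / 6) / (exp u - 1) + 1 / 6 * (1 / (exp u - 1) - exp (- u) / u)"
        by (simp add: diff_divide_distrib ring_distribs)
      finally show ?thesis .
    qed
    have 1: "norm (of_real (2 * binet_kernel r / r - 1 / 6) / (exp u - 1)) \<le> C * (r / (exp r - 1))"
    proof -
      have "norm (of_real (2 * binet_kernel r / r - 1 / 6) / (exp u - 1)) = \<bar>2 * binet_kernel r / r - 1 / 6\<bar> / norm (exp u - 1)"
        by (simp only: norm_divide norm_of_real)
      also have "\<dots> \<le> (C * r) / (exp r - 1)" using C(2)[OF r] ge pos C(1) r by (intro frac_le) auto
      finally show ?thesis by simp
    qed
    have 2: "norm (1 / (exp u - 1) - exp (- u) / u) \<le> norm a * (r / (exp r - 1))"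
    proof -
      have "1 / (exp u - 1) - exp (- u) / u = (u - 1 + exp (- u)) / (u * (exp u - 1))"
        using u0 eu by (simp add: exp_minus field_simps)
      then have "norm (1 / (exp u - 1) - exp (- u) / u) = norm (u - 1 + exp (- u)) / (norm u * norm (exp u - 1))"
        by (simp add: norm_divide norm_mult)
      also have "\<dots> \<le> norm u ^ 2 / (norm u * (exp r - 1))"
        using norm_exp_neg_remainder_le[of u] a r ge pos u0 by (intro frac_le mult_left_mono) (auto simp: u_def)
      also have "\<dots> = norm a * (r / (exp r - 1))" using u0 r by (simp add: power2_eq_square u_def norm_mult)
      finally show ?thesis .
    qed
    have "norm (h r) \<le> C * (r / (exp r - 1)) + 1 / 6 * (norm a * (r / (exp r - 1)))"
    proof -
      have "norm (1 / 6 * (1 / (exp u - 1) - exp (- u) / u)) = 1 / 6 * norm (1 / (exp u - 1) - exp (- u) / u)"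
        unfolding norm_mult by simp
      also have "\<dots> \<le> 1 / 6 * (norm a * (r / (exp r - 1)))" by (rule mult_left_mono[OF 2]) simp
      finally show ?thesis unfolding heq using 1 by (intro norm_triangle_mono)
    qed
    also have "\<dots> = (C + norm a / 6) * (r / (exp r - 1))" by (simp add: algebra_simps)
    \<comment> \<open>With 1/4 given up, the rate 3/4 still beats the growth exp(r/2) of sinh(zr) on
      the line \<open>Re z = 1 / 2\<close>.\<close>
    also have "\<dots> \<le> (C + norm a / 6) * (exp (- (1 - 1 / 4) * r) / (1 / 4))"
      using C(1) r by (intro mult_left_mono div_exp_minus_one_le') auto
    finally show ?thesis by (simp add: algebra_simps)
  qed
  moreover have "continuous_on {0<..} h"
  proof -
    have [continuous_intros]: "continuous_on {0<..} (\<lambda>r. bose_kernel a r)"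
      using continuous_bose_kernel[OF a] by simp
    show ?thesis unfolding h_def using a0 by (auto intro!: continuous_intros)
  qed
  ultimately show ?thesis using that by blast
qed

text \<open>The singular part contributes 1/(6a) times pi i / 2. The remainder is split by the two
  exponentials of the hyperbolic sine, and each part vanishes by the Riemann-Lebesgue lemma.\<close>

lemma P_int_tendsto:
  fixes Y :: "nat \<Rightarrow> real"
  assumes a: "Re a = 1" and Y: "filterlim Y at_top sequentially"
  shows "(\<lambda>n. P_int a (Complex (1/2) (Y n))) \<longlonglongrightarrow> of_real pi * \<i> / (12 * a)"
proof -
  define h where "h = (\<lambda>r. of_real (2 * binet_kernel r) * bose_kernel a r - exp (- a * of_real r) / (6 * a * of_real r))"
  obtain C where C: "\<And>r. r > 0 \<Longrightarrow> norm (h r) \<le> C * exp (- (3 / 4) * r)" and cont: "continuous_on {0<..} h"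
    unfolding h_def using P_int_remainder_bound[OF a] by blast
  have a0: "a \<noteq> 0" using a by auto
  define z where "z = (\<lambda>n. Complex (1/2) (Y n))"
  have z: "\<bar>Re (z n)\<bar> < 1" for n by (simp add: z_def)
  define p where "p = (\<lambda>n. half_line_integral (\<lambda>r. (h r * of_real (exp (r / 2))) * exp (\<i> * of_real (1 * Y n * r))))"
  define m where "m = (\<lambda>n. half_line_integral (\<lambda>r. (h r * of_real (exp (- r / 2))) * exp (\<i> * of_real (- 1 * Y n * r))))"
  have bp: "norm (h r * of_real (exp (r / 2))) \<le> C * exp (- (1 / 4) * r)" "norm (h r * of_real (exp (- r / 2))) \<le> C * exp (- (1 / 4) * r)"
    if r: "r > 0" for r
  proof -
    have C0: "C \<ge> 0" using order_trans[OF norm_ge_zero C[OF r]] by (simp add: zero_le_mult_iff)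
    have "norm (h r * of_real (exp (r / 2))) \<le> C * exp (- (3 / 4) * r) * exp (r / 2)"
      using C[OF r] by (simp add: norm_mult)
    also have "\<dots> = C * exp (- (1 / 4) * r)" by (simp add: mult_exp_exp)
    finally show "norm (h r * of_real (exp (r / 2))) \<le> C * exp (- (1 / 4) * r)" .
    have "norm (h r * of_real (exp (- r / 2))) \<le> C * exp (- (3 / 4) * r) * 1"
      unfolding norm_mult using C[OF r] r C0 by (intro mult_mono) auto
    also have "\<dots> \<le> C * exp (- (1 / 4) * r)" using C0 r by (auto intro!: mult_left_mono)
    finally show "norm (h r * of_real (exp (- r / 2))) \<le> C * exp (- (1 / 4) * r)" .
  qed
  have c: "continuous_on {0<..} (\<lambda>r. h r * of_real (exp (r / 2)))" "continuous_on {0<..} (\<lambda>r. h r * of_real (exp (- r / 2)))"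
    using cont by (auto intro!: continuous_intros)
  have lim: "p \<longlonglongrightarrow> 0" "m \<longlonglongrightarrow> 0"
    unfolding p_def m_def
    by (rule riemann_lebesgue_half_line[OF c(1) _ bp(1) Y]; simp) (rule riemann_lebesgue_half_line[OF c(2) _ bp(2) Y]; simp)
  have eq: "P_int a (z n) = 1 / (6 * a) * ((Ln (a + z n) - Ln (a - z n)) / 2) + 1 / 2 * (p n - m n)" for n
  proof -
    define f where "f = (\<lambda>r. sinh (z n * of_real r) / of_real r * exp (- a * of_real r))"
    have f: "half_line_integrable f" "half_line_integral f = (Ln (a + z n) - Ln (a - z n)) / 2"
      unfolding f_def using half_line_integral_sinh_exp[OF a z] by auto
    have ip: "half_line_integrable (\<lambda>r. (h r * of_real (exp (r / 2))) * exp (\<i> * of_real (1 * Y n * r)))"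
      by (rule half_line_integrableI[of _ "1/4" C]) (use bp c in \<open>auto intro!: continuous_intros simp: norm_mult\<close>)
    have im: "half_line_integrable (\<lambda>r. (h r * of_real (exp (- r / 2))) * exp (\<i> * of_real (- 1 * Y n * r)))"
      by (rule half_line_integrableI[of _ "1/4" C]) (use bp c in \<open>auto intro!: continuous_intros simp: norm_mult\<close>)
    have "P_int a (z n) = half_line_integral (\<lambda>r. 1 / (6 * a) * f r + 1 / 2 * ((h r * of_real (exp (r / 2))) * exp (\<i> * of_real (1 * Y n * r)) -
        (h r * of_real (exp (- r / 2))) * exp (\<i> * of_real (- 1 * Y n * r))))"
      unfolding P_int_def
    proof (rule set_lebesgue_integral_cong)
      show "\<forall>r. r \<in> {0<..} \<longrightarrow> sinh (z n * of_real r) * of_real (2 * binet_kernel r) * bose_kernel a r =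
         1 / (6 * a) * f r + 1 / 2 * ((h r * of_real (exp (r / 2))) * exp (\<i> * of_real (1 * Y n * r)) -
        (h r * of_real (exp (- r / 2))) * exp (\<i> * of_real (- 1 * Y n * r)))"
      proof (intro allI impI)
        fix r :: real assume "r \<in> {0<..}"
        then have r: "r > 0" by simp
        have zr: "z n * of_real r = of_real (r / 2) + \<i> * of_real (1 * Y n * r)" "- (z n * of_real r) = of_real (- r / 2) + \<i> * of_real (- 1 * Y n * r)"
          by (auto simp: z_def complex_eq_iff)
        have s: "1 / 2 * (of_real (exp (r / 2)) * exp (\<i> * of_real (1 * Y n * r)) - of_real (exp (- r / 2)) * exp (\<i> * of_real (- 1 * Y n * r))) = sinh (z n * of_real r)"
          unfolding sinh_def exp_of_real[symmetric] mult_exp_exp zr[symmetric] by (simp add: scaleR_conv_of_real)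
        have "sinh (z n * of_real r) * of_real (2 * binet_kernel r) * bose_kernel a r = sinh (z n * of_real r) * (exp (- a * of_real r) / (6 * a * of_real r)) + h r * sinh (z n * of_real r)"
          unfolding h_def by (simp add: algebra_simps)
        also have "sinh (z n * of_real r) * (exp (- a * of_real r) / (6 * a * of_real r)) = 1 / (6 * a) * f r"
          by (simp add: f_def)
        finally show "sinh (z n * of_real r) * of_real (2 * binet_kernel r) * bose_kernel a r =
           1 / (6 * a) * f r + 1 / 2 * ((h r * of_real (exp (r / 2))) * exp (\<i> * of_real (1 * Y n * r)) -
          (h r * of_real (exp (- r / 2))) * exp (\<i> * of_real (- 1 * Y n * r)))"
          unfolding s[symmetric] by (simp add: algebra_simps)
      qed
    qed auto
    also have "\<dots> = half_line_integral (\<lambda>r. 1 / (6 * a) * f r) + half_line_integral (\<lambda>r. 1 / 2 * ((h r * of_real (exp (r / 2))) * exp (\<i> * of_real (1 * Y n * r)) -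
        (h r * of_real (exp (- r / 2))) * exp (\<i> * of_real (- 1 * Y n * r))))"
      by (rule set_integral_add(2)) (use f(1) ip im in \<open>auto intro!: set_integrable_mult_right\<close>)
    also have "\<dots> = 1 / (6 * a) * half_line_integral f + 1 / 2 * (p n - m n)"
      unfolding set_integral_mult_right set_integral_diff(2)[OF ip im] p_def m_def ..
    finally show ?thesis unfolding f(2) .
  qed
  have "(\<lambda>n. 1 / (6 * a) * ((Ln (a + z n) - Ln (a - z n)) / 2) + 1 / 2 * (p n - m n)) \<longlonglongrightarrow>
      1 / (6 * a) * ((\<i> * of_real pi) / 2) + 1 / 2 * (0 - 0)"
    unfolding z_def by (intro tendsto_intros Ln_quotient_tendsto[OF a Y] lim) auto
  then show ?thesis unfolding eq[symmetric] unfolding z_def by (simp add: mult_ac)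
qed

lemma binet_integral_vertical_tendsto:
  fixes Y :: "nat \<Rightarrow> real"
  assumes Y: "filterlim Y at_top sequentially"
  shows "(\<lambda>n. binet_integral (Complex (1/2) (Y n))) \<longlonglongrightarrow> 0"
proof -
  obtain C where C: "C > 0" "\<And>r. r > 0 \<Longrightarrow> \<bar>binet_kernel r / r\<bar> \<le> C"
    using binet_kernel_linear_bound by blast
  define h where "h = (\<lambda>r. complex_of_real (binet_kernel r / r * exp (- (1/2) * r)))"
  have "(\<lambda>n. half_line_integral (\<lambda>r. h r * exp (\<i> * of_real (- 1 * Y n * r)))) \<longlonglongrightarrow> 0"
  proof (rule riemann_lebesgue_half_line[of _ "1/2" C, OF _ _ _ Y])
    show "continuous_on {0<..} h" unfolding h_def by (auto intro!: continuous_intros)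
    show "norm (h r) \<le> C * exp (- (1 / 2) * r)" if "r > 0" for r
      unfolding h_def norm_of_real abs_mult abs_exp_cancel by (rule mult_right_mono[OF C(2)[OF that]]) simp
  qed auto
  moreover have "binet_integral (Complex (1/2) (Y n)) = half_line_integral (\<lambda>r. h r * exp (\<i> * of_real (- 1 * Y n * r)))" for n
    unfolding binet_integral_def
  proof (rule set_lebesgue_integral_cong)
    have "- Complex (1/2) (Y n) * of_real r = of_real (- (1/2) * r) + \<i> * of_real (- 1 * Y n * r)" for r
      by (auto simp: complex_eq_iff)
    then show "\<forall>r. r \<in> {0<..} \<longrightarrow> of_real (binet_kernel r / r) * exp (- Complex (1/2) (Y n) * of_real r) = h r * exp (\<i> * of_real (- 1 * Y n * r))"
      unfolding h_def by (simp only: exp_add exp_of_real) simp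
  qed auto
  ultimately show ?thesis by simp
qed

section \<open>The infinite product\<close>

lemma convergent_prod_qpoch: "norm q < 1 \<Longrightarrow> convergent_prod (\<lambda>n. 1 - x * q ^ n :: complex)"
proof (rule abs_convergent_prod_imp_convergent_prod, rule summable_imp_abs_convergent_prod)
  assume "norm q < 1"
  then have "summable (\<lambda>n. norm x * norm q ^ n)" by (intro summable_mult summable_geometric) simp
  then show "summable (\<lambda>n. norm (1 - x * q ^ n - 1))" by (simp add: norm_mult norm_power)
qed

lemma qpoch_inf_LIMSEQ:
  assumes "norm q < 1"
  shows "(\<lambda>n. \<Prod>i<n. 1 - x * q ^ i) \<longlonglongrightarrow> qpoch_inf x q"
proof -
  have "(\<lambda>n. \<Prod>i\<le>n. 1 - x * q ^ i) \<longlonglongrightarrow> qpoch_inf x q"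
    unfolding qpoch_inf_def using convergent_prod_LIMSEQ[OF convergent_prod_qpoch[OF assms]] .
  then have "(\<lambda>n. \<Prod>i<Suc n. 1 - x * q ^ i) \<longlonglongrightarrow> qpoch_inf x q"
    by (simp only: lessThan_Suc_atMost)
  then show ?thesis by (rule LIMSEQ_imp_Suc)
qed

lemma qpoch_inf_rec:
  assumes "norm q < 1"
  shows "qpoch_inf x q = (1 - x) * qpoch_inf (x * q) q"
proof (rule LIMSEQ_unique)
  show "(\<lambda>n. \<Prod>i<Suc n. 1 - x * q ^ i) \<longlonglongrightarrow> qpoch_inf x q"
    using qpoch_inf_LIMSEQ[OF assms] by (rule LIMSEQ_Suc)
  have "(\<lambda>n. (1 - x) * (\<Prod>i<n. 1 - (x * q) * q ^ i)) \<longlonglongrightarrow> (1 - x) * qpoch_inf (x * q) q"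
    by (intro tendsto_mult tendsto_const qpoch_inf_LIMSEQ assms)
  then show "(\<lambda>n. \<Prod>i<Suc n. 1 - x * q ^ i) \<longlonglongrightarrow> (1 - x) * qpoch_inf (x * q) q"
    by (simp only: prod.lessThan_Suc_shift power_0 mult_1_right power_Suc mult.assoc)
qed

lemma qpoch_inf_0 [simp]: "qpoch_inf 0 q = 1"
  by (simp add: qpoch_inf_def)

text \<open>Both arguments of the product may move holomorphically, since later
  \<open>\<tau>\<close> and \<open>\<xi>\<close> vary together. The reason is locally uniform
  convergence of the partial products.\<close>

lemma qpoch_inf_holomorphic:
  assumes "open A" "f holomorphic_on A" "g holomorphic_on A" "\<And>s. s \<in> A \<Longrightarrow> norm (g s) < 1"
  shows "(\<lambda>s. qpoch_inf (f s) (g s)) holomorphic_on A"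
proof (rule holomorphic_uniform_sequence[OF \<open>open A\<close>])
  show "(\<lambda>s. \<Prod>i<n. 1 - f s * g s ^ i) holomorphic_on A" for n
    by (intro holomorphic_intros assms)
  fix x assume "x \<in> A"
  then obtain d where d: "d > 0" "cball x d \<subseteq> A" using \<open>open A\<close> open_contains_cball by blast
  define K where "K = cball x d"
  have K: "compact K" "K \<subseteq> A" "K \<noteq> {}" using d by (auto simp: K_def)
  have cf: "continuous_on K f" "continuous_on K g"
    using K assms holomorphic_on_imp_continuous_on continuous_on_subset by blast+
  obtain B where B: "\<And>s. s \<in> K \<Longrightarrow> norm (f s) \<le> B"
    using compact_imp_bounded[OF compact_continuous_image[OF cf(1) K(1)]] unfolding bounded_iff by auto
  \<comment> \<open>By compactness the norm of the base attains a maximum on the disc, which is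
    below 1 and gives one geometric majorant.\<close>
  obtain t where t: "t \<in> K" "\<And>s. s \<in> K \<Longrightarrow> norm (g s) \<le> norm (g t)"
    using continuous_attains_sup[OF K(1,3), of "\<lambda>s. norm (g s)"] cf(2) by (auto intro: continuous_on_norm)
  have t1: "norm (g t) < 1" using t K assms by blast
  have "uniformly_convergent_on K (\<lambda>N s. \<Sum>n<N. norm ((1 - f s * g s ^ n) - 1))"
  proof (rule Weierstrass_m_test_ev[THEN uniformly_convergentI])
    show "summable (\<lambda>n. \<bar>B\<bar> * norm (g t) ^ n)" using t1 by (intro summable_mult summable_geometric) simp
    show "\<forall>\<^sub>F n in sequentially. \<forall>s\<in>K. norm (norm ((1 - f s * g s ^ n) - 1)) \<le> \<bar>B\<bar> * norm (g t) ^ n"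
    proof (intro always_eventually allI ballI)
      fix n s assume s: "s \<in> K"
      have "norm (norm ((1 - f s * g s ^ n) - 1)) = norm (f s) * norm (g s) ^ n"
        by (simp add: norm_mult norm_power)
      also have "\<dots> \<le> \<bar>B\<bar> * norm (g t) ^ n"
        using B[OF s] t(2)[OF s] by (intro mult_mono power_mono) auto
      finally show "norm (norm ((1 - f s * g s ^ n) - 1)) \<le> \<bar>B\<bar> * norm (g t) ^ n" .
    qed
  qed
  then have "uniformly_convergent_on K (\<lambda>N s. \<Prod>n<N. 1 - f s * g s ^ n)"
    using cf K by (intro uniformly_convergent_on_prod') (auto intro!: continuous_intros)
  then have "uniform_limit K (\<lambda>N s. \<Prod>n<N. 1 - f s * g s ^ n) (\<lambda>s. lim (\<lambda>N. \<Prod>n<N. 1 - f s * g s ^ n)) sequentially"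
    unfolding uniformly_convergent_uniform_limit_iff .
  then have "uniform_limit K (\<lambda>N s. \<Prod>n<N. 1 - f s * g s ^ n) (\<lambda>s. qpoch_inf (f s) (g s)) sequentially"
  proof (rule uniform_limit_cong'[THEN iffD1, rotated 2])
    show "lim (\<lambda>N. \<Prod>n<N. 1 - f s * g s ^ n) = qpoch_inf (f s) (g s)" if "s \<in> K" for s
      using qpoch_inf_LIMSEQ[of "g s" "f s"] assms(4)[of s] that K by (intro limI) auto
  qed auto
  then show "\<exists>d>0. cball x d \<subseteq> A \<and> uniform_limit (cball x d) (\<lambda>n s. \<Prod>i<n. 1 - f s * g s ^ i) (\<lambda>s. qpoch_inf (f s) (g s)) sequentially"
    using d by (auto simp: K_def)
qed

lemma qpoch_inf_tendsto_1:
  assumes "norm q < 1" "X \<longlonglongrightarrow> 0"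
  shows "(\<lambda>n. qpoch_inf (X n) q) \<longlonglongrightarrow> 1"
proof -
  have "(\<lambda>x. qpoch_inf x q) holomorphic_on UNIV"
    by (rule qpoch_inf_holomorphic) (use assms in \<open>auto intro!: holomorphic_intros\<close>)
  then have "isCont (\<lambda>x. qpoch_inf x q) 0"
    using holomorphic_on_imp_continuous_on continuous_on_eq_continuous_at by blast
  from isCont_tendsto_compose[OF this assms(2)] show ?thesis by simp
qed

section \<open>The formula on a vertical line\<close>

text \<open>Passing from z + 1 to z under the exponential is the functional equation of
  \<open>rGamma\<close>; no branches of \<open>ln_Gamma\<close> have to be compared.\<close>

lemma exp_G_fun:
  assumes "\<tau> \<noteq> 0" "\<xi> / \<tau> = z" "z \<notin> \<real>\<^sub>\<le>\<^sub>0"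
  shows "exp (G_fun \<tau> \<xi>) = exp (- stirling_remainder z)"
proof -
  have z1: "z + 1 \<notin> \<int>\<^sub>\<le>\<^sub>0" "z \<notin> \<int>\<^sub>\<le>\<^sub>0"
  proof -
    show "z \<notin> \<int>\<^sub>\<le>\<^sub>0" using assms(3) nonpos_Ints_subset_nonpos_Reals by blast
    show "z + 1 \<notin> \<int>\<^sub>\<le>\<^sub>0"
    proof
      assume "z + 1 \<in> \<int>\<^sub>\<le>\<^sub>0"
      then have "z + 1 \<in> \<real>\<^sub>\<le>\<^sub>0" using nonpos_Ints_subset_nonpos_Reals by blast
      then show False using assms(3) by (auto simp: complex_nonpos_Reals_iff)
    qed
  qed
  have z0: "z \<noteq> 0" using assms(3) by auto
  define E where "E = exp ((z - 1 / 2) * Ln z - z + of_real (ln (2 * pi) / 2))"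
  have ls: "ln (sqrt (2 * pi)) = ln (2 * pi) / 2" by (simp add: ln_sqrt)
  have "G_fun \<tau> \<xi> = (- ln_Gamma (z + 1) + Ln z) + ((z - 1 / 2) * Ln z - z + of_real (ln (2 * pi) / 2))"
    unfolding G_fun_def assms(2) ls by (simp add: algebra_simps)
  then have "exp (G_fun \<tau> \<xi>) = rGamma (z + 1) * z * E"
    using z1 z0 by (simp only: exp_add E_def) (simp add: rGamma_complex_altdef)
  also have "\<dots> = rGamma z * E" using rGamma_plus1[of z] by (simp add: mult.commute)
  also have "\<dots> = exp (- stirling_remainder z)"
  proof -
    have "- stirling_remainder z = - ln_Gamma z + ((z - 1 / 2) * Ln z - z + of_real (ln (2 * pi) / 2))"
      by (simp add: stirling_remainder_def algebra_simps)
    then show ?thesis using z1 by (simp only: exp_add E_def) (simp add: rGamma_complex_altdef)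
  qed
  finally show ?thesis .
qed

text \<open>The reflection formula once more, with the branch
  \<open>Ln (- z) = Ln z - \<i> pi\<close> for \<open>Im z > 0\<close>. It says that the two Binet
  terms gained by P cancel the factor gained by the product in q*.\<close>

lemma stirling_remainder_reflection:
  assumes "Im z > 0"
  shows "(1 - exp (2 * of_real pi * \<i> * z)) * exp (stirling_remainder z + stirling_remainder (- z)) = 1"
proof -
  have z0: "z \<noteq> 0" using assms by auto
  have nn: "z \<notin> \<int>\<^sub>\<le>\<^sub>0" "- z \<notin> \<int>\<^sub>\<le>\<^sub>0"
    using assms by (auto elim!: nonpos_Ints_cases simp: minus_equation_iff[of z])
  have Lm: "Ln (- z) = Ln z - \<i> * of_real pi"
  proof (rule Ln_unique)
    show "exp (Ln z - \<i> * of_real pi) = - z" using z0 by (simp add: exp_diff mult.commute[of \<i>])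
  qed (use Im_Ln_pos_lt_imp[OF assms] in auto)
  define s where "s = sin (of_real pi * z)"
  define e where "e = exp (of_real pi * \<i> * z)"
  have s0: "s \<noteq> 0"
  proof
    assume "s = 0"
    then have "1 - exp (2 * of_real pi * \<i> * z) = 0" using minus_2i_exp_sin[of z] by (simp add: s_def)
    then have "norm (exp (2 * of_real pi * \<i> * z)) = 1" by simp
    then show False unfolding norm_exp_2_pi_i using assms by simp
  qed
  have e0: "e \<noteq> 0" by (simp add: e_def)
  have x: "1 - exp (2 * of_real pi * \<i> * z) = - 2 * \<i> * e * s"
    using minus_2i_exp_sin[of z] by (simp add: e_def s_def)
  have G: "z * Gamma z * Gamma (- z) * s = - of_real pi"
  proof -
    have "Gamma (1 + z) = z * Gamma z" using Gamma_plus1[of z] nn by (simp add: add.commute)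
    moreover have "Gamma (- z) * Gamma (1 + z) = of_real pi / - s"
      using Gamma_reflection_complex[of "- z"] by (simp add: s_def)
    ultimately have "Gamma (- z) * (z * Gamma z) * s = of_real pi / - s * s" by simp
    then show ?thesis using s0 by (simp add: mult_ac)
  qed
  have "stirling_remainder z + stirling_remainder (- z) =
      ln_Gamma z + ln_Gamma (- z) + Ln z - of_real pi * \<i> * z - of_real pi * \<i> / 2 - of_real (ln (2 * pi))"
    unfolding stirling_remainder_def Lm by (simp add: field_simps)
  also have "exp \<dots> = Gamma z * Gamma (- z) * z / e / \<i> / (2 * of_real pi)"
  proof -
    have "exp (of_real (ln (2 * pi))) = complex_of_real (2 * pi)" by (simp only: exp_of_real) simp
    then show ?thesis
      unfolding exp_diff exp_add exp_half_pi_i using nn z0 by (simp add: Gamma_complex_altdef e_def)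
  qed
  finally have "(1 - exp (2 * of_real pi * \<i> * z)) * exp (stirling_remainder z + stirling_remainder (- z)) =
      - 2 * \<i> * e * s * (Gamma z * Gamma (- z) * z / e / \<i> / (2 * of_real pi))"
    unfolding x by simp
  also have "\<dots> = - (z * Gamma z * Gamma (- z) * s) / of_real pi"
    using e0 by (simp add: field_simps del: divide_i)
  also have "\<dots> = 1" unfolding G by simp
  finally show ?thesis .
qed

section \<open>Both sides in the coordinates a and z\<close>

text \<open>In \<open>core_lhs\<close> and \<open>core_rhs\<close>, \<open>z / a\<close> is
  \<open>\<xi>\<close> and \<open>1 / a\<close> is \<open>\<tau>\<close>, so x*q* is exp(2 pi i (z -
  a)) and q* is exp(- 2 pi i a). The prefactor is taken in its cut-free form.\<close>

definition core_lhs :: "complex \<Rightarrow> complex \<Rightarrow> complex" where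
  "core_lhs a z = qpoch_inf (exp (2 * of_real pi * \<i> * (z / a))) (exp (2 * of_real pi * \<i> * (1 / a)))"

definition core_rhs :: "complex \<Rightarrow> complex \<Rightarrow> complex" where
  "core_rhs a z = exp (- (of_real pi * \<i> / (12 * a))) *
     qpoch_inf (exp (2 * of_real pi * \<i> * (z - a))) (exp (2 * of_real pi * \<i> * (- a))) *
     (rGamma z * exp (H_fun (1 / a) (z / a) + P_int a z))"

lemma exp_2_pi_i_add: "exp (2 * of_real pi * \<i> * (u + v)) = exp (2 * of_real pi * \<i> * u) * exp (2 * of_real pi * \<i> * v)"
  by (simp add: ring_distribs exp_add)

lemma exp_2_pi_i_one [simp]: "exp (2 * of_real pi * \<i>) = 1"
  using exp_two_pi_i by simp

lemma Im_divide_a: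
  assumes "Re a = 1"
  shows "Im (z / a) = (Im z - Re z * Im a) / (1 + Im a ^ 2)"
  using assms by (simp add: Im_divide)

lemma Im_one_divide_pos:
  assumes "Re a = 1" "Im a < 0"
  shows "Im (1 / a) > 0"
  unfolding Im_divide_a[OF assms(1)] using assms(2) by (simp add: divide_neg_pos add_pos_nonneg)

lemma core_norms:
  assumes "Re a = 1" "Im a < 0"
  shows "norm (exp (2 * of_real pi * \<i> * (1 / a))) < 1" "norm (exp (2 * of_real pi * \<i> * (- a))) < 1"
proof -
  have "Im (1 / a) > 0" by (rule Im_one_divide_pos[OF assms])
  then show "norm (exp (2 * of_real pi * \<i> * (1 / a))) < 1" unfolding norm_exp_2_pi_i by simp
  show "norm (exp (2 * of_real pi * \<i> * (- a))) < 1" unfolding norm_exp_2_pi_i using assms(2) by (simp add: mult_pos_neg)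
qed

text \<open>The product in q loses its first factor 1 - x, while that in q* depends on z modulo 1
  only. On the right the primitives of \<open>lg_sym\<close> in \<open>H_fun\<close> and in P
  cancel.\<close>

lemma core_shift_1:
  assumes a: "Re a = 1" "Im a < 0" and z: "\<bar>Re z\<bar> < 1" "\<bar>Re (z + 1)\<bar> < 1"
  shows "core_lhs a z = (1 - exp (2 * of_real pi * \<i> * (z / a))) * core_lhs a (z + 1)"
    and "core_rhs a z = (1 - exp (2 * of_real pi * \<i> * (z / a))) * core_rhs a (z + 1)"
proof -
  have a0: "a \<noteq> 0" using a by auto
  define \<tau> where "\<tau> = 1 / a"
  define \<xi> where "\<xi> = z / a"
  have \<tau>0: "\<tau> \<noteq> 0" using a0 by (simp add: \<tau>_def)
  have a\<tau>: "a = 1 / \<tau>" by (simp add: \<tau>_def)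
  have z\<xi>: "z = \<xi> / \<tau>" using a0 by (simp add: \<xi>_def \<tau>_def)
  have \<xi>1: "(z + 1) / a = \<xi> + \<tau>" using a0 by (simp add: \<xi>_def \<tau>_def add_divide_distrib)
  show "core_lhs a z = (1 - exp (2 * of_real pi * \<i> * (z / a))) * core_lhs a (z + 1)"
    unfolding core_lhs_def add_divide_distrib exp_2_pi_i_add by (rule qpoch_inf_rec[OF core_norms(1)[OF a]])
  have q: "exp (2 * of_real pi * \<i> * (z + 1 - a)) = exp (2 * of_real pi * \<i> * (z - a))"
    using exp_2_pi_i_add[of "z - a" 1] by (simp add: algebra_simps)
  have notcut: "\<xi> \<notin> real_cuts" unfolding \<xi>_def by (rule strip_div_notin_real_cuts[OF a(1) z(1)])
  define c where "c = of_real (ln (2 * pi)) - of_real pi * \<i> / 2 + Ln \<tau>"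
  have Pd: "P_int a (z + 1) - P_int a z = lg_sym (\<xi> + \<tau>) + lg_sym \<xi> - 2 / \<tau> * (lg_sym_primitive (\<xi> + \<tau>) - lg_sym_primitive \<xi>)"
    using P_int_shift_1[OF a(1) z] unfolding \<xi>1 \<xi>_def[symmetric] by (simp add: a\<tau>)
  have Hd: "H_fun \<tau> (\<xi> + \<tau>) - H_fun \<tau> \<xi> = - (lg_sym (\<xi> + \<tau>) - lg_sym \<xi>) - of_real pi * \<i> * \<xi> - c
      + 2 / \<tau> * (lg_sym_primitive (\<xi> + \<tau>) - lg_sym_primitive \<xi>)"
    unfolding H_fun_def Li2_uhp_aux_def c_def using \<tau>0
    by (simp add: field_simps power2_eq_square)
  have "H_fun \<tau> (\<xi> + \<tau>) + P_int a (z + 1) = (H_fun \<tau> \<xi> + P_int a z) + (2 * lg_sym \<xi> - of_real pi * \<i> * \<xi> - c)"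
  proof -
    define D where "D = 2 / \<tau> * (lg_sym_primitive (\<xi> + \<tau>) - lg_sym_primitive \<xi>)"
    have "H_fun \<tau> (\<xi> + \<tau>) + P_int a (z + 1) =
        (H_fun \<tau> \<xi> + P_int a z) + ((H_fun \<tau> (\<xi> + \<tau>) - H_fun \<tau> \<xi>) + (P_int a (z + 1) - P_int a z))" by simp
    also have "\<dots> = (H_fun \<tau> \<xi> + P_int a z) + (2 * lg_sym \<xi> - of_real pi * \<i> * \<xi> - c)"
      unfolding Pd Hd D_def[symmetric] by simp
    finally show ?thesis .
  qed
  then have e: "exp (H_fun \<tau> (\<xi> + \<tau>) + P_int a (z + 1)) = exp (H_fun \<tau> \<xi> + P_int a z) * exp (2 * lg_sym \<xi> - of_real pi * \<i> * \<xi> - c)"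
    by (simp only: exp_add)
  \<comment> \<open>The value \<open>z\<close> is what turns \<open>rGamma (z + 1)\<close> into
    \<open>rGamma z\<close>.\<close>
  have x: "(1 - exp (2 * of_real pi * \<i> * \<xi>)) * exp (2 * lg_sym \<xi> - of_real pi * \<i> * \<xi> - c) = z"
  proof -
    have "(1 - exp (2 * of_real pi * \<i> * \<xi>)) * exp (2 * lg_sym \<xi> - of_real pi * \<i> * \<xi> - c) =
       \<xi> * (exp (of_real pi * \<i> * \<xi> + of_real (ln (2 * pi)) - of_real pi * \<i> / 2 - 2 * lg_sym \<xi>) * exp (2 * lg_sym \<xi> - of_real pi * \<i> * \<xi> - c))"
      unfolding exp_log_uhp_gen[OF notcut, symmetric] by (simp add: mult_ac)
    also have "exp (of_real pi * \<i> * \<xi> + of_real (ln (2 * pi)) - of_real pi * \<i> / 2 - 2 * lg_sym \<xi>) * exp (2 * lg_sym \<xi> - of_real pi * \<i> * \<xi> - c) = exp (- Ln \<tau>)"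
      unfolding mult_exp_exp c_def by simp
    also have "\<xi> * exp (- Ln \<tau>) = z" using \<tau>0 z\<xi> by (simp add: exp_minus divide_inverse)
    finally show ?thesis .
  qed
  have "rGamma z * exp (H_fun \<tau> \<xi> + P_int a z) =
     (1 - exp (2 * of_real pi * \<i> * \<xi>)) * (rGamma (z + 1) * exp (H_fun \<tau> (\<xi> + \<tau>) + P_int a (z + 1)))"
  proof -
    have "rGamma z = z * rGamma (z + 1)" by (rule rGamma_plus1[symmetric])
    moreover have "u * (g * (E * F)) = (u * F) * g * E" for u g E F :: complex by (simp only: mult_ac)
    ultimately show ?thesis unfolding e using x by (simp only:)
  qed
  then show "core_rhs a z = (1 - exp (2 * of_real pi * \<i> * (z / a))) * core_rhs a (z + 1)"
    unfolding core_rhs_def q \<tau>_def[symmetric] \<xi>_def[symmetric] \<xi>1 by (simp only: mult_ac)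
qed

text \<open>The left side depends on x and q only. On the right the product in q* gains 1 - exp(2 pi
  i z), P gains two Binet integrals, and the reflection identity of the Stirling remainder balances
  them.\<close>

lemma core_shift_a:
  assumes a: "Re a = 1" "Im a < 0" and z: "-1 < Re z" "Re z < 0" "Im z > 0" "Im (z / a) > 0"
  shows "core_lhs a (z + a) = core_lhs a z" and "core_rhs a (z + a) = core_rhs a z"
proof -
  have a0: "a \<noteq> 0" using a by auto
  have za: "(z + a) / a = z / a + 1" using a0 by (simp add: add_divide_distrib)
  have x: "exp (2 * of_real pi * \<i> * ((z + a) / a)) = exp (2 * of_real pi * \<i> * (z / a))"
    unfolding za exp_2_pi_i_add by simp
  show "core_lhs a (z + a) = core_lhs a z" unfolding core_lhs_def x ..
  have \<tau>: "Im (1 / a) > 0" by (rule Im_one_divide_pos[OF a])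
  have t0: "1 / a \<noteq> 0" using a0 by simp
  have z': "Im ((z + a) / a) > 0" unfolding za using z(4) by simp
  \<comment> \<open>The part of the prefactor that is a function of x alone, hence common to
    \<open>z\<close> and \<open>z + a\<close>.\<close>
  define X where "X = exp (Ln (1 - exp (2 * of_real pi * \<i> * (z / a))) / 2) * exp (Li2_series (exp (2 * of_real pi * \<i> * (z / a))) / (2 * of_real pi * \<i> * (1 / a)))"
  have R: "rGamma w * exp (H_fun (1 / a) (w / a) + P_int a w) = X * exp (- stirling_remainder w + P_int a w)"
    if w: "w = z \<or> w = z + a" "w \<notin> \<real>\<^sub>\<le>\<^sub>0" for w
  proof -
    have w1: "Im (w / a) > 0" "exp (2 * of_real pi * \<i> * (w / a)) = exp (2 * of_real pi * \<i> * (z / a))"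
      using w z' z(4) x by auto
    have w2: "w / a / (1 / a) = w" using a0 by simp
    have "rGamma w * exp (H_fun (1 / a) (w / a) + P_int a w) =
      exp (Ln (1 - exp (2 * of_real pi * \<i> * (z / a))) / 2) *
      exp (Li2_series (exp (2 * of_real pi * \<i> * (z / a))) / (2 * of_real pi * \<i> * (1 / a)) + G_fun (1 / a) (w / a) + P_int a w)"
      using exp_prefactor_uhp[OF \<tau> w1(1), of "P_int a w"] unfolding w1(2) w2 by simp
    also have "\<dots> = X * exp (G_fun (1 / a) (w / a)) * exp (P_int a w)" by (simp only: X_def exp_add mult.assoc)
    also have "\<dots> = X * exp (- stirling_remainder w + P_int a w)"
      unfolding exp_G_fun[OF t0 w2 w(2)] by (simp only: exp_add mult.assoc)
    finally show ?thesis .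
  qed
  have nn: "z \<notin> \<real>\<^sub>\<le>\<^sub>0" "z + a \<notin> \<real>\<^sub>\<le>\<^sub>0" using z a by (auto simp: complex_nonpos_Reals_iff)
  have Pd: "P_int a (z + a) = P_int a z + stirling_remainder (- z) + stirling_remainder (z + a)"
    using P_int_shift_a[OF a(1) z(1,2)] binet_formula[of "- z"] binet_formula[of "z + a"] z a
    by (simp add: algebra_simps)
  have q: "qpoch_inf (exp (2 * of_real pi * \<i> * (z + a - a))) (exp (2 * of_real pi * \<i> * (- a))) =
      (1 - exp (2 * of_real pi * \<i> * z)) * qpoch_inf (exp (2 * of_real pi * \<i> * (z - a))) (exp (2 * of_real pi * \<i> * (- a)))"
    using qpoch_inf_rec[OF core_norms(2)[OF a], of "exp (2 * of_real pi * \<i> * z)"] exp_2_pi_i_add[of z "- a"] by simp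
  have "(1 - exp (2 * of_real pi * \<i> * z)) * exp (- stirling_remainder (z + a) + P_int a (z + a)) =
     exp (- stirling_remainder z + P_int a z)"
  proof -
    have "- stirling_remainder (z + a) + P_int a (z + a) = (stirling_remainder z + stirling_remainder (- z)) + (- stirling_remainder z + P_int a z)"
      unfolding Pd by simp
    then show ?thesis using stirling_remainder_reflection[OF z(3)] by (simp only: exp_add mult.assoc[symmetric] mult_1_left)
  qed
  moreover have "C * (u * Q) * (X * E) = C * Q * (X * (u * E))" for C u Q E by (simp only: mult_ac)
  ultimately show "core_rhs a (z + a) = core_rhs a z"
    unfolding core_rhs_def q R[OF disjI1[OF refl] nn(1)] R[OF disjI2[OF refl] nn(2)] by (simp only:)
qed

text \<open>The intermediate point \<open>Complex (1/2) y - a\<close> has real part - 1/2; adding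
  \<open>a\<close> returns to the start, adding 1 gives the next point of the line. Since
  \<open>Im a < 0\<close>, that point lies higher.\<close>

lemma core_step:
  assumes a: "Re a = 1" "Im a < 0" and y: "y > 0"
  defines "x \<equiv> exp (2 * of_real pi * \<i> * (Complex (1/2) y / a))"
  shows "core_lhs a (Complex (1/2) y) = (1 - x) * core_lhs a (Complex (1/2) (y - Im a))"
    and "core_rhs a (Complex (1/2) y) = (1 - x) * core_rhs a (Complex (1/2) (y - Im a))"
proof -
  define z where "z = Complex (1/2) y - a"
  have a0: "a \<noteq> 0" using a by auto
  have za: "z + a = Complex (1/2) y" by (simp add: z_def)
  have z1: "z + 1 = Complex (1/2) (y - Im a)" using a by (simp add: z_def complex_eq_iff)
  have "z / a = Complex (1/2) y / a - 1" using a0 by (simp add: z_def diff_divide_distrib)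
  then have zI: "Im (z / a) = Im (Complex (1/2) y / a)" by simp
  have "\<dots> > 0" unfolding Im_divide_a[OF a(1)] using a y by (simp add: add_pos_nonneg add_pos_pos)
  with zI have zI: "Im (z / a) > 0" by simp
  have z: "-1 < Re z" "Re z < 0" "Im z > 0" using a y by (auto simp: z_def)
  have x: "exp (2 * of_real pi * \<i> * (z / a)) = x"
  proof -
    have "Complex (1/2) y / a = z / a + 1" using a0 by (simp add: z_def diff_divide_distrib)
    then show ?thesis unfolding x_def by (simp only: exp_2_pi_i_add) simp
  qed
  have "core_lhs a (z + a) = (1 - x) * core_lhs a (z + 1)" "core_rhs a (z + a) = (1 - x) * core_rhs a (z + 1)"
    using core_shift_a[OF a z zI] core_shift_1[OF a, of z] z unfolding x by auto
  then show "core_lhs a (Complex (1/2) y) = (1 - x) * core_lhs a (Complex (1/2) (y - Im a))"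
    "core_rhs a (Complex (1/2) y) = (1 - x) * core_rhs a (Complex (1/2) (y - Im a))"
    unfolding za z1 by auto
qed

text \<open>Upwards x and x*q* tend to 0, so the products, the square root and the dilogarithm
  become trivial; the Binet term vanishes and the limit of P cancels the power of q.\<close>

lemma core_limits:
  fixes Y :: "nat \<Rightarrow> real"
  assumes a: "Re a = 1" "Im a < 0" and Y: "filterlim Y at_top sequentially" and Ypos: "\<And>n. Y n > 0"
  shows "(\<lambda>n. core_lhs a (Complex (1/2) (Y n))) \<longlonglongrightarrow> 1" "(\<lambda>n. core_rhs a (Complex (1/2) (Y n))) \<longlonglongrightarrow> 1"
proof -
  have a0: "a \<noteq> 0" using a by auto
  define z where "z = (\<lambda>n. Complex (1/2) (Y n))"
  have d: "1 + Im a ^ 2 > 0" by (simp add: add_pos_nonneg)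
  have Imz: "Im (z n / a) = (Y n - Im a / 2) / (1 + Im a ^ 2)" for n
    unfolding Im_divide_a[OF a(1)] by (simp add: z_def)
  have E: "(\<lambda>n. exp (2 * of_real pi * \<i> * w n)) \<longlonglongrightarrow> 0" if "filterlim (\<lambda>n. Im (w n)) at_top sequentially" for w
  proof (rule tendsto_norm_zero_cancel)
    have "((\<lambda>t. exp (- 2 * pi * t)) \<longlongrightarrow> 0) at_top" by real_asymp
    from filterlim_compose[OF this that] show "(\<lambda>n. norm (exp (2 * of_real pi * \<i> * w n))) \<longlonglongrightarrow> 0"
      unfolding norm_exp_2_pi_i .
  qed
  have x0: "(\<lambda>n. exp (2 * of_real pi * \<i> * (z n / a))) \<longlonglongrightarrow> 0"
  proof (rule E)
    have "filterlim (\<lambda>t. (t - Im a / 2) / (1 + Im a ^ 2)) at_top at_top" using d by real_asymp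
    from filterlim_compose[OF this Y] show "filterlim (\<lambda>n. Im (z n / a)) at_top sequentially" unfolding Imz .
  qed
  have q0: "(\<lambda>n. exp (2 * of_real pi * \<i> * (z n - a))) \<longlonglongrightarrow> 0"
  proof (rule E)
    have "filterlim (\<lambda>t. t - Im a) at_top at_top" by real_asymp
    from filterlim_compose[OF this Y] show "filterlim (\<lambda>n. Im (z n - a)) at_top sequentially" by (simp add: z_def)
  qed
  show "(\<lambda>n. core_lhs a (Complex (1/2) (Y n))) \<longlonglongrightarrow> 1"
    unfolding core_lhs_def using qpoch_inf_tendsto_1[OF core_norms(1)[OF a] x0] by (simp add: z_def)
  have \<tau>: "Im (1 / a) > 0" by (rule Im_one_divide_pos[OF a])
  have t0: "1 / a \<noteq> 0" using a0 by simp
  \<comment> \<open>Continuity of the dilogarithm at 0, from its differentiability there.\<close>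
  have "\<exists>D. (Li2_series has_field_derivative D) (at 0)" using Li2_series_has_field_derivative[of 0] by auto
  then have "isCont Li2_series 0" using DERIV_isCont by blast
  from isCont_tendsto_compose[OF this x0]
  have Li: "(\<lambda>n. Li2_series (exp (2 * of_real pi * \<i> * (z n / a)))) \<longlonglongrightarrow> 0" by (simp add: Li2_series_def)
  have R: "rGamma (z n) * exp (H_fun (1 / a) (z n / a) + P_int a (z n)) =
     exp (Ln (1 - exp (2 * of_real pi * \<i> * (z n / a))) / 2) *
     (exp (Li2_series (exp (2 * of_real pi * \<i> * (z n / a))) / (2 * of_real pi * \<i> * (1 / a))) * exp (- binet_integral (z n)) * exp (P_int a (z n)))" for n
  proof -
    have w1: "Im (z n / a) > 0" unfolding Imz using a Ypos[of n] d by (simp add: divide_pos_pos)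
    have w2: "z n / a / (1 / a) = z n" using a0 by simp
    have nn: "z n \<notin> \<real>\<^sub>\<le>\<^sub>0" by (auto simp: z_def complex_nonpos_Reals_iff)
    have b: "binet_integral (z n) = stirling_remainder (z n)" by (rule binet_formula) (simp add: z_def)
    show ?thesis
      using exp_prefactor_uhp[OF \<tau> w1, of "P_int a (z n)"]
      unfolding w2 b exp_G_fun[OF t0 w2 nn, symmetric] by (simp only: exp_add)
  qed
  have "(\<lambda>n. exp (- (of_real pi * \<i> / (12 * a))) *
     qpoch_inf (exp (2 * of_real pi * \<i> * (z n - a))) (exp (2 * of_real pi * \<i> * (- a))) *
     (exp (Ln (1 - exp (2 * of_real pi * \<i> * (z n / a))) / 2) *
     (exp (Li2_series (exp (2 * of_real pi * \<i> * (z n / a))) / (2 * of_real pi * \<i> * (1 / a))) * exp (- binet_integral (z n)) * exp (P_int a (z n)))))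
    \<longlonglongrightarrow> exp (- (of_real pi * \<i> / (12 * a))) * 1 * (exp (Ln (1 - 0) / 2) * (exp (0 / (2 * of_real pi * \<i> * (1 / a))) * exp (- 0) * exp (of_real pi * \<i> / (12 * a))))"
    unfolding z_def
    by (intro tendsto_intros qpoch_inf_tendsto_1[OF core_norms(2)[OF a]] q0[unfolded z_def] x0[unfolded z_def] Li[unfolded z_def]
         binet_integral_vertical_tendsto[OF Y] P_int_tendsto[OF a(1) Y]) (use a0 in auto)
  also have "exp (- (of_real pi * \<i> / (12 * a))) * 1 * (exp (Ln (1 - 0) / 2) * (exp (0 / (2 * of_real pi * \<i> * (1 / a))) * exp (- 0) * exp (of_real pi * \<i> / (12 * a)))) = 1"
    by (simp add: exp_minus)
  finally show "(\<lambda>n. core_rhs a (Complex (1/2) (Y n))) \<longlonglongrightarrow> 1"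
    unfolding R[symmetric] unfolding core_rhs_def z_def .
qed

text \<open>Each step multiplies both sides by the same factor, and their limits agree.\<close>

lemma core_formula_line:
  assumes a: "Re a = 1" "Im a < 0" and y: "y > 0"
  shows "core_lhs a (Complex (1/2) y) = core_rhs a (Complex (1/2) y)"
proof -
  define Y where "Y = (\<lambda>n. y - Im a * real n)"
  have Ypos: "Y n > 0" for n
  proof -
    have "- Im a * real n \<ge> 0" using a by (intro mult_nonneg_nonneg) auto
    then show ?thesis using y by (simp add: Y_def)
  qed
  have "filterlim (\<lambda>n. y - Im a * real n) at_top sequentially" using a(2) by real_asymp
  then have Y: "filterlim Y at_top sequentially" by (simp add: Y_def)
  let ?L = "\<lambda>y. core_lhs a (Complex (1/2) y)" and ?R = "\<lambda>y. core_rhs a (Complex (1/2) y)"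
  have "\<exists>c. ?L y = c * ?L (Y n) \<and> ?R y = c * ?R (Y n)" for n
  proof (induction n)
    case 0
    show ?case by (intro exI[of _ 1]) (simp add: Y_def)
  next
    case (Suc n)
    then obtain c where c: "?L y = c * ?L (Y n)" "?R y = c * ?R (Y n)" by blast
    have YS: "Y n - Im a = Y (Suc n)" by (simp add: Y_def algebra_simps)
    show ?case using core_step[OF a Ypos[of n]] unfolding c YS by (metis mult.assoc)
  qed
  \<comment> \<open>Cross-multiplication eliminates the accumulated factor \<open>c\<close>, so
    neither its limit nor its nonvanishing enters.\<close>
  then have cross: "?L y * ?R (Y n) = ?R y * ?L (Y n)" for n
    by (metis mult.assoc mult.commute)
  have "(\<lambda>n. ?L y * ?R (Y n)) \<longlonglongrightarrow> ?L y * 1"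
    by (intro tendsto_mult tendsto_const core_limits(2)[OF a Y Ypos])
  moreover have "(\<lambda>n. ?R y * ?L (Y n)) \<longlonglongrightarrow> ?R y * 1"
    by (intro tendsto_mult tendsto_const core_limits(1)[OF a Y Ypos])
  ultimately have "?L y * 1 = ?R y * 1" unfolding cross using LIMSEQ_unique by blast
  then show ?thesis by simp
qed

section \<open>Analytic continuation\<close>

text \<open>The value of P is a separate argument, so that the same expression serves P and its
  conjugate.\<close>

definition product_defect :: "complex \<Rightarrow> complex \<Rightarrow> complex \<Rightarrow> complex" where
  "product_defect \<tau> \<xi> p = qpoch_inf (exp (2 * of_real pi * \<i> * \<xi>)) (exp (2 * of_real pi * \<i> * \<tau>)) -
     exp (- (of_real pi * \<i> * \<tau> / 12)) *
     qpoch_inf (exp (2 * of_real pi * \<i> * ((\<xi> - 1) / \<tau>))) (exp (2 * of_real pi * \<i> * (- (1 / \<tau>)))) *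
     (rGamma (\<xi> / \<tau>) * exp (H_fun \<tau> \<xi> + p))"

lemma product_defect_line:
  assumes a: "Re a = 1" "Im a < 0" and y: "y > 0"
  shows "product_defect (1 / a) (Complex (1/2) y / a) (P_int a (Complex (1/2) y)) = 0"
proof -
  have a0: "a \<noteq> 0" using a by auto
  have e: "(z / a - 1) / (1 / a) = z - a" "z / a / (1 / a) = z" "- (1 / (1 / a)) = - a"
    "of_real pi * \<i> * (1 / a) / 12 = of_real pi * \<i> / (12 * a)" for z
    using a0 by (auto simp: field_simps)
  show ?thesis
    using core_formula_line[OF a y] unfolding product_defect_def e core_lhs_def core_rhs_def by simp
qed

lemma Im_neg_inverse: "Im \<tau> > 0 \<Longrightarrow> Im (- (1 / \<tau>)) > 0"
  by (simp add: Im_divide sum_power2_gt_zero_iff zero_less_divide_iff)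

text \<open>\<open>rGamma\<close> is entire and \<open>H_fun\<close> contains no logarithm of
  \<open>\<xi> / \<tau>\<close>, so the half-line \<open>\<xi> / \<tau> \<le> 0\<close> is not
  singular and continuation can cross it.\<close>

lemma product_defect_holomorphic:
  assumes A: "open A" and hol: "t holomorphic_on A" "x holomorphic_on A" "p holomorphic_on A"
    and dom: "\<And>s. s \<in> A \<Longrightarrow> Im (t s) > 0" "\<And>s. s \<in> A \<Longrightarrow> x s \<notin> real_cuts"
  shows "(\<lambda>s. product_defect (t s) (x s) (p s)) holomorphic_on A"
proof -
  have t0: "t s \<noteq> 0" "t s \<notin> \<real>\<^sub>\<le>\<^sub>0" if "s \<in> A" for s
    using uhp_not_cut(2,3)[OF dom(1)[OF that]] by auto
  have q1: "(\<lambda>s. qpoch_inf (exp (2 * of_real pi * \<i> * x s)) (exp (2 * of_real pi * \<i> * t s))) holomorphic_on A"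
  proof (rule qpoch_inf_holomorphic[OF A])
    show "norm (exp (2 * of_real pi * \<i> * t s)) < 1" if "s \<in> A" for s
      unfolding norm_exp_2_pi_i using dom(1)[OF that] by simp
  qed (intro holomorphic_intros hol)+
  have q2: "(\<lambda>s. qpoch_inf (exp (2 * of_real pi * \<i> * ((x s - 1) / t s))) (exp (2 * of_real pi * \<i> * (- (1 / t s))))) holomorphic_on A"
  proof (rule qpoch_inf_holomorphic[OF A])
    show "norm (exp (2 * of_real pi * \<i> * (- (1 / t s)))) < 1" if "s \<in> A" for s
      unfolding norm_exp_2_pi_i using Im_neg_inverse[OF dom(1)[OF that]] by (simp add: mult_pos_neg)
  qed (intro holomorphic_intros hol t0; simp)+
  have lg: "(\<lambda>s. lg_sym (x s)) holomorphic_on A" "(\<lambda>s. lg_sym_primitive (x s)) holomorphic_on A"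
    using holomorphic_on_compose_gen[OF hol(2) lg_sym_holomorphic] holomorphic_on_compose_gen[OF hol(2) lg_sym_primitive_holomorphic]
      dom(2) by (auto simp: o_def)
  have H: "(\<lambda>s. H_fun (t s) (x s)) holomorphic_on A"
    unfolding H_fun_def Li2_uhp_aux_def by (intro holomorphic_intros hol lg) (use t0 in auto)
  have "(\<lambda>s. x s / t s) holomorphic_on A" by (intro holomorphic_intros hol t0)
  from holomorphic_on_compose_gen[OF this holomorphic_rGamma, of UNIV]
  have g: "(\<lambda>s. rGamma (x s / t s)) holomorphic_on A" by (simp add: o_def)
  show ?thesis unfolding product_defect_def
    by (intro holomorphic_intros q1 q2 g H hol) auto
qed

text \<open>Reduces continuation in two variables to the identity theorem in one variable along
  holomorphic curves.\<close>

lemma holomorphic2_on_compose: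
  assumes P: "holomorphic2_on P W" and A: "open A" and hol: "t holomorphic_on A" "x holomorphic_on A"
    and W: "\<And>s. s \<in> A \<Longrightarrow> (t s, x s) \<in> W"
  shows "(\<lambda>s. P (t s) (x s)) holomorphic_on A"
  unfolding holomorphic_on_open[OF A]
proof (intro ballI)
  fix s assume s: "s \<in> A"
  obtain a b where ab: "((\<lambda>(z, w). P z w) has_derivative (\<lambda>(h, k). a * h + b * k)) (at (t s, x s))"
    using P W[OF s] unfolding holomorphic2_on_def by blast
  have t: "(t has_derivative (*) (deriv t s)) (at s)" and x: "(x has_derivative (*) (deriv x s)) (at s)"
    using holomorphic_derivI[OF hol(1) A s] holomorphic_derivI[OF hol(2) A s] by (auto simp: has_field_derivative_def)
  have "((\<lambda>s. (\<lambda>(z, w). P z w) (t s, x s)) has_derivative (\<lambda>h. (\<lambda>(h, k). a * h + b * k) (deriv t s * h, deriv x s * h))) (at s)"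
    using has_derivative_compose[OF has_derivative_Pair[OF t x] ab] .
  moreover have "(\<lambda>h. (\<lambda>(h, k). a * h + b * k) (deriv t s * h, deriv x s * h)) = (*) (a * deriv t s + b * deriv x s)"
    by (auto simp: fun_eq_iff algebra_simps)
  ultimately have "((\<lambda>s. P (t s) (x s)) has_derivative (*) (a * deriv t s + b * deriv x s)) (at s)"
    by simp
  then show "\<exists>f'. ((\<lambda>s. P (t s) (x s)) has_field_derivative f') (at s)"
    by (auto simp: has_field_derivative_def)
qed

section \<open>From the line to the first quadrant of tau\<close>

text \<open>The consequences of \<open>is_P_minus_on\<close> used for the local continuation, in a
  form invariant under conjugating both variables. Of the rays only the one of argument - pi/2 is
  kept.\<close>

definition P_setting :: "(complex \<times> complex) set \<Rightarrow> (complex \<Rightarrow> complex \<Rightarrow> complex) \<Rightarrow> bool" where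
  "P_setting W P \<longleftrightarrow> open W \<and> W \<subseteq> (- \<real>\<^sub>\<le>\<^sub>0) \<times> (- real_cuts) \<and> holomorphic2_on P W \<and>
     (\<forall>\<tau> \<xi>. Im \<tau> = 0 \<and> Re \<tau> > 0 \<and> \<xi> \<notin> real_cuts \<longrightarrow> (\<tau>, \<xi>) \<in> W) \<and>
     (\<forall>\<tau> \<xi>. Re \<tau> > 0 \<and> \<bar>Re (\<xi> / \<tau>)\<bar> < Re (1 / \<tau>) \<longrightarrow> (\<tau>, \<xi>) \<in> W) \<and>
     (\<forall>a z. Re a = 1 \<and> \<bar>Re z\<bar> < 1 \<longrightarrow> P (1 / a) (z / a) = P_int a z)"

lemma P_setting_defect_holomorphic:
  assumes "P_setting W P" "open A" "t holomorphic_on A" "x holomorphic_on A"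
    and "\<And>s. s \<in> A \<Longrightarrow> (t s, x s) \<in> W" "\<And>s. s \<in> A \<Longrightarrow> Im (t s) > 0"
  shows "(\<lambda>s. product_defect (t s) (x s) (P (t s) (x s))) holomorphic_on A"
proof (rule product_defect_holomorphic[OF assms(2-4)])
  have "holomorphic2_on P W" "W \<subseteq> (- \<real>\<^sub>\<le>\<^sub>0) \<times> (- real_cuts)" using assms(1) by (auto simp: P_setting_def)
  then show "(\<lambda>s. P (t s) (x s)) holomorphic_on A" "\<And>s. s \<in> A \<Longrightarrow> x s \<notin> real_cuts"
    using holomorphic2_on_compose[OF _ assms(2-4), of P W] assms(5) by auto
qed (use assms in auto)

text \<open>For fixed \<open>a\<close> the identity theorem in \<open>z\<close> extends the formula
  from the vertical half-line to the whole strip of convergence.\<close>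

lemma product_defect_strip:
  assumes P: "P_setting W P" and a: "Re a = 1" "Im a < 0" and z: "\<bar>Re z\<bar> < 1"
  shows "product_defect (1 / a) (z / a) (P (1 / a) (z / a)) = 0"
proof -
  let ?S = "{z::complex. -1 < Re z} \<inter> {z. Re z < 1}"
  let ?U = "{Complex (1/2) y | y. y > 0}"
  have a0: "a \<noteq> 0" using a by auto
  have re: "Re (1 / a) > 0" using a by (simp add: Re_divide add_pos_nonneg)
  show ?thesis
  proof (rule analytic_continuation[of "\<lambda>z. product_defect (1 / a) (z / a) (P (1 / a) (z / a))" ?S ?U "Complex (1/2) 1"])
    show S: "open ?S" by (intro open_Int open_halfspace_Re_gt open_halfspace_Re_lt)
    show "connected ?S" by (intro convex_connected convex_Int convex_halfspace_Re_gt convex_halfspace_Re_lt)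
    show "(\<lambda>z. product_defect (1 / a) (z / a) (P (1 / a) (z / a))) holomorphic_on ?S"
    proof (rule P_setting_defect_holomorphic[OF P S])
      show "(1 / a, s / a) \<in> W" if "s \<in> ?S" for s
      proof -
        have "\<bar>Re (s / a / (1 / a))\<bar> < Re (1 / (1 / a))" using that a0 a by auto
        then show ?thesis using P re unfolding P_setting_def by blast
      qed
      show "Im (1 / a) > 0" by (rule Im_one_divide_pos[OF a])
    qed (use a0 in \<open>auto intro!: holomorphic_intros\<close>)
    show "Complex (1/2) 1 islimpt ?U"
      unfolding islimpt_sequential
    proof (intro exI[of _ "\<lambda>n. Complex (1/2) (1 + 1 / real (Suc n))"] conjI allI)
      show "Complex (1/2) (1 + 1 / real (Suc n)) \<in> ?U - {Complex (1/2) 1}" for n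
        by (auto intro!: exI[of _ "1 + 1 / real (Suc n)"] add_pos_pos)
      have "(\<lambda>n. 1 + 1 / real (Suc n)) \<longlonglongrightarrow> 1" by real_asymp
      then show "(\<lambda>n. Complex (1/2) (1 + 1 / real (Suc n))) \<longlonglongrightarrow> Complex (1/2) 1"
        by (intro tendsto_Complex tendsto_const)
    qed
    fix w assume "w \<in> ?U"
    then obtain y where y: "w = Complex (1/2) y" "y > 0" by blast
    have "P (1 / a) (w / a) = P_int a w" using P a y unfolding P_setting_def by simp
    then show "product_defect (1 / a) (w / a) (P (1 / a) (w / a)) = 0"
      using product_defect_line[OF a y(2)] y(1) by simp
  qed (use z in auto)
qed

text \<open>For real \<open>\<xi>\<close> in (0,1) the strip condition reads
  \<open>\<xi> * Re (1 / \<tau>) < Re (1 / \<tau>)\<close> and holds for all \<open>\<tau>\<close>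
  in the right half-plane. So the identity theorem in \<open>\<tau>\<close> spreads the formula from
  the arc \<open>Re (1 / \<tau>) = 1\<close> over the quadrant.\<close>

lemma product_defect_quadrant:
  assumes P: "P_setting W P" and \<tau>: "Re \<tau> > 0" "Im \<tau> > 0" and \<xi>: "0 < \<xi>" "\<xi> < 1"
  shows "product_defect \<tau> (of_real \<xi>) (P \<tau> (of_real \<xi>)) = 0"
proof -
  let ?S = "{z::complex. 0 < Re z} \<inter> {z. 0 < Im z}"
  let ?U = "{1 / a | a. Re a = 1 \<and> Im a < 0}"
  have W: "(s, of_real \<xi>) \<in> W" if "Re s > 0" for s
  proof -
    have "Re (1 / s) > 0" using that by (simp add: Re_divide add_pos_nonneg)
    moreover have "Re (of_real \<xi> / s) = \<xi> * Re (1 / s)" by (simp add: Re_divide)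
    ultimately have "\<bar>Re (of_real \<xi> / s)\<bar> < Re (1 / s)" using \<xi> by (simp add: abs_mult)
    then show ?thesis using P that unfolding P_setting_def by blast
  qed
  show ?thesis
  proof (rule analytic_continuation[of "\<lambda>\<tau>. product_defect \<tau> (of_real \<xi>) (P \<tau> (of_real \<xi>))" ?S ?U "1 / Complex 1 (-1)"])
    show S: "open ?S" by (intro open_Int open_halfspace_Re_gt open_halfspace_Im_gt)
    show "connected ?S" by (intro convex_connected convex_Int convex_halfspace_Re_gt convex_halfspace_Im_gt)
    show "(\<lambda>\<tau>. product_defect \<tau> (of_real \<xi>) (P \<tau> (of_real \<xi>))) holomorphic_on ?S"
      by (rule P_setting_defect_holomorphic[OF P S]) (use W in \<open>auto intro!: holomorphic_intros\<close>)
    show sub: "?U \<subseteq> ?S"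
    proof safe
      fix a :: complex assume "Re a = 1" "Im a < 0"
      then show "0 < Re (1 / a)" "0 < Im (1 / a)" using Im_one_divide_pos[of a] by (auto simp: Re_divide add_pos_nonneg)
    qed
    have mem: "1 / Complex 1 (-1) \<in> ?U" by (auto intro!: exI[of _ "Complex 1 (-1)"])
    then show "1 / Complex 1 (-1) \<in> ?S" using sub by blast
    show "1 / Complex 1 (-1) islimpt ?U"
      unfolding islimpt_sequential
    proof (intro exI[of _ "\<lambda>n. 1 / Complex 1 (- (1 + 1 / real (Suc n)))"] conjI allI)
      show "1 / Complex 1 (- (1 + 1 / real (Suc n))) \<in> ?U - {1 / Complex 1 (-1)}" for n
      proof -
        have "1 / Complex 1 (- (1 + 1 / real (Suc n))) \<noteq> 1 / Complex 1 (-1)"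
          by (simp only: divide_inverse mult_1_left inverse_eq_iff_eq) (simp add: complex_eq_iff)
        moreover have "0 < 1 + 1 / real (Suc n)" by (intro add_pos_pos) auto
        then have "- (1 + 1 / real (Suc n)) < 0" by linarith
        ultimately show ?thesis by (auto intro!: exI[of _ "Complex 1 (- (1 + 1 / real (Suc n)))"] simp del: of_nat_Suc)
      qed
      have "(\<lambda>n. - (1 + 1 / real (Suc n))) \<longlonglongrightarrow> -1" by real_asymp
      then show "(\<lambda>n. 1 / Complex 1 (- (1 + 1 / real (Suc n)))) \<longlonglongrightarrow> 1 / Complex 1 (-1)"
        by (intro tendsto_divide tendsto_Complex tendsto_const) (auto simp: complex_eq_iff)
    qed
    fix w assume "w \<in> ?U"
    then obtain a where a: "w = 1 / a" "Re a = 1" "Im a < 0" by blast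
    have "a \<noteq> 0" using a by auto
    then have "of_real \<xi> * a / a = of_real \<xi>" by simp
    moreover have "\<bar>Re (of_real \<xi> * a)\<bar> < 1" using \<xi> a by simp
    ultimately show "product_defect w (of_real \<xi>) (P w (of_real \<xi>)) = 0"
      using product_defect_strip[OF P a(2,3), of "of_real \<xi> * a"] a(1) by simp
  qed (use \<tau> in auto)
qed

section \<open>Local continuation in both variables\<close>

text \<open>Testing only points with \<open>Im \<tau> > 0\<close> gives the notion a meaning at real
  \<open>\<tau>\<close>, where the formula itself has none, and makes it vacuous below the real
  axis.\<close>

definition defect_vanishes_near :: "(complex \<Rightarrow> complex \<Rightarrow> complex) \<Rightarrow> complex \<times> complex \<Rightarrow> bool" where
  "defect_vanishes_near P w \<longleftrightarrow> (\<exists>e>0. \<forall>\<tau> \<xi>. (\<tau>, \<xi>) \<in> ball w e \<and> Im \<tau> > 0 \<longrightarrow> product_defect \<tau> \<xi> (P \<tau> \<xi>) = 0)"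

text \<open>A compact path joins \<open>\<xi>0\<close> to 1/2 within the cut plane. By compactness a
  tube around it stays in \<open>W\<close> for all \<open>\<tau>\<close> near
  \<open>\<tau>0\<close>, and in the tube the formula is continued in \<open>\<xi>\<close> from a
  real interval next to 1/2.\<close>

lemma defect_vanishes_near_real:
  assumes P: "P_setting W P" and \<tau>0: "Im \<tau>0 = 0" "Re \<tau>0 > 0" and \<xi>0: "\<xi>0 \<notin> real_cuts"
  shows "defect_vanishes_near P (\<tau>0, \<xi>0)"
proof -
  define K where "K = closed_segment 0 \<xi>0 \<union> closed_segment 0 (of_real (1/2))"
  have K: "compact K" "connected K" "\<xi>0 \<in> K" "of_real (1/2) \<in> K"
    unfolding K_def by (auto intro!: compact_Un connected_Un)
  have "K \<subseteq> - real_cuts"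
    unfolding K_def using Compl_real_cuts_segment[OF \<xi>0] Compl_real_cuts_segment[of "of_real (1/2)"]
    by (auto simp: mem_real_cuts_iff)
  then have "{\<tau>0} \<times> K \<subseteq> W" using P \<tau>0 unfolding P_setting_def by blast
  moreover have "compact ({\<tau>0} \<times> K)" by (intro compact_Times K) auto
  moreover have "open W" using P by (simp add: P_setting_def)
  ultimately obtain e where e: "e > 0" "(\<Union>w\<in>{\<tau>0} \<times> K. ball w e) \<subseteq> W"
    using compact_subset_open_imp_ball_epsilon_subset by metis
  \<comment> \<open>Half of \<open>e\<close>, since the distances in \<open>\<tau>\<close> and
    \<open>\<xi>\<close> add up; at most \<open>Re \<tau>0\<close>, so that \<open>\<tau>\<close>
    stays in the right half-plane.\<close>
  define \<epsilon> where "\<epsilon> = min (e / 2) (Re \<tau>0)"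
  have \<epsilon>: "\<epsilon> > 0" "\<epsilon> \<le> e / 2" "\<epsilon> \<le> Re \<tau>0" using e \<tau>0 by (auto simp: \<epsilon>_def)
  define V where "V = (\<Union>k\<in>K. ball k \<epsilon>)"
  have V: "open V" unfolding V_def by auto
  have "connected V"
  proof -
    have "V = K \<union> V" unfolding V_def using \<epsilon> by force
    moreover have "connected (K \<union> (\<Union>k\<in>K. ball k \<epsilon>))"
    proof -
      have "connected (\<Union>k\<in>K. K \<union> ball k \<epsilon>)"
      proof (rule connected_Union)
        show "connected S" if "S \<in> (\<lambda>k. K \<union> ball k \<epsilon>) ` K" for S
          using that K(2) \<epsilon> by (auto intro!: connected_Un)
        show "\<Inter> ((\<lambda>k. K \<union> ball k \<epsilon>) ` K) \<noteq> {}" using K(3) by blast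
      qed
      moreover have "(\<Union>k\<in>K. K \<union> ball k \<epsilon>) = K \<union> (\<Union>k\<in>K. ball k \<epsilon>)" using K(3) by auto
      ultimately show ?thesis by simp
    qed
    ultimately show ?thesis by (simp add: V_def)
  qed
  have VW: "(\<tau>, \<xi>) \<in> W" if "dist \<tau>0 \<tau> < \<epsilon>" "\<xi> \<in> V" for \<tau> \<xi>
  proof -
    obtain k where k: "k \<in> K" "dist k \<xi> < \<epsilon>" using \<open>\<xi> \<in> V\<close> by (auto simp: V_def)
    have "dist (\<tau>0, k) (\<tau>, \<xi>) \<le> dist \<tau>0 \<tau> + dist k \<xi>"
      unfolding dist_Pair_Pair by (rule sqrt_sum_squares_le_sum) auto
    also have "\<dots> < e" using that k \<epsilon> by linarith
    finally have "(\<tau>, \<xi>) \<in> (\<Union>w\<in>{\<tau>0} \<times> K. ball w e)"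
      using k(1) by (intro UN_I[of "(\<tau>0, k)"]) auto
    then show ?thesis using e(2) by blast
  qed
  have main: "product_defect \<tau> \<xi> (P \<tau> \<xi>) = 0" if \<tau>: "dist \<tau>0 \<tau> < \<epsilon>" "Im \<tau> > 0" and \<xi>: "\<xi> \<in> V" for \<tau> \<xi>
  proof -
    have "\<bar>Re (\<tau>0 - \<tau>)\<bar> < Re \<tau>0"
      using abs_Re_le_cmod[of "\<tau>0 - \<tau>"] \<tau>(1) \<epsilon>(3) by (simp add: dist_norm)
    then have re: "Re \<tau> > 0" by simp
    \<comment> \<open>The bound 1/2 keeps the interval inside (0,1), where the quadrant result
      applies.\<close>
    define \<delta> where "\<delta> = min \<epsilon> (1/2)"
    have \<delta>: "0 < \<delta>" "\<delta> \<le> \<epsilon>" "\<delta> \<le> 1/2" using \<epsilon> by (auto simp: \<delta>_def)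
    define U where "U = complex_of_real ` {1/2<..<1/2 + \<delta>}"
    have UV: "U \<subseteq> V"
    proof
      fix u assume "u \<in> U"
      then obtain r where r: "u = of_real r" "1/2 < r" "r < 1/2 + \<delta>" by (auto simp: U_def)
      have "dist (of_real (1/2)) u = \<bar>1/2 - r\<bar>" unfolding r(1) dist_of_real by (simp add: dist_real_def)
      also have "\<dots> < \<epsilon>" using r \<delta> by simp
      finally show "u \<in> V" unfolding V_def using K(4) by auto
    qed
    have lim: "complex_of_real (1/2) islimpt U"
      unfolding islimpt_sequential
    proof (intro exI[of _ "\<lambda>n. complex_of_real (1/2 + \<delta> / real (Suc (Suc n)))"] conjI allI)
      show "complex_of_real (1/2 + \<delta> / real (Suc (Suc n))) \<in> U - {complex_of_real (1/2)}" for n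
      proof -
        have "0 < \<delta> / real (Suc (Suc n))" "\<delta> / real (Suc (Suc n)) < \<delta>"
          using \<delta> by (auto simp: field_simps intro: add_pos_nonneg)
        then show ?thesis unfolding U_def Diff_iff singleton_iff of_real_eq_iff by (intro conjI imageI) auto
      qed
      have "(\<lambda>n. 1/2 + \<delta> / real (Suc (Suc n))) \<longlonglongrightarrow> 1/2" by real_asymp
      then show "(\<lambda>n. complex_of_real (1/2 + \<delta> / real (Suc (Suc n)))) \<longlonglongrightarrow> complex_of_real (1/2)"
        by (rule tendsto_of_real)
    qed
    show ?thesis
    proof (rule analytic_continuation[of "\<lambda>\<xi>. product_defect \<tau> \<xi> (P \<tau> \<xi>)" V U, OF _ V \<open>connected V\<close> UV _ lim _ \<xi>])
      show "(\<lambda>\<xi>. product_defect \<tau> \<xi> (P \<tau> \<xi>)) holomorphic_on V"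
        by (rule P_setting_defect_holomorphic[OF P V]) (use VW \<tau> in \<open>auto intro!: holomorphic_intros\<close>)
      show "complex_of_real (1/2) \<in> V" unfolding V_def using K(4) \<epsilon> by force
      fix u assume "u \<in> U"
      then obtain r where "u = of_real r" "1/2 < r" "r < 1/2 + \<delta>" by (auto simp: U_def)
      then show "product_defect \<tau> u (P \<tau> u) = 0"
        using product_defect_quadrant[OF P re \<tau>(2), of r] \<delta> by simp
    qed
  qed
  show ?thesis unfolding defect_vanishes_near_def
  proof (intro exI[of _ \<epsilon>] conjI allI impI)
    fix \<tau> \<xi> assume *: "(\<tau>, \<xi>) \<in> ball (\<tau>0, \<xi>0) \<epsilon> \<and> Im \<tau> > 0"
    then have "dist \<tau>0 \<tau> < \<epsilon>" "dist \<xi>0 \<xi> < \<epsilon>"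
      using dist_fst_le[of "(\<tau>0, \<xi>0)" "(\<tau>, \<xi>)"] dist_snd_le[of "(\<tau>0, \<xi>0)" "(\<tau>, \<xi>)"] by auto
    moreover from this have "\<xi> \<in> V" unfolding V_def using K(3) by auto
    ultimately show "product_defect \<tau> \<xi> (P \<tau> \<xi>) = 0" using main * by blast
  qed (rule \<epsilon>(1))
qed

text \<open>The complex line through the two points meets the ball in a convex set of parameters, on
  which the one-variable identity theorem applies.\<close>

lemma defect_vanishes_on_ball:
  assumes P: "P_setting W P" and sub: "ball w e \<subseteq> W" and up: "\<And>\<tau> \<xi>. (\<tau>, \<xi>) \<in> ball w e \<Longrightarrow> Im \<tau> > 0"
    and near: "defect_vanishes_near P (t1, x1)" "(t1, x1) \<in> ball w e" and "(t2, x2) \<in> ball w e"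
  shows "product_defect t2 x2 (P t2 x2) = 0"
proof -
  define l where "l = (\<lambda>s::complex. (t1 + s * (t2 - t1), x1 + s * (x2 - x1)))"
  define A where "A = l -` ball w e"
  have contl: "continuous_on UNIV l" unfolding l_def by (intro continuous_intros)
  have A: "open A" unfolding A_def using contl by (intro open_vimage) auto
  have "convex A"
  proof (rule convexI)
    fix s s' :: complex and u v :: real
    assume s: "s \<in> A" "s' \<in> A" and uv: "0 \<le> u" "0 \<le> v" "u + v = 1"
    have v: "v = 1 - u" using uv by simp
    have "l (u *\<^sub>R s + v *\<^sub>R s') = u *\<^sub>R l s + v *\<^sub>R l s'"
      unfolding l_def v by (simp add: scaleR_conv_of_real algebra_simps)
    moreover have "u *\<^sub>R l s + v *\<^sub>R l s' \<in> ball w e"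
      using s uv convex_ball[of w e] unfolding A_def convex_def by blast
    ultimately show "u *\<^sub>R s + v *\<^sub>R s' \<in> A" by (simp add: A_def)
  qed
  then have conn: "connected A" by (rule convex_connected)
  have A01: "0 \<in> A" "1 \<in> A" using near(2) assms(6) by (auto simp: A_def l_def)
  obtain \<epsilon> where \<epsilon>: "\<epsilon> > 0" "\<And>\<tau> \<xi>. (\<tau>, \<xi>) \<in> ball (t1, x1) \<epsilon> \<Longrightarrow> Im \<tau> > 0 \<Longrightarrow> product_defect \<tau> \<xi> (P \<tau> \<xi>) = 0"
    using near(1) unfolding defect_vanishes_near_def by blast
  define U where "U = A \<inter> l -` ball (t1, x1) \<epsilon>"
  have U: "open U" unfolding U_def using contl A by (intro open_Int open_vimage) auto
  have "0 \<in> U" using A01 \<epsilon>(1) by (simp add: U_def l_def)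
  define D where "D = (\<lambda>s. product_defect (t1 + s * (t2 - t1)) (x1 + s * (x2 - x1)) (P (t1 + s * (t2 - t1)) (x1 + s * (x2 - x1))))"
  have "D 1 = 0"
  proof (rule analytic_continuation_open[of U A D "\<lambda>_. 0"])
    show "D holomorphic_on A" unfolding D_def
    proof (rule P_setting_defect_holomorphic[OF P A])
      show "(t1 + s * (t2 - t1), x1 + s * (x2 - x1)) \<in> W" if "s \<in> A" for s
        using that sub by (auto simp: A_def l_def)
      show "Im (t1 + s * (t2 - t1)) > 0" if "s \<in> A" for s
        by (rule up[of _ "x1 + s * (x2 - x1)"]) (use that in \<open>simp add: A_def l_def\<close>)
    qed (intro holomorphic_intros)+
    fix s assume "s \<in> U"
    then show "D s = 0" unfolding D_def U_def A_def l_def using \<epsilon>(2) up by auto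
  qed (use U A conn A01 \<open>0 \<in> U\<close> in \<open>auto simp: U_def\<close>)
  then show ?thesis by (simp add: D_def)
qed

section \<open>Complex conjugation\<close>

definition cnj_pair :: "complex \<times> complex \<Rightarrow> complex \<times> complex" where
  "cnj_pair w = (cnj (fst w), cnj (snd w))"

text \<open>Schwarz reflection: the upper half-plane formula for this function is the conjugate
  formula for \<open>P\<close> over the lower half-plane.\<close>

definition cnj_fun2 :: "(complex \<Rightarrow> complex \<Rightarrow> complex) \<Rightarrow> complex \<Rightarrow> complex \<Rightarrow> complex" where
  "cnj_fun2 P \<tau> \<xi> = cnj (P (cnj \<tau>) (cnj \<xi>))"

lemma cnj_pair_cnj_pair [simp]: "cnj_pair (cnj_pair w) = w"
  by (simp add: cnj_pair_def)

lemma bounded_linear_cnj_pair: "bounded_linear cnj_pair"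
  unfolding cnj_pair_def
  by (intro bounded_linear_Pair bounded_linear_compose[OF bounded_linear_cnj] bounded_linear_fst bounded_linear_snd)

lemma P_int_cnj: "cnj (P_int a z) = P_int (cnj a) (cnj z)"
proof -
  have sinh_cnj: "cnj (sinh w) = sinh (cnj w)" for w
    by (simp add: sinh_def exp_cnj)
  have "cnj (P_int a z) = half_line_integral (\<lambda>r. cnj (sinh (z * of_real r) * of_real (2 * binet_kernel r) * bose_kernel a r))"
    unfolding P_int_def set_lebesgue_integral_def by (subst Bochner_Integration.integral_cnj[symmetric]) simp
  also have "\<dots> = P_int (cnj a) (cnj z)"
    unfolding P_int_def bose_kernel_def by (simp add: sinh_cnj exp_cnj)
  finally show ?thesis .
qed

text \<open>The cuts, the positive axis and the strip are symmetric, \<open>P_int\<close> has real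
  kernels, and conjugating before and after leaves the derivative complex linear, with conjugate
  coefficients.\<close>

lemma P_setting_cnj:
  assumes P: "P_setting W P"
  shows "P_setting (cnj_pair -` W) (cnj_fun2 P)"
proof -
  have cont: "continuous_on UNIV cnj_pair"
    by (rule linear_continuous_on[OF bounded_linear_cnj_pair])
  have 1: "open (cnj_pair -` W)" using P cont by (intro open_vimage) (auto simp: P_setting_def)
  have 2: "cnj_pair -` W \<subseteq> (- \<real>\<^sub>\<le>\<^sub>0) \<times> (- real_cuts)"
  proof
    fix w assume "w \<in> cnj_pair -` W"
    then have "cnj_pair w \<in> (- \<real>\<^sub>\<le>\<^sub>0) \<times> (- real_cuts)" using P unfolding P_setting_def by blast
    then show "w \<in> (- \<real>\<^sub>\<le>\<^sub>0) \<times> (- real_cuts)"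
      by (cases w) (auto simp: cnj_pair_def complex_nonpos_Reals_iff mem_real_cuts_iff)
  qed
  have 3: "holomorphic2_on (cnj_fun2 P) (cnj_pair -` W)"
    unfolding holomorphic2_on_def
  proof
    fix w assume "w \<in> cnj_pair -` W"
    then obtain a b where ab: "((\<lambda>(z, w). P z w) has_derivative (\<lambda>(h, k). a * h + b * k)) (at (cnj_pair w))"
      using P unfolding P_setting_def holomorphic2_on_def by blast
    have "(cnj_pair has_derivative cnj_pair) (at w)"
      by (rule bounded_linear_imp_has_derivative[OF bounded_linear_cnj_pair])
    from bounded_linear.has_derivative[OF bounded_linear_cnj has_derivative_compose[OF this ab]]
    have "((\<lambda>w. cnj ((\<lambda>(z, w). P z w) (cnj_pair w))) has_derivative (\<lambda>h. cnj ((\<lambda>(h, k). a * h + b * k) (cnj_pair h)))) (at w)" .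
    moreover have "(\<lambda>w. cnj ((\<lambda>(z, w). P z w) (cnj_pair w))) = (\<lambda>(z, w). cnj_fun2 P z w)"
      by (auto simp: fun_eq_iff cnj_pair_def cnj_fun2_def)
    moreover have "(\<lambda>h. cnj ((\<lambda>(h, k). a * h + b * k) (cnj_pair h))) = (\<lambda>(h, k). cnj a * h + cnj b * k)"
      by (auto simp: fun_eq_iff cnj_pair_def)
    ultimately show "\<exists>a b. ((\<lambda>(z, w). cnj_fun2 P z w) has_derivative (\<lambda>(h, k). a * h + b * k)) (at w)" by auto
  qed
  have 4: "(\<tau>, \<xi>) \<in> cnj_pair -` W" if "Im \<tau> = 0" "Re \<tau> > 0" "\<xi> \<notin> real_cuts" for \<tau> \<xi>
  proof -
    have "Im (cnj \<tau>) = 0 \<and> Re (cnj \<tau>) > 0 \<and> cnj \<xi> \<notin> real_cuts" using that by (simp add: mem_real_cuts_iff)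
    then have "(cnj \<tau>, cnj \<xi>) \<in> W" using P unfolding P_setting_def by blast
    then show ?thesis by (simp add: cnj_pair_def)
  qed
  have 5: "(\<tau>, \<xi>) \<in> cnj_pair -` W" if "Re \<tau> > 0" "\<bar>Re (\<xi> / \<tau>)\<bar> < Re (1 / \<tau>)" for \<tau> \<xi>
  proof -
    have "Re (cnj \<xi> / cnj \<tau>) = Re (\<xi> / \<tau>)" "Re (1 / cnj \<tau>) = Re (1 / \<tau>)"
      by (simp_all add: Re_divide)
    then have "Re (cnj \<tau>) > 0 \<and> \<bar>Re (cnj \<xi> / cnj \<tau>)\<bar> < Re (1 / cnj \<tau>)" using that by simp
    then have "(cnj \<tau>, cnj \<xi>) \<in> W" using P unfolding P_setting_def by blast
    then show ?thesis by (simp add: cnj_pair_def)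
  qed
  have 6: "cnj_fun2 P (1 / a) (z / a) = P_int a z" if "Re a = 1" "\<bar>Re z\<bar> < 1" for a z
  proof -
    have "Re (cnj a) = 1 \<and> \<bar>Re (cnj z)\<bar> < 1" using that by simp
    then have "P (1 / cnj a) (cnj z / cnj a) = P_int (cnj a) (cnj z)" using P unfolding P_setting_def by blast
    then show ?thesis by (simp add: cnj_fun2_def P_int_cnj)
  qed
  show ?thesis unfolding P_setting_def using 1 2 3 4 5 6 by blast
qed

section \<open>The rays and the domains on which they converge\<close>

text \<open>The substitution t = - i r turns sine and cotangent into their hyperbolic
  counterparts.\<close>

lemma P_ray_eq_P_int:
  assumes a: "Re a = 1" and z: "\<bar>Re z\<bar> < 1"
  shows "P_ray (- pi / 2) (1 / a) (z / a) = P_int a z"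
proof -
  define f where "f = (\<lambda>r. sinh (z * of_real r) * of_real (2 * binet_kernel r) * bose_kernel a r)"
  define g where "g = (\<lambda>r. let t = of_real r * cis (- pi / 2) in
     sin (z / a / (1 / a) * t) / (exp (\<i> * t / (1 / a)) - 1) * (cot (t / 2) - 2 / t) / t * cis (- pi / 2))"
  have a0: "a \<noteq> 0" using a by auto
  have fg: "g r = f r" if r: "r > 0" for r
  proof -
    define t where "t = - (\<i> * complex_of_real r)"
    have t0: "t \<noteq> 0" using r by (simp add: t_def)
    have c: "cis (- pi / 2) = - \<i>" by (simp add: complex_eq_iff)
    define E where "E = exp (complex_of_real (r / 2))"
    have E0: "E \<noteq> 0" by (simp add: E_def)
    have EE: "E * E = exp (complex_of_real r)" unfolding E_def mult_exp_exp by (simp flip: of_real_add)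
    have E1: "E * E - 1 \<noteq> 0"
    proof -
      have "exp r \<noteq> 1" using r by simp
      then have "complex_of_real (exp r) \<noteq> 1" by (metis of_real_eq_1_iff)
      then show ?thesis unfolding EE exp_of_real by simp
    qed
    have s: "sin (z * t) = - \<i> * sinh (z * of_real r)"
    proof -
      have eq: "\<i> * (z * t) = z * of_real r" by (simp add: t_def complex_eq_iff)
      show ?thesis unfolding sin_exp_eq eq by (simp add: sinh_def scaleR_conv_of_real)
    qed
    have ct: "cot (t / 2) = \<i> * ((E * E + 1) / (E * E - 1))"
    proof -
      have "\<i> * (t / 2) = of_real (r / 2)" by (simp add: t_def)
      then have "sin (t / 2) = (E - inverse E) / (2 * \<i>)" "cos (t / 2) = (E + inverse E) / 2"
        unfolding sin_exp_eq cos_exp_eq by (simp_all add: E_def exp_minus)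
      then have "cot (t / 2) = ((E + inverse E) / 2) / ((E - inverse E) / (2 * \<i>))" by (simp only: cot_def)
      also have "\<dots> = \<i> * ((E + inverse E) / (E - inverse E))"
      proof -
        have "(X / 2) / (Y / (2 * \<i>)) = \<i> * (X / Y)" for X Y :: complex
          by (simp only: divide_divide_eq_right) (simp add: mult_ac)
        then show ?thesis .
      qed
      also have "(E + inverse E) / (E - inverse E) = (E * E + 1) / (E * E - 1)"
      proof -
        have "E - inverse E \<noteq> 0" using E0 E1 by (simp add: field_simps)
        then show ?thesis using E0 E1 by (simp add: field_simps)
      qed
      finally show ?thesis .
    qed
    have k: "complex_of_real (2 * binet_kernel r) = (E * E + 1) / (E * E - 1) - 2 / of_real r"
    proof -
      have "complex_of_real (2 * binet_kernel r) = 1 - 2 / of_real r + 2 / (E * E - 1)"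
        unfolding EE by (simp add: binet_kernel_def exp_of_real)
      also have "\<dots> = (E * E + 1) / (E * E - 1) - 2 / of_real r" using E1 by (simp add: field_simps)
      finally show ?thesis .
    qed
    have b: "cot (t / 2) - 2 / t = \<i> * of_real (2 * binet_kernel r)"
    proof -
      have "2 / t = \<i> * (2 / of_real r)"
        using t0 r by (subst nonzero_divide_eq_eq) (simp_all add: t_def complex_eq_iff)
      then show ?thesis unfolding ct k by (simp only: right_diff_distrib)
    qed
    have ti: "(- \<i>) / t = 1 / of_real r"
      using t0 r by (subst nonzero_divide_eq_eq) (simp_all add: t_def)
    \<comment> \<open>Collects the factors from the sine, the cotangent bracket and the direction of
      the ray; what is left over is (- i)/t = 1/r.\<close>
    have gen: "(- \<i> * S) / D * (\<i> * B) / t * (- \<i>) = S * B / D * ((- \<i>) / t)" for S D B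
    proof -
      have "(- \<i> * S) / D * (\<i> * B) / t * (- \<i>) = - (\<i> * \<i>) * (S * B / D * ((- \<i>) / t))"
        unfolding divide_inverse by (simp only: mult_ac mult_minus_left mult_minus_right minus_minus)
      then show ?thesis by simp
    qed
    have e: "\<i> * t / (1 / a) = a * of_real r" by (simp add: t_def)
    have w: "z / a / (1 / a) = z" using a0 by simp
    have "g r = sin (z * t) / (exp (a * of_real r) - 1) * (cot (t / 2) - 2 / t) / t * (- \<i>)"
      unfolding g_def Let_def c w e[symmetric] by (simp add: t_def mult.commute)
    also have "\<dots> = f r"
      unfolding s b gen ti f_def bose_kernel_def by simp
    finally show ?thesis .
  qed
  have "P_ray (- pi / 2) (1 / a) (z / a) = integral {0..} g" unfolding P_ray_def g_def ..
  \<comment> \<open>The endpoint 0 is negligible; afterwards the gauge integral becomes a Lebesgue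
    integral by absolute integrability.\<close>
  also have "\<dots> = integral {0<..} g"
    by (rule integral_spike_set) (auto intro: negligible_subset[of "{0}"])
  also have "\<dots> = integral {0<..} f" by (rule integral_cong) (use fg in auto)
  also have "\<dots> = P_int a z"
    unfolding P_int_def f_def using set_borel_integral_eq_integral(2)[OF P_int_integrable[OF a z]] by simp
  finally show ?thesis .
qed

text \<open>For real positive \<open>\<tau>\<close> the ray may be adapted to \<open>\<xi>\<close>:
  a non-real \<open>\<xi>\<close> is rotated onto the real axis by the argument of
  \<open>\<xi>\<close> or \<open>- \<xi>\<close>, and a real one has modulus below 1 =
  sin(pi/2).\<close>

lemma real_pos_in_Omega_ray:
  assumes "Im \<tau> = 0" "Re \<tau> > 0" "\<xi> \<notin> real_cuts"
  shows "\<exists>d\<in>{-pi<..<0}. (\<tau>, \<xi>) \<in> Omega_ray d"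
proof -
  have "\<tau> = of_real (Re \<tau>)" using assms(1) by (simp add: complex_eq_iff)
  then have \<tau>: "Arg \<tau> = 0" "\<tau> \<noteq> 0" using assms(2) Arg_of_real[of "Re \<tau>"] by auto
  have "\<exists>\<sigma>\<in>{0<..<pi}. \<bar>Im (\<xi> * cis (- \<sigma>))\<bar> < sin \<sigma>"
  proof (cases "Im \<xi> = 0")
    case True
    then have "\<bar>Re \<xi>\<bar> < 1" using assms(3) by (auto simp: mem_real_cuts_iff)
    then show ?thesis by (intro bexI[of _ "pi / 2"]) auto
  next
    case False
    define w where "w = (if Im \<xi> > 0 then \<xi> else - \<xi>)"
    have w: "Im w > 0" using False by (auto simp: w_def)
    then have "w \<noteq> 0" by auto
    have \<sigma>: "0 < Arg w" "Arg w < pi"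
      using Im_Ln_pos_lt_imp[OF w] Arg_eq_Im_Ln[OF \<open>w \<noteq> 0\<close>] by auto
    have "w * cis (- Arg w) = of_real (norm w)"
    proof -
      have "w = of_real (norm w) * cis (Arg w)" using rcis_cmod_Arg[of w] by (simp add: rcis_def)
      then have "w * cis (- Arg w) = of_real (norm w) * (cis (Arg w) * cis (- Arg w))" by (metis mult.assoc)
      then show ?thesis by (simp add: cis_mult)
    qed
    then have "Im (w * cis (- Arg w)) = 0" by simp
    then have "Im (\<xi> * cis (- Arg w)) = 0" by (auto simp: w_def split: if_splits)
    then show ?thesis using \<sigma> sin_gt_zero[OF \<sigma>] by (intro bexI[of _ "Arg w"]) auto
  qed
  then obtain \<sigma> where \<sigma>: "\<sigma> \<in> {0<..<pi}" "\<bar>Im (\<xi> * cis (- \<sigma>))\<bar> < sin \<sigma>" by blast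
  then have "(\<tau>, \<xi>) \<in> Omega_ray (- \<sigma>)" unfolding Omega_ray_def using \<tau> by (intro UN_I[of \<sigma>]) auto
  then show ?thesis using \<sigma> by (intro bexI[of _ "- \<sigma>"]) auto
qed

text \<open>For \<open>\<sigma> = Arg \<tau> + pi / 2\<close> the two sides of the defining
  inequality are the norm of \<open>\<tau>\<close> times
  \<open>\<bar>Re (\<xi> / \<tau>)\<bar>\<close> and times \<open>Re (1 / \<tau>)\<close>.\<close>

lemma strip_in_Omega_ray:
  assumes "Re \<tau> > 0" "\<bar>Re (\<xi> / \<tau>)\<bar> < Re (1 / \<tau>)"
  shows "(\<tau>, \<xi>) \<in> Omega_ray (- pi / 2)"
proof -
  have t0: "\<tau> \<noteq> 0" using assms by auto
  have A: "\<bar>Arg \<tau>\<bar> < pi / 2" using Re_Ln_pos_lt_imp[OF assms(1)] Arg_eq_Im_Ln[OF t0] by simp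
  define \<sigma> where "\<sigma> = Arg \<tau> + pi / 2"
  have \<sigma>: "\<sigma> \<in> {0<..<pi}" using A by (auto simp: \<sigma>_def)
  have cisA: "cis (- Arg \<tau>) = of_real (norm \<tau>) / \<tau>"
  proof -
    have "\<tau> = of_real (norm \<tau>) * cis (Arg \<tau>)" using rcis_cmod_Arg[of \<tau>] by (simp add: rcis_def)
    then have "\<tau> * cis (- Arg \<tau>) = of_real (norm \<tau>) * (cis (Arg \<tau>) * cis (- Arg \<tau>))" by (metis mult.assoc)
    then show ?thesis using t0 by (simp add: cis_mult field_simps)
  qed
  have "cis (- \<sigma>) = cis (- Arg \<tau>) * (- \<i>)"
  proof -
    have "cis (- \<sigma>) = cis (- Arg \<tau>) * cis (- pi / 2)" unfolding cis_mult by (simp add: \<sigma>_def)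
    also have "cis (- pi / 2) = - \<i>" by (simp add: complex_eq_iff)
    finally show ?thesis .
  qed
  then have "\<xi> * cis (- \<sigma>) = - \<i> * (of_real (norm \<tau>) * (\<xi> / \<tau>))" by (simp add: cisA)
  moreover have "Im (- \<i> * v) = - Re v" for v by simp
  ultimately have "Im (\<xi> * cis (- \<sigma>)) = - Re (of_real (norm \<tau>) * (\<xi> / \<tau>))" by (simp only:)
  also have "Re (of_real (norm \<tau>) * (\<xi> / \<tau>)) = norm \<tau> * Re (\<xi> / \<tau>)" by (simp add: Re_divide ring_distribs)
  finally have 1: "\<bar>Im (\<xi> * cis (- \<sigma>))\<bar> = norm \<tau> * \<bar>Re (\<xi> / \<tau>)\<bar>" by (simp add: abs_mult)
  have "sin \<sigma> = cos (Arg \<tau>)" by (simp add: \<sigma>_def sin_add)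
  also have "\<dots> = Re (cis (- Arg \<tau>))" by simp
  also have "\<dots> = norm \<tau> * Re (1 / \<tau>)" unfolding cisA by (simp add: Re_divide)
  finally have "\<bar>Im (\<xi> * cis (- \<sigma>))\<bar> < sin \<sigma>" unfolding 1 using assms(2) t0 by simp
  then show ?thesis unfolding Omega_ray_def using \<sigma> t0 by (intro UN_I[of \<sigma>]) (auto simp: \<sigma>_def)
qed

lemma P_settingI:
  assumes "is_P_minus_on W P"
  shows "P_setting W P"
proof -
  have sub: "(\<Union>d\<in>{-pi<..<0}. Omega_ray d) \<subseteq> W"
    and ray: "\<And>d \<tau> \<xi>. d \<in> {-pi<..<0} \<Longrightarrow> (\<tau>, \<xi>) \<in> Omega_ray d \<Longrightarrow> P \<tau> \<xi> = P_ray d \<tau> \<xi>"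
    using assms unfolding is_P_minus_on_def by blast+
  have d: "- pi / 2 \<in> {-pi<..<0}" by simp
  have 1: "(\<tau>, \<xi>) \<in> W" if "Im \<tau> = 0" "Re \<tau> > 0" "\<xi> \<notin> real_cuts" for \<tau> \<xi>
    using real_pos_in_Omega_ray[OF that] sub by blast
  have 2: "(\<tau>, \<xi>) \<in> W" if "Re \<tau> > 0" "\<bar>Re (\<xi> / \<tau>)\<bar> < Re (1 / \<tau>)" for \<tau> \<xi>
    using strip_in_Omega_ray[OF that] sub d by blast
  have 3: "P (1 / a) (z / a) = P_int a z" if "Re a = 1" "\<bar>Re z\<bar> < 1" for a z
  proof -
    have a0: "a \<noteq> 0" using that by auto
    have "Re (1 / a) > 0" using that by (simp add: Re_divide add_pos_nonneg)
    moreover have "\<bar>Re (z / a / (1 / a))\<bar> < Re (1 / (1 / a))" using that a0 by simp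
    ultimately have "(1 / a, z / a) \<in> Omega_ray (- pi / 2)" by (rule strip_in_Omega_ray)
    then show ?thesis using ray[OF d] P_ray_eq_P_int[OF that] by simp
  qed
  show ?thesis unfolding P_setting_def using assms 1 2 3 unfolding is_P_minus_on_def by blast
qed

text \<open>
  The part of \<open>W\<close> over the upper half-plane need not be connected, so the identity theorem is applied
  on all of \<open>W\<close>, with the complex conjugate formula over the lower half-plane. The two are linked
  across the positive real axis, where neither formula makes sense, because both hold near each of its
  points by continuation in \<open>\<xi>\<close> from the strip where the integral converges.
\<close>

lemma product_defect_eq_0:
  assumes W: "is_P_minus_on W P" and w: "(\<tau>, \<xi>) \<in> W" "Im \<tau> > 0"
  shows "product_defect \<tau> \<xi> (P \<tau> \<xi>) = 0"
proof -
  note P = P_settingI[OF W]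
  note P' = P_setting_cnj[OF P]
  have openW: "open W" and connW: "connected W" and Wsub: "W \<subseteq> (- \<real>\<^sub>\<le>\<^sub>0) \<times> (- real_cuts)"
    using W unfolding is_P_minus_on_def by auto
  \<comment> \<open>Over the upper half-plane the second condition is vacuous, over the lower one
    the first; over the positive real axis both have content.\<close>
  define good where "good = (\<lambda>w. defect_vanishes_near P w \<and> defect_vanishes_near (cnj_fun2 P) (cnj_pair w))"
  have cnj_ball: "cnj_pair u \<in> ball (cnj_pair w) e \<longleftrightarrow> u \<in> ball w e" for u w e
    by (cases u; cases w) (simp add: cnj_pair_def dist_norm norm_Pair flip: complex_cnj_diff)
  have near_open: "\<exists>e>0. \<forall>u\<in>ball w e. defect_vanishes_near Q u" if near: "defect_vanishes_near Q w" for Q w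
  proof -
    obtain e where e: "e > 0" "\<And>\<tau> \<xi>. (\<tau>, \<xi>) \<in> ball w e \<Longrightarrow> Im \<tau> > 0 \<Longrightarrow> product_defect \<tau> \<xi> (Q \<tau> \<xi>) = 0"
      using near unfolding defect_vanishes_near_def by blast
    have "defect_vanishes_near Q u" if u: "u \<in> ball w e" for u
    proof -
      obtain e' where "e' > 0" "ball u e' \<subseteq> ball w e" using u openE[OF open_ball] by metis
      then show ?thesis unfolding defect_vanishes_near_def using e(2) by blast
    qed
    then show ?thesis using e(1) by blast
  qed
  have good_open: "\<exists>e>0. \<forall>u\<in>ball w e. good u" if "good w" for w
  proof -
    have near: "defect_vanishes_near P w" "defect_vanishes_near (cnj_fun2 P) (cnj_pair w)"
      using that unfolding good_def by blast+
    obtain e1 where e1: "e1 > 0" "\<And>u. u \<in> ball w e1 \<Longrightarrow> defect_vanishes_near P u"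
      using near_open[OF near(1)] by blast
    obtain e2 where e2: "e2 > 0" "\<And>u. u \<in> ball (cnj_pair w) e2 \<Longrightarrow> defect_vanishes_near (cnj_fun2 P) u"
      using near_open[OF near(2)] by blast
    have "good u" if "u \<in> ball w (min e1 e2)" for u
      using e1(2)[of u] e2(2)[of "cnj_pair u"] that cnj_ball[of u w e2] by (auto simp: good_def)
    then show ?thesis using e1(1) e2(1) by (intro exI[of _ "min e1 e2"]) auto
  qed
  \<comment> \<open>In a ball over the upper half-plane, vanishing near one point spreads to the
    centre, so points near a bad point are bad. Conjugate points lie below the axis, where nothing
    is tested.\<close>
  have upper: "\<exists>e>0. \<forall>u\<in>ball w e. defect_vanishes_near Q u \<longrightarrow> defect_vanishes_near Q w \<and> (\<forall>v\<in>ball w e. defect_vanishes_near (cnj_fun2 Q) (cnj_pair v))"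
    if Q: "P_setting V Q" and w: "w \<in> V" "Im (fst w) > 0" for V Q w
  proof -
    have "open (V \<inter> {w. Im (fst w) > 0})"
      using Q by (intro open_Int open_Collect_less continuous_intros) (auto simp: P_setting_def)
    then obtain e where e: "e > 0" "ball w e \<subseteq> V \<inter> {w. Im (fst w) > 0}"
      using w by (metis (mono_tags, lifting) IntI mem_Collect_eq openE)
    have up: "Im \<tau> > 0" if "(\<tau>, \<xi>) \<in> ball w e" for \<tau> \<xi> using e(2) that by auto
    have "defect_vanishes_near Q w" if u: "u \<in> ball w e" "defect_vanishes_near Q u" for u
    proof -
      have "product_defect \<tau> \<xi> (Q \<tau> \<xi>) = 0" if "(\<tau>, \<xi>) \<in> ball w e" for \<tau> \<xi>
        by (rule defect_vanishes_on_ball[where w = w and e = e and ?t1.0 = "fst u" and ?x1.0 = "snd u", OF Q _ up])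
           (use e(2) u that in auto)
      then show ?thesis unfolding defect_vanishes_near_def using e(1) by blast
    qed
    moreover have "defect_vanishes_near (cnj_fun2 Q) (cnj_pair v)" if v: "v \<in> ball w e" for v
    proof -
      obtain e' where e': "e' > 0" "ball v e' \<subseteq> ball w e" using v openE[OF open_ball] by metis
      have False if "(\<tau>, \<xi>) \<in> ball (cnj_pair v) e'" "Im \<tau> > 0" for \<tau> \<xi>
      proof -
        have "cnj_pair (\<tau>, \<xi>) \<in> ball v e'" using cnj_ball[of "cnj_pair (\<tau>, \<xi>)" v e'] that(1) by simp
        then have "(cnj \<tau>, cnj \<xi>) \<in> ball w e" using e'(2) by (auto simp: cnj_pair_def)
        from up[OF this] show False using that(2) by simp
      qed
      then show ?thesis unfolding defect_vanishes_near_def using e'(1) by blast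
    qed
    ultimately show ?thesis using e(1) by blast
  qed
  have cc: "cnj_fun2 (cnj_fun2 P) = P" by (simp add: cnj_fun2_def fun_eq_iff)
  have bad_open: "\<exists>e>0. \<forall>u\<in>ball w e. \<not> good u" if w: "w \<in> W" "\<not> good w" for w
  proof -
    consider "Im (fst w) = 0" | "Im (fst w) > 0" | "Im (fst w) < 0" by linarith
    then show ?thesis
    proof cases
      case 1
      have *: "fst w \<notin> \<real>\<^sub>\<le>\<^sub>0" "snd w \<notin> real_cuts" using Wsub w(1) by (auto simp: mem_Times_iff)
      then have re: "Re (fst w) > 0" using 1 by (auto simp: complex_nonpos_Reals_iff)
      \<comment> \<open>Every point over the positive axis is good, for \<open>P\<close> and for its
        conjugate, so no bad point lies there.\<close>
      have "defect_vanishes_near P w" using defect_vanishes_near_real[OF P 1 re *(2)] by simp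
      moreover have "defect_vanishes_near (cnj_fun2 P) (cnj_pair w)"
        unfolding cnj_pair_def using defect_vanishes_near_real[OF P', of "cnj (fst w)" "cnj (snd w)"] 1 re *(2)
        by (simp add: mem_real_cuts_iff)
      ultimately show ?thesis using w(2) by (simp add: good_def)
    next
      case 2
      obtain e where e: "e > 0" "\<forall>u\<in>ball w e. defect_vanishes_near P u \<longrightarrow> defect_vanishes_near P w \<and> (\<forall>v\<in>ball w e. defect_vanishes_near (cnj_fun2 P) (cnj_pair v))"
        using upper[OF P w(1) 2] by blast
      have "w \<in> ball w e" using e(1) by simp
      then have "\<not> good u" if "u \<in> ball w e" for u using e(2) that w(2) unfolding good_def by blast
      then show ?thesis using e(1) by blast
    next
      case 3
      have "cnj_pair w \<in> cnj_pair -` W" "Im (fst (cnj_pair w)) > 0" using w 3 by (simp_all, simp add: cnj_pair_def)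
      from upper[OF P' this]
      obtain e where e: "e > 0" "\<forall>u\<in>ball (cnj_pair w) e. defect_vanishes_near (cnj_fun2 P) u \<longrightarrow>
          defect_vanishes_near (cnj_fun2 P) (cnj_pair w) \<and> (\<forall>v\<in>ball (cnj_pair w) e. defect_vanishes_near P (cnj_pair v))"
        unfolding cc by blast
      have "\<not> good u" if u: "u \<in> ball w e" for u
      proof
        assume "good u"
        then have "defect_vanishes_near (cnj_fun2 P) (cnj_pair u)" by (simp add: good_def)
        moreover have "cnj_pair u \<in> ball (cnj_pair w) e" using u cnj_ball by blast
        ultimately have "defect_vanishes_near (cnj_fun2 P) (cnj_pair w)" "\<forall>v\<in>ball (cnj_pair w) e. defect_vanishes_near P (cnj_pair v)"
          using e(2) by blast+
        moreover have "cnj_pair w \<in> ball (cnj_pair w) e" using e(1) by simp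
        ultimately have "defect_vanishes_near P (cnj_pair (cnj_pair w))" by blast
        then show False using w(2) \<open>defect_vanishes_near (cnj_fun2 P) (cnj_pair w)\<close> by (simp add: good_def)
      qed
      then show ?thesis using e(1) by blast
    qed
  qed
  define S where "S = {w\<in>W. good w}"
  have "open S"
    unfolding open_contains_ball
  proof
    fix w assume "w \<in> S"
    then have "w \<in> W" "good w" by (auto simp: S_def)
    then obtain e1 e2 where "e1 > 0" "ball w e1 \<subseteq> W" "e2 > 0" "\<forall>u\<in>ball w e2. good u"
      using good_open openW by (meson open_contains_ball)
    then show "\<exists>e>0. ball w e \<subseteq> S" by (intro exI[of _ "min e1 e2"]) (auto simp: S_def)
  qed
  moreover have "open (W - S)"
    unfolding open_contains_ball
  proof
    fix w assume "w \<in> W - S"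
    then have "w \<in> W" "\<not> good w" by (auto simp: S_def)
    then obtain e1 e2 where "e1 > 0" "ball w e1 \<subseteq> W" "e2 > 0" "\<forall>u\<in>ball w e2. \<not> good u"
      using bad_open openW by (meson open_contains_ball)
    then show "\<exists>e>0. ball w e \<subseteq> W - S" by (intro exI[of _ "min e1 e2"]) (auto simp: S_def)
  qed
  moreover have "(1, 0) \<in> S"
  proof -
    have m: "(1, 0) \<in> W" using P unfolding P_setting_def by (auto simp: mem_real_cuts_iff)
    have "defect_vanishes_near P (1, 0)" "defect_vanishes_near (cnj_fun2 P) (cnj_pair (1, 0))"
      using defect_vanishes_near_real[OF P, of 1 0] defect_vanishes_near_real[OF P', of 1 0]
      by (auto simp: mem_real_cuts_iff cnj_pair_def)
    then show ?thesis using m by (simp add: S_def good_def)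
  qed
  ultimately have "W - S = {}"
    using connectedD[OF connW, of S "W - S"] by (auto simp: S_def)
  then have "good (\<tau>, \<xi>)" using w(1) by (auto simp: S_def)
  then show ?thesis using w(2) unfolding good_def defect_vanishes_near_def by auto
qed

theorem theorem6:
  fixes \<tau> \<xi> q x q' x' :: complex
    and W :: "(complex \<times> complex) set"
    and P :: "complex \<Rightarrow> complex \<Rightarrow> complex"
  assumes "Im \<tau> > 0"
    and "\<xi> \<notin> real_cuts"
    and "\<xi> / \<tau> \<notin> \<real>\<^sub>\<le>\<^sub>0"
    and "is_P_minus_on W P"
    and "(\<tau>, \<xi>) \<in> W"
    and "q = exp (2 * of_real pi * \<i> * \<tau>)"
    and "x = exp (2 * of_real pi * \<i> * \<xi>)"
    and "q' = exp (- 2 * of_real pi * \<i> / \<tau>)"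
    and "x' = exp (2 * of_real pi * \<i> * \<xi> / \<tau>)"
  shows "qpoch_inf x q =
      exp (- of_real pi * \<i> * \<tau> / 12) * sqrt_one_minus_x \<tau> \<xi> * qpoch_inf (x' * q') q' *
      exp (Li2_x \<tau> \<xi> / (2 * of_real pi * \<i> * \<tau>) + G_fun \<tau> \<xi> + P \<tau> \<xi>)"
proof -
  have q': "q' = exp (2 * of_real pi * \<i> * (- (1 / \<tau>)))" unfolding assms(8) by simp
  have "x' * q' = exp (2 * of_real pi * \<i> * ((\<xi> - 1) / \<tau>))"
    unfolding assms(8,9) mult_exp_exp by (simp add: diff_divide_distrib ring_distribs)
  with q' have "qpoch_inf x q = exp (- of_real pi * \<i> * \<tau> / 12) * qpoch_inf (x' * q') q' *
      (rGamma (\<xi> / \<tau>) * exp (H_fun \<tau> \<xi> + P \<tau> \<xi>))"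
    using product_defect_eq_0[OF assms(4,5,1)] unfolding product_defect_def assms(6,7) by simp
  then show ?thesis
    unfolding exp_prefactor[OF assms(1-3), symmetric] by (simp only: mult_ac)
qed

end
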